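(* Let $\beta=2/\log(e/2)\approx 6.51778$, and let $w(n)$ be any function with $w(n)\to\infty$. (i) If $p(n-1)=\beta(\log n-\tfrac12\log\log n)-w(n)$, then a.a.s. $\delta(\mathcal G(n,p))\le \lfloor m(\mathcal G(n,p))/(n-1)\rfloor$, and hence $T(\mathcal G(n,p))=\delta(\mathcal G(n,p))$. (ii) If $p(n-1)=\beta(\log n-\tfrac12\log\log n)+w(n)$, then a.a.s. $\delta(\mathcal G(n,p))> \lfloor m(\mathcal G(n,p))/(n-1)\rfloor$, and hence $T(\mathcal G(n,p))=\lfloor m(\mathcal G(n,p))/(n-1)\rfloor$.
   Context: $\mathcal G(n,p)$ is the Erdős–Rényi random graph on $[n]$ with each edge present independently with probability $p=p(n)$; "a.a.s." means with probability tending to $1$ as $n\to\infty$; $\log$ is the natural logarithm. For a graph $G$, $m(G)$ is its number of edges, $\delta(G)$ its minimum degree, and $T(G)$ the maximum number of pairwise edge-disjoint spanning trees of $G$. *)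

theory Defs
  imports Complex_Main
begin

text \<open>Simple graphs on the vertex set [n] = {1..n}, represented by their edge set,
  a set of 2-element subsets of {1..n}.\<close>

definition all_edges :: "nat \<Rightarrow> nat set set" where
  "all_edges n = {e. e \<subseteq> {1..n} \<and> card e = 2}"

text \<open>Erdos--Renyi random graph G(n,p): probability that the random edge set satisfies P.\<close>
definition gnp_prob :: "nat \<Rightarrow> real \<Rightarrow> (nat set set \<Rightarrow> bool) \<Rightarrow> real" where
  "gnp_prob n p P =
     (\<Sum>E\<in>{E. E \<subseteq> all_edges n \<and> P E}.
        p ^ card E * (1 - p) ^ (card (all_edges n) - card E))"

text \<open>a.a.s.: probability tends to 1 as n tends to infinity.\<close>
definition aas :: "(nat \<Rightarrow> real) \<Rightarrow> (nat \<Rightarrow> nat set set \<Rightarrow> bool) \<Rightarrow> bool" where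
  "aas p P \<longleftrightarrow> ((\<lambda>n. gnp_prob n (p n) (P n)) \<longlonglongrightarrow> 1)"

definition num_edges :: "nat set set \<Rightarrow> nat" where
  "num_edges E = card E"

definition degree :: "nat set set \<Rightarrow> nat \<Rightarrow> nat" where
  "degree E v = card {e\<in>E. v \<in> e}"

definition min_degree :: "nat \<Rightarrow> nat set set \<Rightarrow> nat" where
  "min_degree n E = Min (degree E ` {1..n})"

definition adj_rel :: "nat set set \<Rightarrow> (nat \<times> nat) set" where
  "adj_rel F = {(u, v). {u, v} \<in> F}"

definition connected_on :: "nat \<Rightarrow> nat set set \<Rightarrow> bool" where
  "connected_on n F \<longleftrightarrow> (\<forall>u\<in>{1..n}. \<forall>v\<in>{1..n}. (u, v) \<in> (adj_rel F)\<^sup>*)"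

text \<open>A cycle: at least 3 distinct vertices, cyclically consecutive ones adjacent.\<close>
definition has_cycle :: "nat set set \<Rightarrow> bool" where
  "has_cycle F \<longleftrightarrow> (\<exists>vs. length vs \<ge> 3 \<and> distinct vs \<and>
      (\<forall>i<length vs. {vs ! i, vs ! ((i + 1) mod length vs)} \<in> F))"

definition spanning_tree :: "nat \<Rightarrow> nat set set \<Rightarrow> nat set set \<Rightarrow> bool" where
  "spanning_tree n E F \<longleftrightarrow> F \<subseteq> E \<and> connected_on n F \<and> \<not> has_cycle F"

text \<open>Maximum number of pairwise edge-disjoint spanning trees.\<close>
definition tree_packing :: "nat \<Rightarrow> nat set set \<Rightarrow> nat" where
  "tree_packing n E = Max {k. \<exists>F :: nat \<Rightarrow> nat set set.
      (\<forall>i<k. spanning_tree n E (F i)) \<and>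
      (\<forall>i<k. \<forall>j<k. i \<noteq> j \<longrightarrow> F i \<inter> F j = {})}"

definition beta_const :: real where
  "beta_const = 2 / ln (exp 1 / 2)"

end

theory Submission
  imports Defs "HOL-Analysis.Harmonic_Numbers" "HOL-Real_Asymp.Real_Asymp"
begin

text \<open>Let \<open>r = m / (n - 1)\<close> and let \<open>t\<close> be the smaller of the minimum degree and \<open>r\<close>, rounded down.
  Both are upper bounds for the number of disjoint spanning trees. By the Nash-Williams--Tutte theorem
  \<open>t\<close> trees exist if every partition into \<open>P\<close> classes has at least \<open>t (P - 1)\<close> crossing edges.
  If all classes have at most \<open>0.99 n\<close> vertices, this follows from every such class spanning at most
  \<open>r (s - 1)\<close> edges, where \<open>s\<close> is its size. Otherwise it suffices that the complement \<open>U\<close> of the huge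
  class has a boundary of at least \<open>t |U|\<close> edges. A minimal counterexample \<open>U\<close> to the latter has at
  least two vertices and no isolated ones, so it spans at least \<open>|U| / 2\<close> edges; since this is
  independent of its boundary being small, a union bound over all \<open>U\<close> succeeds, for all densities
  down to \<open>0.97 log n / n\<close>. For smaller densities there are isolated vertices.

  The position of the minimum degree relative to \<open>r\<close>, which is about \<open>n p / 2\<close>, is decided by the first
  moment (above the threshold) and the second moment (below it) of the number of vertices of degree at
  most \<open>n p / 2\<close>. With \<open>\<mu> = p (n - 1)\<close> its expectation is of order \<open>n exp (- \<mu> / \<beta>) / sqrt \<mu>\<close>.\<close>

section \<open>Packing spanning trees\<close>

text \<open>Origin of \<beta>: at half its mean a Poisson variable has log-probability -(\<mu>/2)(1
  - ln 2) = -\<mu>/\<beta>, up to a term of order log \<mu>. Setting n exp(-\<mu>/\<beta>)/sqrt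
  \<mu> to a constant, with \<mu> of order log n, gives \<beta>(log n - (1/2) log log n) + O(1).
  Shifting the degree level by O(1) changes the expectation by a constant factor only, and near the
  threshold m/(n - 1) is known up to O(1), so any w tending to infinity decides the comparison. The
  obstacle is part (i): w may be huge, so p can be anything down to 0 and the minimum degree can be
  far below m/(n - 1). A vertex then has degree at most t with probability about 1/n, so sets with
  few boundary edges are too frequent for a plain union bound. Asking for |U|/2 inner edges brings a
  factor sqrt p per vertex of U: the base of the union bound becomes about n sqrt p n^(-0.97),
  roughly n^(-0.47), which can afford the loss of n^(0.07) from counting only 0.99 n outer vertices.
  The gap between 0.97 and 1 leaves n^(0.03) for the second moment method.\<close>

definition conn :: "nat set set \<Rightarrow> (nat \<times> nat) set" where
  "conn F = (adj_rel F)\<^sup>*"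

lemma conn_refl [simp]: "(x, x) \<in> conn F"
  by (simp add: conn_def)

lemma conn_sym: "(x, y) \<in> conn F \<Longrightarrow> (y, x) \<in> conn F"
proof -
  have "sym (adj_rel F)"
    by (auto simp: sym_def adj_rel_def insert_commute)
  then show "(x, y) \<in> conn F \<Longrightarrow> (y, x) \<in> conn F"
    unfolding conn_def by (meson sym_rtrancl symD)
qed

lemma conn_trans: "(x, y) \<in> conn F \<Longrightarrow> (y, z) \<in> conn F \<Longrightarrow> (x, z) \<in> conn F"
  by (auto simp: conn_def)

lemma conn_edge: "{x, y} \<in> F \<Longrightarrow> (x, y) \<in> conn F"
  by (auto simp: conn_def adj_rel_def)

lemma conn_leI:
  assumes "\<And>a b. {a, b} \<in> G \<Longrightarrow> (a, b) \<in> conn F"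
  shows "conn G \<subseteq> conn F"
proof -
  have "adj_rel G \<subseteq> (adj_rel F)\<^sup>*"
    using assms by (auto simp: adj_rel_def conn_def)
  then show ?thesis
    unfolding conn_def by (rule rtrancl_subset_rtrancl)
qed

lemma conn_mono: "F \<subseteq> G \<Longrightarrow> conn F \<subseteq> conn G"
  by (rule conn_leI) (auto intro: conn_edge)

lemma conn_insert_iff:
  "(a, b) \<in> conn (insert {x, y} F) \<longleftrightarrow> (a, b) \<in> conn F
     \<or> (a, x) \<in> conn F \<and> (y, b) \<in> conn F \<or> (a, y) \<in> conn F \<and> (x, b) \<in> conn F"
  (is "?l \<longleftrightarrow> ?r b")
proof
  assume ?l
  then have "(a, b) \<in> (adj_rel (insert {x, y} F))\<^sup>*"
    by (simp add: conn_def)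
  then show "?r b"
  proof (induction rule: rtrancl_induct)
    case (step b c)
    then have "{b, c} = {x, y} \<or> {b, c} \<in> F"
      by (auto simp: adj_rel_def)
    then have "b = x \<and> c = y \<or> b = y \<and> c = x \<or> (b, c) \<in> conn F"
      by (auto simp: doubleton_eq_iff intro: conn_edge)
    with step.IH show ?case
      by (metis conn_refl conn_sym conn_trans)
  qed simp
next
  have *: "conn F \<subseteq> conn (insert {x, y} F)"
    by (rule conn_mono) auto
  have "(x, y) \<in> conn (insert {x, y} F)" "(y, x) \<in> conn (insert {x, y} F)"
    by (auto intro: conn_edge conn_sym)
  then show "?r b \<Longrightarrow> ?l"
    using * by (meson conn_trans subsetD)
qed

lemma conn_insert_redundant:
  "(x, y) \<in> conn F \<Longrightarrow> conn (insert {x, y} F) = conn F"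
  by (auto simp: conn_insert_iff) (meson conn_sym conn_trans)+

text \<open>Steinitz exchange for the graphic matroid, with \<open>conn F\<close> in the role of the
  span of \<open>F\<close>.\<close>

lemma conn_exchange:
  assumes "(a, b) \<in> conn (insert {x, y} F)" "(a, b) \<notin> conn F"
  shows "(x, y) \<in> conn (insert {a, b} F)"
  using assms by (simp add: conn_insert_iff) (meson conn_sym)

text \<open>Independence in the graphic matroid: no edge is spanned by the others. Exchange
  arguments work with this form directly; \<open>forest_acyclic\<close> translates it to
  cycles.\<close>

definition forest :: "nat set set \<Rightarrow> bool" where
  "forest F \<longleftrightarrow> (\<forall>x y. {x, y} \<in> F \<longrightarrow> (x, y) \<notin> conn (F - {{x, y}}))"

lemma forest_subset: "forest F \<Longrightarrow> G \<subseteq> F \<Longrightarrow> forest G"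
  unfolding forest_def by (meson Diff_mono conn_mono order_refl subsetD)

lemma forest_insert:
  assumes "forest F" "(x, y) \<notin> conn F"
  shows "forest (insert {x, y} F)"
  unfolding forest_def
proof (intro allI impI)
  fix a b assume ab: "{a, b} \<in> insert {x, y} F"
  have xyF: "{x, y} \<notin> F"
    using assms(2) by (auto intro: conn_edge)
  show "(a, b) \<notin> conn (insert {x, y} F - {{a, b}})"
  proof (cases "{a, b} = {x, y}")
    case True
    then have "insert {x, y} F - {{a, b}} = F"
      using xyF by auto
    with True assms(2) show ?thesis
      by (auto simp: doubleton_eq_iff dest: conn_sym)
  next
    case False
    then have abF: "{a, b} \<in> F" using ab by auto
    have eq: "insert {x, y} F - {{a, b}} = insert {x, y} (F - {{a, b}})"
      using False by auto
    have "insert {a, b} (F - {{a, b}}) = F"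
      using abF by auto
    then show ?thesis
      using conn_exchange[of a b x y "F - {{a, b}}"] assms abF eq
      by (auto simp: forest_def)
  qed
qed

text \<open>The set on the right-hand side consists of the edges on the path from \<open>x\<close> to \<open>y\<close>.\<close>

lemma forest_path_edges:
  assumes "forest F" "finite F" "(x, y) \<in> conn F"
    and F2: "\<And>e. e \<in> F \<Longrightarrow> \<exists>a b. e = {a, b}"
  shows "(x, y) \<in> conn {f \<in> F. (x, y) \<notin> conn (F - {f})}"
proof -
  have "\<exists>D. (D \<subseteq> F \<and> (x, y) \<in> conn D) \<and> (\<forall>D'. D' \<subseteq> F \<and> (x, y) \<in> conn D' \<longrightarrow> card D \<le> card D')"
    by (rule ex_has_least_nat[of "\<lambda>D. D \<subseteq> F \<and> (x, y) \<in> conn D" F card]) (use assms in auto)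
  then obtain D where D: "D \<subseteq> F" "(x, y) \<in> conn D"
    and min: "\<And>D'. D' \<subseteq> F \<Longrightarrow> (x, y) \<in> conn D' \<Longrightarrow> card D \<le> card D'"
    by blast
  \<comment> \<open>If x and y stayed connected in \<open>F - {f}\<close>, one could walk from one
    end of f along the rest of \<open>D\<close> and across from x to y to the other end, all inside
    \<open>F - {f}\<close>, against \<open>forest F\<close>.\<close>
  have "(x, y) \<notin> conn (F - {f})" if f: "f \<in> D" for f
  proof
    assume *: "(x, y) \<in> conn (F - {f})"
    obtain a b where ab: "f = {a, b}" using F2 D f by blast
    have "finite D" using D assms finite_subset by blast
    then have "card (D - {f}) < card D" using f by (meson card_Diff1_less)
    then have "(x, y) \<notin> conn (D - {f})" using min[of "D - {f}"] D by force
    moreover have "(x, y) \<in> conn (insert {a, b} (D - {f}))"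
      using D f ab by (simp add: insert_absorb)
    ultimately have 1: "(a, b) \<in> conn (insert {x, y} (D - {f}))"
      using conn_exchange by blast
    have "conn (insert {x, y} (D - {f})) \<subseteq> conn (insert {x, y} (F - {f}))"
      using D by (intro conn_mono) auto
    then have "(a, b) \<in> conn (F - {f})"
      using 1 conn_insert_redundant[OF *] by auto
    then show False
      using assms(1) ab f D by (auto simp: forest_def)
  qed
  then have "conn D \<subseteq> conn {f \<in> F. (x, y) \<notin> conn (F - {f})}"
    using D by (intro conn_mono) auto
  then show ?thesis using D by blast
qed

text \<open>A cycle without its closing edge is a path that joins the ends of that edge.\<close>

lemma forest_acyclic:
  assumes "forest F"
  shows "\<not> has_cycle F"
proof
  assume "has_cycle F"
  then obtain vs where vs: "length vs \<ge> 3" "distinct vs"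
    and e: "\<And>i. i < length vs \<Longrightarrow> {vs ! i, vs ! ((i + 1) mod length vs)} \<in> F"
    by (auto simp: has_cycle_def)
  define l where "l = length vs - 1"
  have l: "length vs = Suc l" "l \<ge> 2" using vs by (auto simp: l_def)
  have last: "{vs ! l, vs ! 0} \<in> F" using e[of l] l by simp
  have "(vs ! 0, vs ! i) \<in> conn (F - {{vs ! l, vs ! 0}})" if "i \<le> l" for i
    using that
  proof (induction i)
    case (Suc i)
    have "{vs ! i, vs ! Suc i} \<in> F" using e[of i] Suc l by simp
    \<comment> \<open>Here the length of at least 3 enters: on two vertices the closing edge would
      be the first edge again.\<close>
    moreover have "{vs ! i, vs ! Suc i} \<noteq> {vs ! l, vs ! 0}"
    proof
      assume "{vs ! i, vs ! Suc i} = {vs ! l, vs ! 0}"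
      then have "i = l \<and> Suc i = 0 \<or> i = 0 \<and> Suc i = l"
        using vs(2) Suc.prems l by (auto simp: doubleton_eq_iff nth_eq_iff_index_eq)
      then show False using l by auto
    qed
    ultimately have "(vs ! i, vs ! Suc i) \<in> conn (F - {{vs ! l, vs ! 0}})"
      by (intro conn_edge) auto
    then show ?case using Suc by (meson Suc_leD conn_trans)
  qed simp
  from this[of l] have "(vs ! l, vs ! 0) \<in> conn (F - {{vs ! l, vs ! 0}})"
    by (auto intro: conn_sym)
  then show False using last assms by (auto simp: forest_def)
qed

section \<open>Connected components and the rank formula for forests\<close>

definition comps :: "nat set \<Rightarrow> nat set set \<Rightarrow> nat set set" where
  "comps V F = (\<lambda>v. conn F `` {v}) ` V"

lemma conn_class_eq: "(x, y) \<in> conn F \<longleftrightarrow> conn F `` {x} = conn F `` {y}"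
proof
  assume "(x, y) \<in> conn F"
  then have "(x, z) \<in> conn F \<longleftrightarrow> (y, z) \<in> conn F" for z
    using conn_trans[of x y F z] conn_trans[of y x F z] conn_sym[of x y F] by blast
  then show "conn F `` {x} = conn F `` {y}" by auto
next
  assume "conn F `` {x} = conn F `` {y}"
  moreover have "y \<in> conn F `` {y}" by simp
  ultimately have "y \<in> conn F `` {x}" by simp
  then show "(x, y) \<in> conn F" by simp
qed

lemma comps_disjoint: "C \<in> comps V F \<Longrightarrow> D \<in> comps V F \<Longrightarrow> C \<noteq> D \<Longrightarrow> C \<inter> D = {}"
proof (rule ccontr)
  assume C: "C \<in> comps V F" "D \<in> comps V F" "C \<noteq> D" "C \<inter> D \<noteq> {}"
  then obtain u v w where u: "C = conn F `` {u}" "D = conn F `` {v}" "w \<in> C" "w \<in> D"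
    unfolding comps_def by blast
  then have "(u, w) \<in> conn F" "(v, w) \<in> conn F" by blast+
  then have "conn F `` {u} = conn F `` {v}" using conn_class_eq by metis
  then show False using C u by blast
qed

lemma comps_subset:
  assumes "\<And>e. e \<in> F \<Longrightarrow> e \<subseteq> V" "C \<in> comps V F"
  shows "C \<subseteq> V"
proof -
  have "(a, b) \<in> (adj_rel F)\<^sup>* \<Longrightarrow> a \<in> V \<Longrightarrow> b \<in> V" for a b
    by (induction rule: rtrancl_induct) (use assms(1) in \<open>auto simp: adj_rel_def\<close>)
  then show ?thesis using assms(2) by (auto simp: comps_def conn_def)
qed

lemma Union_comps:
  assumes "\<And>e. e \<in> F \<Longrightarrow> e \<subseteq> V"
  shows "\<Union> (comps V F) = V"
proof
  show "\<Union> (comps V F) \<subseteq> V" using comps_subset[of F V] assms by blast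
  have "v \<in> conn F `` {v}" for v by simp
  then show "V \<subseteq> \<Union> (comps V F)" unfolding comps_def by blast
qed

lemma comps_insert:
  assumes "x \<in> V" "y \<in> V"
  shows "comps V (insert {x, y} F)
    = comps V F - {conn F `` {x}, conn F `` {y}} \<union> {conn F `` {x} \<union> conn F `` {y}}"
    (is "?l = ?r")
proof -
  have cls: "conn (insert {x, y} F) `` {v} =
     (if (v, x) \<in> conn F \<or> (v, y) \<in> conn F then conn F `` {x} \<union> conn F `` {y} else conn F `` {v})" for v
    by (auto simp: conn_insert_iff) (meson conn_sym conn_trans)+
  have 1: "v \<in> V \<Longrightarrow> conn (insert {x, y} F) `` {v} \<in> ?r" for v
    unfolding cls comps_def using conn_class_eq[of v x F] conn_class_eq[of v y F] by auto
  have 2: "conn F `` {x} \<union> conn F `` {y} = conn (insert {x, y} F) `` {x}"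
    unfolding cls by simp
  have 3: "conn F `` {v} = conn (insert {x, y} F) `` {v}"
    if "conn F `` {v} \<noteq> conn F `` {x}" "conn F `` {v} \<noteq> conn F `` {y}" for v
    unfolding cls using that conn_class_eq by simp
  show ?thesis
  proof
    show "?l \<subseteq> ?r" using 1 unfolding comps_def[of V "insert {x, y} F"] by blast
    show "?r \<subseteq> ?l"
    proof
      fix C assume "C \<in> ?r"
      then consider "C = conn F `` {x} \<union> conn F `` {y}"
        | v where "v \<in> V" "C = conn F `` {v}" "C \<noteq> conn F `` {x}" "C \<noteq> conn F `` {y}"
        unfolding comps_def by blast
      then show "C \<in> ?l"
      proof cases
        case 1
        then show ?thesis using 2 assms unfolding comps_def by blast
      next
        case 2
        then show ?thesis using 3[of v] unfolding comps_def by auto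
      qed
    qed
  qed
qed

lemma card_comps_insert:
  assumes "finite V" "x \<in> V" "y \<in> V"
  shows "card (comps V (insert {x, y} F)) + of_bool ((x, y) \<notin> conn F) = card (comps V F)"
proof (cases "(x, y) \<in> conn F")
  case True
  then show ?thesis by (simp add: comps_def conn_insert_redundant)
next
  case False
  have fin: "finite (comps V F)" using assms by (simp add: comps_def)
  have mem: "conn F `` {x} \<in> comps V F" "conn F `` {y} \<in> comps V F"
    using assms by (auto simp: comps_def)
  have ne: "conn F `` {x} \<noteq> conn F `` {y}" using False conn_class_eq by blast
  \<comment> \<open>The merged class has to be new, since only then does adding it raise the
    cardinality by one.\<close>
  have "conn F `` {x} \<union> conn F `` {y} \<notin> comps V F - {conn F `` {x}, conn F `` {y}}"
  proof
    assume *: "conn F `` {x} \<union> conn F `` {y} \<in> comps V F - {conn F `` {x}, conn F `` {y}}"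
    then have "(conn F `` {x} \<union> conn F `` {y}) \<inter> conn F `` {x} = {}"
      using comps_disjoint mem by blast
    then show False using conn_refl by blast
  qed
  then have "card (comps V (insert {x, y} F)) = card (comps V F - {conn F `` {x}, conn F `` {y}}) + 1"
    unfolding comps_insert[OF assms(2,3)] using fin by simp
  also have "card (comps V F - {conn F `` {x}, conn F `` {y}}) = card (comps V F) - 2"
    using mem ne fin by (subst card_Diff_subset) auto
  moreover have "card (comps V F) \<ge> 2"
    using card_mono[OF fin, of "{conn F `` {x}, conn F `` {y}}"] mem ne by auto
  ultimately show ?thesis using False by simp
qed

lemma comps_empty_card: "card (comps V {}) = card V"
proof -
  have "conn {} = Id" by (auto simp: conn_def adj_rel_def)
  then show ?thesis by (simp add: comps_def card_image)
qed

lemma card_comps_ge: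
  assumes "finite F" "finite V" "\<And>e. e \<in> F \<Longrightarrow> \<exists>x\<in>V. \<exists>y\<in>V. e = {x, y}"
  shows "card V \<le> card (comps V F) + card F"
  using assms(1,3)
proof (induction F rule: finite_induct)
  case (insert e F)
  obtain x y where xy: "x \<in> V" "y \<in> V" "e = {x, y}" using insert.prems by blast
  have "card V \<le> card (comps V F) + card F" using insert by blast
  then show ?case using card_comps_insert[OF assms(2) xy(1,2), of F] xy insert.hyps
    by (cases "(x, y) \<in> conn F") auto
qed (simp add: comps_empty_card)

text \<open>Forests attain equality in \<open>card_comps_ge\<close>: no edge is spanned by the
  others, so in any order of insertion each one merges two components.\<close>

lemma card_comps_forest:
  assumes "finite F" "finite V" "\<And>e. e \<in> F \<Longrightarrow> \<exists>x\<in>V. \<exists>y\<in>V. e = {x, y}" "forest F"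
  shows "card V = card (comps V F) + card F"
  using assms(1,3,4)
proof (induction F rule: finite_induct)
  case (insert e F)
  obtain x y where xy: "x \<in> V" "y \<in> V" "e = {x, y}" using insert.prems by blast
  have "forest F" using insert.prems(2) by (rule forest_subset) auto
  then have "card V = card (comps V F) + card F" using insert by blast
  moreover have "(x, y) \<notin> conn F"
    using insert.prems(2) xy insert.hyps by (auto simp: forest_def)
  ultimately show ?case using card_comps_insert[OF assms(2) xy(1,2), of F] xy insert.hyps
    by simp
qed (simp add: comps_empty_card)

section \<open>Edge exchanges and disjoint spanning forests\<close>

definition forest_packing :: "nat set set \<Rightarrow> nat \<Rightarrow> (nat \<Rightarrow> nat set set) \<Rightarrow> bool" where
  "forest_packing E k F \<longleftrightarrow> (\<forall>i<k. F i \<subseteq> E \<and> forest (F i)) \<and>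
     (\<forall>i<k. \<forall>j<k. i \<noteq> j \<longrightarrow> F i \<inter> F j = {})"

definition unused :: "nat set set \<Rightarrow> nat \<Rightarrow> (nat \<Rightarrow> nat set set) \<Rightarrow> nat set set" where
  "unused E k F = E - (\<Union>i<k. F i)"

definition max_packing :: "nat set set \<Rightarrow> nat \<Rightarrow> (nat \<Rightarrow> nat set set) \<Rightarrow> bool" where
  "max_packing E k F \<longleftrightarrow> forest_packing E k F \<and>
     (\<forall>G. forest_packing E k G \<longrightarrow> (\<Sum>i<k. card (G i)) \<le> (\<Sum>i<k. card (F i)))"

inductive exch :: "nat set set \<Rightarrow> nat \<Rightarrow> (nat \<Rightarrow> nat set set) \<Rightarrow> (nat \<Rightarrow> nat set set) \<Rightarrow> bool"
  for E k where
  "i < k \<Longrightarrow> e \<in> unused E k F \<Longrightarrow> f \<in> F i \<Longrightarrow> forest (insert e (F i - {f}))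
    \<Longrightarrow> exch E k F (F(i := insert e (F i - {f})))"

lemma forest_packing_upd:
  assumes "forest_packing E k F" "i < k" "forest H" "H \<subseteq> F i \<union> unused E k F"
  shows "forest_packing E k (F(i := H))"
proof -
  have disj: "H \<inter> F j = {}" if "j < k" "j \<noteq> i" for j
  proof -
    have "F i \<inter> F j = {}" "unused E k F \<inter> F j = {}"
      using assms(1,2) that by (auto simp: forest_packing_def unused_def)
    then show ?thesis using assms(4) by blast
  qed
  have "F i \<union> unused E k F \<subseteq> E"
    using assms(1,2) by (auto simp: forest_packing_def unused_def)
  then have "H \<subseteq> E" using assms(4) by blast
  moreover have "(F(i := H)) j \<inter> (F(i := H)) l = {}" if "j < k" "l < k" "j \<noteq> l" for j l
    using disj[of j] disj[of l] that assms(1)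
    by (cases "j = i"; cases "l = i") (simp_all add: forest_packing_def Int_commute)
  ultimately show ?thesis
    using assms(1,3) by (simp add: forest_packing_def)
qed

lemma sum_card_upd:
  fixes F :: "nat \<Rightarrow> 'a set"
  assumes "i < k"
  shows "(\<Sum>j<k. card ((F(i := H)) j)) + card (F i) = (\<Sum>j<k. card (F j)) + card H"
proof -
  have *: "sum g {..<k} = g i + sum g ({..<k} - {i})" for g :: "nat \<Rightarrow> nat"
    using assms by (intro sum.remove) auto
  have "(\<Sum>j\<in>{..<k} - {i}. card ((F(i := H)) j)) = (\<Sum>j\<in>{..<k} - {i}. card (F j))"
    by (rule sum.cong) auto
  then show ?thesis
    using *[of "\<lambda>j. card ((F(i := H)) j)"] *[of "\<lambda>j. card (F j)"] by simp
qed

lemma exch_max_packing: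
  assumes "exch E k F G" "max_packing E k F" "finite E"
  shows "max_packing E k G"
  using assms(1)
proof cases
  case (1 i e f)
  have F: "forest_packing E k F" using assms by (simp add: max_packing_def)
  have "forest_packing E k G"
    unfolding 1(1) using F by (rule forest_packing_upd) (use 1 in auto)
  moreover have "finite (F i)" using F 1 assms(3) finite_subset by (auto simp: forest_packing_def)
  moreover have "e \<notin> F i" using 1 by (auto simp: unused_def)
  ultimately have "card (insert e (F i - {f})) = card (F i)"
    using card_Suc_Diff1[of "F i" f] \<open>f \<in> F i\<close> by simp
  then have "(\<Sum>j<k. card (G j)) = (\<Sum>j<k. card (F j))"
    unfolding 1(1) using sum_card_upd[OF 1(2), of F "insert e (F i - {f})"] by simp
  then show ?thesis using assms(2) \<open>forest_packing E k G\<close> by (simp add: max_packing_def)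
qed

text \<open>If an unused edge joined two components of some forest, that forest could be enlarged; and
  every edge on the path joining its ends can be exchanged for it.\<close>

lemma unused_connected:
  assumes max: "max_packing E k F" and "finite E" "i < k" and xy: "{x, y} \<in> unused E k F"
    and E2: "\<And>e. e \<in> E \<Longrightarrow> \<exists>a b. e = {a, b}"
    and E0: "\<And>G. exch E k F G \<Longrightarrow> unused E k G \<subseteq> E0"
  shows "(x, y) \<in> conn (F i \<inter> E0)"
proof -
  have F: "forest_packing E k F" using max by (simp add: max_packing_def)
  then have Fi: "F i \<subseteq> E" "forest (F i)" "finite (F i)"
    using \<open>i < k\<close> \<open>finite E\<close> finite_subset by (auto simp: forest_packing_def)
  have xyF: "{x, y} \<notin> F i" using xy \<open>i < k\<close> by (auto simp: unused_def)
  have con: "(x, y) \<in> conn (F i)"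
  proof (rule ccontr)
    assume "(x, y) \<notin> conn (F i)"
    then have "forest (insert {x, y} (F i))" using Fi forest_insert by blast
    then have "forest_packing E k (F(i := insert {x, y} (F i)))"
      using xy by (intro forest_packing_upd[OF F \<open>i < k\<close>]) auto
    then have "(\<Sum>j<k. card ((F(i := insert {x, y} (F i))) j)) \<le> (\<Sum>j<k. card (F j))"
      using max by (auto simp: max_packing_def)
    then show False
      using sum_card_upd[OF \<open>i < k\<close>, of F "insert {x, y} (F i)"] xyF Fi by simp
  qed
  have "{f \<in> F i. (x, y) \<notin> conn (F i - {f})} \<subseteq> F i \<inter> E0"
  proof
    fix f assume "f \<in> {f \<in> F i. (x, y) \<notin> conn (F i - {f})}"
    then have f: "f \<in> F i" "(x, y) \<notin> conn (F i - {f})" by auto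
    have "forest (insert {x, y} (F i - {f}))"
      using f Fi by (intro forest_insert) (auto intro: forest_subset)
    then have ex: "exch E k F (F(i := insert {x, y} (F i - {f})))"
      using f xy \<open>i < k\<close> by (intro exch.intros)
    have "f \<in> unused E k (F(i := insert {x, y} (F i - {f})))"
      using f Fi F \<open>i < k\<close> xyF by (fastforce simp: unused_def forest_packing_def)
    then show "f \<in> F i \<inter> E0" using E0[OF ex] f by auto
  qed
  moreover have "(x, y) \<in> conn {f \<in> F i. (x, y) \<notin> conn (F i - {f})}"
    using Fi con E2 by (intro forest_path_edges) auto
  ultimately show ?thesis using conn_mono by blast
qed

text \<open>\<open>F\<close> is a packing with the maximal number of edges, and \<open>E0\<close> consists of the edges unused by some
  packing that arises from \<open>F\<close> by exchanges.\<close>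

lemma forest_packing_tight:
  assumes "finite E" and E2: "\<And>e. e \<in> E \<Longrightarrow> \<exists>a b. e = {a, b}"
  obtains F E0 where "forest_packing E k F" "E0 \<subseteq> E" "unused E k F \<subseteq> E0"
    "\<And>i. i < k \<Longrightarrow> conn (F i \<inter> E0) = conn E0"
proof -
  have "\<exists>F. forest_packing E k F \<and>
      (\<forall>G. forest_packing E k G \<longrightarrow> (\<Sum>i<k. card (G i)) \<le> (\<Sum>i<k. card (F i)))"
  proof (rule ex_has_greatest_nat[where b = "Suc (k * card E)"])
    show "forest_packing E k (\<lambda>_. {})" by (simp add: forest_packing_def forest_def)
    show "\<forall>G. forest_packing E k G \<longrightarrow> (\<Sum>i<k. card (G i)) < Suc (k * card E)"
    proof (intro allI impI)
      fix G assume "forest_packing E k G"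
      then have "card (G i) \<le> card E" if "i < k" for i
        using that assms(1) by (auto simp: forest_packing_def intro: card_mono)
      then show "(\<Sum>i<k. card (G i)) < Suc (k * card E)"
        using sum_bounded_above[of "{..<k}" "\<lambda>i. card (G i)" "card E"] by simp
    qed
  qed
  then obtain F where F: "max_packing E k F" by (auto simp: max_packing_def)
  define E0 where "E0 = \<Union> (unused E k ` {G. (exch E k)\<^sup>*\<^sup>* F G})"
  have max: "max_packing E k G" if "(exch E k)\<^sup>*\<^sup>* F G" for G
    using that by induction (use F exch_max_packing assms in auto)
  have A: "(x, y) \<in> conn (G i \<inter> E0)"
    if "(exch E k)\<^sup>*\<^sup>* F G" "{x, y} \<in> unused E k G" "i < k" for x y G i
  proof (rule unused_connected[OF max[OF that(1)] assms(1) that(3,2) E2])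
    fix H assume "exch E k G H"
    then have "(exch E k)\<^sup>*\<^sup>* F H" using that by auto
    then show "unused E k H \<subseteq> E0" by (auto simp: E0_def)
  qed auto
  have B: "conn (G i \<inter> E0) \<subseteq> conn (F i \<inter> E0)" if "(exch E k)\<^sup>*\<^sup>* F G" "i < k" for G i
    using that(1)
  proof induction
    case (step G H)
    from step.hyps(2) have "conn (H i \<inter> E0) \<subseteq> conn (G i \<inter> E0)"
    proof cases
      case (1 j e f)
      show ?thesis
      proof (cases "i = j")
        case True
        show ?thesis
        proof (rule conn_leI)
          fix a b assume "{a, b} \<in> H i \<inter> E0"
          then have "{a, b} \<in> unused E k G \<or> {a, b} \<in> G i \<inter> E0"
            using 1 True by auto
          then show "(a, b) \<in> conn (G i \<inter> E0)"
            using A[OF step.hyps(1) _ \<open>i < k\<close>] by (auto intro: conn_edge)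
        qed
      qed (use 1 in auto)
    qed
    then show ?case using step.IH by blast
  qed auto
  have "conn (F i \<inter> E0) = conn E0" if "i < k" for i
  proof
    show "conn (F i \<inter> E0) \<subseteq> conn E0" by (rule conn_mono) auto
    show "conn E0 \<subseteq> conn (F i \<inter> E0)"
    proof (rule conn_leI)
      fix a b assume "{a, b} \<in> E0"
      then obtain G where "(exch E k)\<^sup>*\<^sup>* F G" "{a, b} \<in> unused E k G" by (auto simp: E0_def)
      then show "(a, b) \<in> conn (F i \<inter> E0)" using A B that by blast
    qed
  qed
  moreover have "E0 \<subseteq> E" by (auto simp: E0_def unused_def)
  moreover have "unused E k F \<subseteq> E0" by (auto simp: E0_def)
  moreover have "forest_packing E k F" using F by (simp add: max_packing_def)
  ultimately show thesis using that by blast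
qed

text \<open>The Nash-Williams--Tutte theorem. It suffices to check the partitions into components of
  a subgraph.\<close>

theorem spanning_forest_packing:
  assumes fin: "finite V" "V \<noteq> {}" and E: "\<And>e. e \<in> E \<Longrightarrow> \<exists>x\<in>V. \<exists>y\<in>V. e = {x, y}"
    and cross: "\<And>E0. E0 \<subseteq> E \<Longrightarrow>
      k * (card (comps V E0) - 1) \<le> card {e \<in> E. \<not> (\<exists>C\<in>comps V E0. e \<subseteq> C)}"
  obtains F where "forest_packing E k F" "\<And>i x y. i < k \<Longrightarrow> x \<in> V \<Longrightarrow> y \<in> V \<Longrightarrow> (x, y) \<in> conn (F i)"
proof -
  have "E \<subseteq> (\<lambda>(x, y). {x, y}) ` (V \<times> V)" using E by fastforce
  then have finE: "finite E" using fin finite_subset by blast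
  have E2: "\<And>e. e \<in> E \<Longrightarrow> \<exists>a b. e = {a, b}" using E by blast
  obtain F E0 where F: "forest_packing E k F" "E0 \<subseteq> E" "unused E k F \<subseteq> E0"
    and eq: "\<And>i. i < k \<Longrightarrow> conn (F i \<inter> E0) = conn E0"
    using forest_packing_tight[OF finE E2] by metis
  have Fi: "F i \<subseteq> E" "forest (F i)" "finite (F i)" if "i < k" for i
    using F(1) that finE finite_subset by (auto simp: forest_packing_def)
  define P where "P = card (comps V E0)"
  define X where "X = {e \<in> E. \<not> (\<exists>C\<in>comps V E0. e \<subseteq> C)}"
  have in0: "\<exists>C\<in>comps V E0. e \<subseteq> C" if e: "e \<in> E0" for e
  proof -
    obtain x y where "x \<in> V" "e = {x, y}" using e F(2) E by blast
    then have "e \<subseteq> conn E0 `` {x}" using e conn_edge[of x y E0] by auto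
    then show ?thesis using \<open>x \<in> V\<close> by (auto simp: comps_def)
  qed
  have "X \<subseteq> (\<Union>i<k. F i - E0)"
  proof
    fix e assume e: "e \<in> X"
    then have "e \<notin> E0" using in0 by (auto simp: X_def)
    moreover from this have "e \<notin> unused E k F" using F(3) by blast
    ultimately show "e \<in> (\<Union>i<k. F i - E0)" using e by (auto simp: X_def unused_def)
  qed
  then have "card X \<le> card (\<Union>i<k. F i - E0)"
    using Fi by (intro card_mono) auto
  also have "\<dots> \<le> (\<Sum>i<k. card (F i - E0))" by (rule card_UN_le) simp
  finally have X: "card X \<le> (\<Sum>i<k. card (F i - E0))" .
  have pos: "card (comps V G) \<ge> 1" for G
    using fin by (simp add: comps_def Suc_le_eq card_gt_0_iff)
  \<comment> \<open>Since \<open>F i\<close> spans the same components as \<open>E0\<close> within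
    \<open>E0\<close>, it has at most P - 1 edges outside, and exactly P - 1 only if it is
    connected. The crossing hypothesis forces equality for every i.\<close>
  have cnt: "card (F i - E0) + card (comps V (F i)) = P" if i: "i < k" for i
  proof -
    have "card V = card (comps V (F i)) + card (F i)"
      using Fi[OF i] E fin by (intro card_comps_forest) auto
    moreover have "card V = card (comps V (F i \<inter> E0)) + card (F i \<inter> E0)"
      using Fi[OF i] E fin by (intro card_comps_forest) (auto intro: forest_subset)
    moreover have "card (F i) = card (F i \<inter> E0) + card (F i - E0)"
      using Fi[OF i] by (metis card_Int_Diff)
    moreover have "comps V (F i \<inter> E0) = comps V E0" using eq[OF i] by (simp add: comps_def)
    ultimately show ?thesis by (simp add: P_def)
  qed
  have one: "card (comps V (F i)) = 1" if i: "i < k" for i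
  proof (rule ccontr)
    assume "card (comps V (F i)) \<noteq> 1"
    then have "card (F i - E0) < P - 1" using cnt[OF i] pos[of "F i"] pos[of E0] P_def by linarith
    moreover have "card (F j - E0) \<le> P - 1" if "j < k" for j
      using cnt[OF that] pos[of "F j"] by linarith
    ultimately have "(\<Sum>i<k. card (F i - E0)) < (\<Sum>i<k. P - 1)"
      using i by (intro sum_strict_mono_ex1) auto
    then show False using X cross[OF F(2)] by (simp add: P_def X_def)
  qed
  have "(x, y) \<in> conn (F i)" if i: "i < k" and "x \<in> V" "y \<in> V" for i x y
  proof -
    obtain C where "comps V (F i) = {C}" using one[OF i] by (rule card_1_singletonE)
    moreover have "conn (F i) `` {x} \<in> comps V (F i)" "conn (F i) `` {y} \<in> comps V (F i)"
      using \<open>x \<in> V\<close> \<open>y \<in> V\<close> by (simp_all add: comps_def)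
    ultimately have "conn (F i) `` {x} = conn (F i) `` {y}" by simp
    then show ?thesis using conn_class_eq by blast
  qed
  then show thesis using that F(1) by blast
qed

section \<open>Graphs on [n] and the upper bounds for tree packings\<close>

lemma finite_all_edges [simp]: "finite (all_edges n)"
  by (rule finite_subset[of _ "Pow {1..n}"]) (auto simp: all_edges_def)

lemma finite_graph: "E \<subseteq> all_edges n \<Longrightarrow> finite E"
  by (rule finite_subset[OF _ finite_all_edges])

lemma all_edgesE:
  assumes "e \<in> all_edges n"
  obtains x y where "x \<in> {1..n}" "y \<in> {1..n}" "x \<noteq> y" "e = {x, y}"
proof -
  obtain x y where "e = {x, y}" "x \<noteq> y" "e \<subseteq> {1..n}"
    using assms unfolding all_edges_def card_2_iff by blast
  then show thesis using that[of x y] by simp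
qed

lemma all_edges_eq: "e \<in> all_edges n \<Longrightarrow> x \<in> e \<Longrightarrow> y \<in> e \<Longrightarrow> x \<noteq> y \<Longrightarrow> e = {x, y}"
  by (erule all_edgesE) fast

lemma all_edges_ends: "e \<in> all_edges n \<Longrightarrow> \<exists>x\<in>{1..n}. \<exists>y\<in>{1..n}. e = {x, y}"
  by (meson all_edgesE)

lemma connected_card_ge:
  assumes "connected_on n F" "F \<subseteq> all_edges n" "n \<ge> 1"
  shows "n - 1 \<le> card F"
proof -
  have "comps {1..n} F \<subseteq> {conn F `` {1}}"
  proof
    fix C assume "C \<in> comps {1..n} F"
    then obtain v where v: "v \<in> {1..n}" "C = conn F `` {v}" unfolding comps_def by blast
    then have "(v, 1) \<in> conn F" using assms(1,3) by (simp add: connected_on_def conn_def)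
    then show "C \<in> {conn F `` {1}}" using v conn_class_eq[of v 1 F] by simp
  qed
  then have "card (comps {1..n} F) \<le> 1" using card_mono[of "{conn F `` {1}}"] by fastforce
  moreover have "card {1..n} \<le> card (comps {1..n} F) + card F"
  proof (rule card_comps_ge)
    show "finite F" using assms(2) finite_subset finite_all_edges by blast
    show "\<exists>x\<in>{1..n}. \<exists>y\<in>{1..n}. e = {x, y}" if "e \<in> F" for e
      using assms(2) that by (intro all_edges_ends) auto
  qed simp
  ultimately show ?thesis by simp
qed

definition tree_family :: "nat \<Rightarrow> nat set set \<Rightarrow> nat \<Rightarrow> (nat \<Rightarrow> nat set set) \<Rightarrow> bool" where
  "tree_family n E k F \<longleftrightarrow> (\<forall>i<k. spanning_tree n E (F i)) \<and>
     (\<forall>i<k. \<forall>j<k. i \<noteq> j \<longrightarrow> F i \<inter> F j = {})"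

lemma disjoint_family_card_le:
  assumes "\<And>i. i < k \<Longrightarrow> F i \<subseteq> E" "\<And>i. i < k \<Longrightarrow> c \<le> card (F i)"
    "\<And>i j. i < k \<Longrightarrow> j < k \<Longrightarrow> i \<noteq> j \<Longrightarrow> F i \<inter> F j = {}" "finite E"
  shows "k * c \<le> card E"
proof -
  have "k * c \<le> (\<Sum>i<k. card (F i))"
    using sum_bounded_below[of "{..<k}" c "\<lambda>i. card (F i)"] assms(2) by simp
  also have "\<dots> = card (\<Union>i<k. F i)"
    using assms(1,3,4) by (intro card_UN_disjoint[symmetric]) (auto intro: finite_subset)
  also have "\<dots> \<le> card E" using assms(1,4) by (intro card_mono) auto
  finally show ?thesis .
qed

lemma tree_family_edges:
  assumes "tree_family n E k F" "E \<subseteq> all_edges n" "n \<ge> 1"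
  shows "k * (n - 1) \<le> card E"
proof (rule disjoint_family_card_le[where F = F])
  show "n - 1 \<le> card (F i)" if "i < k" for i
    using assms that by (intro connected_card_ge) (auto simp: tree_family_def spanning_tree_def)
qed (use assms finite_subset[of E] in \<open>auto simp: tree_family_def spanning_tree_def\<close>)

lemma tree_family_degree:
  assumes T: "tree_family n E k F" and E: "E \<subseteq> all_edges n" "n \<ge> 2" "v \<in> {1..n}"
  shows "k \<le> degree E v"
proof -
  have fin: "finite E" using E(1) by (rule finite_graph)
  have "k * 1 \<le> card {e \<in> E. v \<in> e}"
  proof (rule disjoint_family_card_le[where F = "\<lambda>i. {e \<in> F i. v \<in> e}"])
    fix i assume i: "i < k"
    then have "spanning_tree n E (F i)" using T by (auto simp: tree_family_def)
    then have F: "F i \<subseteq> E" "connected_on n (F i)" by (auto simp: spanning_tree_def)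
    obtain u where u: "u \<in> {1..n}" "u \<noteq> v" using E 
      by (cases "v = 1") (auto intro: that[of 1] that[of 2])
    have "(v, u) \<in> (adj_rel (F i))\<^sup>*" using F E u by (auto simp: connected_on_def)
    then obtain z where "(v, z) \<in> adj_rel (F i)" using u(2) by (auto elim: converse_rtranclE)
    then have "{v, z} \<in> {e \<in> F i. v \<in> e}" by (auto simp: adj_rel_def)
    moreover have "finite (F i)" using F fin finite_subset by auto
    ultimately show "1 \<le> card {e \<in> F i. v \<in> e}" by (auto simp: Suc_le_eq card_gt_0_iff)
    show "{e \<in> F i. v \<in> e} \<subseteq> {e \<in> E. v \<in> e}" using F by auto
  qed (use T fin in \<open>auto simp: tree_family_def\<close>)
  then show ?thesis by (simp add: degree_def)
qed

lemma tree_packing_bounds: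
  assumes E: "E \<subseteq> all_edges n" "n \<ge> 2"
  shows "tree_packing n E \<le> min_degree n E" "tree_packing n E * (n - 1) \<le> card E"
    and "tree_family n E k F \<Longrightarrow> k \<le> tree_packing n E"
proof -
  let ?K = "{k. \<exists>F. tree_family n E k F}"
  have eq: "tree_packing n E = Max ?K" by (simp add: tree_packing_def tree_family_def)
  \<comment> \<open>\<open>Max\<close> is meaningful only on a finite nonempty set. Finiteness holds
    because a spanning tree has at least n - 1 \<ge> 1 edges.\<close>
  have "?K \<subseteq> {..card E}"
  proof
    fix k assume "k \<in> ?K"
    then have "k * (n - 1) \<le> card E" using tree_family_edges[of n E k] E by auto
    moreover have "k * 1 \<le> k * (n - 1)" using E(2) by (intro mult_le_mono2) linarith
    ultimately have "k \<le> card E" by linarith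
    then show "k \<in> {..card E}" by simp
  qed
  then have fin: "finite ?K" using finite_subset by blast
  have "tree_family n E 0 (\<lambda>_. {})" by (simp add: tree_family_def)
  then have "?K \<noteq> {}" by blast
  then have "tree_packing n E \<in> ?K" unfolding eq using fin Max_in by blast
  then obtain F where F: "tree_family n E (tree_packing n E) F" by blast
  show "tree_packing n E \<le> min_degree n E"
    unfolding min_degree_def using E tree_family_degree[OF F E] by (subst Min_ge_iff) auto
  show "tree_packing n E * (n - 1) \<le> card E" using tree_family_edges[OF F] E by simp
  show "tree_family n E k F \<Longrightarrow> k \<le> tree_packing n E" for F
    unfolding eq using fin by (intro Max_ge) auto
qed

section \<open>Lower bounds for tree packings from boundaries and local densities\<close>

definition boundary :: "nat \<Rightarrow> nat set \<Rightarrow> nat set set" where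
  "boundary n U = {e \<in> all_edges n. e \<inter> U \<noteq> {} \<and> \<not> e \<subseteq> U}"

definition inner_edges :: "nat set \<Rightarrow> nat set set" where
  "inner_edges U = {e. e \<subseteq> U \<and> card e = 2}"

lemma inner_edges_subset: "U \<subseteq> {1..n} \<Longrightarrow> inner_edges U \<subseteq> all_edges n"
  by (auto simp: inner_edges_def all_edges_def)

lemma boundary_subset: "boundary n U \<subseteq> all_edges n"
  by (auto simp: boundary_def)

lemma inner_boundary_disjoint: "inner_edges U \<inter> boundary n U = {}"
  by (auto simp: inner_edges_def boundary_def)

lemma card_inner_edges: "finite U \<Longrightarrow> card (inner_edges U) = card U choose 2"
  unfolding inner_edges_def by (rule n_subsets)

lemma card_all_edges: "card (all_edges n) = n choose 2"
  using card_inner_edges[of "{1..n}"] by (simp add: inner_edges_def all_edges_def)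

lemma card_boundary:
  assumes "U \<subseteq> {1..n}"
  shows "card (boundary n U) = card U * (n - card U)"
proof -
  have "bij_betw (\<lambda>(x, y). {x, y}) (U \<times> ({1..n} - U)) (boundary n U)"
  proof (rule bij_betw_imageI)
    show "inj_on (\<lambda>(x, y). {x, y}) (U \<times> ({1..n} - U))"
      by (auto simp: inj_on_def doubleton_eq_iff)
    show "(\<lambda>(x, y). {x, y}) ` (U \<times> ({1..n} - U)) = boundary n U"
    proof
      show "(\<lambda>(x, y). {x, y}) ` (U \<times> ({1..n} - U)) \<subseteq> boundary n U"
        using assms by (auto simp: boundary_def all_edges_def card_2_iff)
      show "boundary n U \<subseteq> (\<lambda>(x, y). {x, y}) ` (U \<times> ({1..n} - U))"
      proof
        fix e assume "e \<in> boundary n U"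
        then obtain a b where ab: "a \<in> {1..n}" "b \<in> {1..n}" "e = {a, b}"
          "e \<inter> U \<noteq> {}" "\<not> e \<subseteq> U"
          unfolding boundary_def using all_edges_ends[of e n] by blast
        obtain x y where "x \<in> U" "y \<in> {1..n} - U" "e = {x, y}"
        proof (cases "a \<in> U")
          case True
          then show ?thesis using ab that[of a b] by auto
        next
          case False
          then show ?thesis using ab that[of b a] by auto
        qed
        then show "e \<in> (\<lambda>(x, y). {x, y}) ` (U \<times> ({1..n} - U))" by auto
      qed
    qed
  qed
  then have "card (boundary n U) = card (U \<times> ({1..n} - U))" by (metis bij_betw_same_card)
  also have "\<dots> = card U * (n - card U)"
    using assms by (simp add: card_cartesian_product card_Diff_subset finite_subset)
  finally show ?thesis .
qed

text \<open>Writes a degree as the size of \<open>E\<close> on a fixed set of potential edges, the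
  form to which both the binomial formulas and the boundary estimates apply.\<close>

lemma degree_boundary:
  assumes "E \<subseteq> all_edges n"
  shows "degree E v = card (E \<inter> boundary n {v})"
proof -
  have "{e \<in> E. v \<in> e} = E \<inter> boundary n {v}"
  proof -
    have "\<not> e \<subseteq> {v}" if "e \<in> E" for e
    proof -
      obtain x y where "x \<noteq> y" "e = {x, y}" using \<open>e \<in> E\<close> assms all_edgesE[of e n] by blast
      then show ?thesis by auto
    qed
    then show ?thesis using assms unfolding boundary_def by blast
  qed
  then show ?thesis by (simp add: degree_def)
qed

text \<open>A minimal set violating the boundary bound has no isolated vertex, hence spans at least
  half as many edges as it has vertices.\<close>

lemma boundary_ge_if_no_dense_violation:
  assumes E: "E \<subseteq> all_edges n" and deg: "\<And>v. v \<in> {1..n} \<Longrightarrow> t \<le> degree E v"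
    and dense: "\<And>U. U \<subseteq> {1..n} \<Longrightarrow> U \<noteq> {} \<Longrightarrow> real (card U) \<le> c \<Longrightarrow>
        card U \<le> 2 * card (E \<inter> inner_edges U) \<Longrightarrow> t * card U \<le> card (E \<inter> boundary n U)"
  shows "U \<subseteq> {1..n} \<Longrightarrow> real (card U) \<le> c \<Longrightarrow> t * card U \<le> card (E \<inter> boundary n U)"
proof (induction "card U" arbitrary: U)
  case (Suc m)
  have finE: "finite E" using E by (rule finite_graph)
  have finU: "finite U" using Suc finite_subset by auto
  have U0: "U \<noteq> {}" using Suc by auto
  show ?case
  proof (cases "card U \<le> 2 * card (E \<inter> inner_edges U)")
    case True
    then show ?thesis using dense Suc U0 by blast
  next
    case False
    \<comment> \<open>Inner edges cover at most two vertices each, so fewer than |U|/2 of them miss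
      some vertex v, and all edges at v leave \<open>U\<close>.\<close>
    have "\<not> U \<subseteq> \<Union> (E \<inter> inner_edges U)"
    proof
      assume "U \<subseteq> \<Union> (E \<inter> inner_edges U)"
      moreover have "finite (\<Union> (E \<inter> inner_edges U))"
        using finU by (rule rev_finite_subset) (auto simp: inner_edges_def)
      ultimately have "card U \<le> card (\<Union> (E \<inter> inner_edges U))" by (intro card_mono)
      also have "\<dots> = card (\<Union>e\<in>E \<inter> inner_edges U. e)" by simp
      also have "\<dots> \<le> (\<Sum>e\<in>E \<inter> inner_edges U. card e)" using finE by (intro card_UN_le) auto
      also have "\<dots> = 2 * card (E \<inter> inner_edges U)" by (simp add: inner_edges_def)
      finally show False using False by simp
    qed
    then obtain v where "v \<in> U" "v \<notin> \<Union> (E \<inter> inner_edges U)" by blast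
    moreover have "card e = 2" if "e \<in> E" for e
      using that E by (auto simp: all_edges_def)
    ultimately have v: "v \<in> U" "\<And>e. e \<in> E \<Longrightarrow> v \<in> e \<Longrightarrow> \<not> e \<subseteq> U"
      unfolding inner_edges_def by blast+
    \<comment> \<open>A common edge would join v to another vertex of \<open>U\<close>. So the
      boundary of \<open>U\<close> splits off the full degree of v, which is at least t, and the
      rest is the induction hypothesis.\<close>
    have disj: "(E \<inter> boundary n (U - {v})) \<inter> (E \<inter> boundary n {v}) = {}"
    proof -
      have "e \<subseteq> U" if "e \<in> boundary n (U - {v})" "v \<in> e" for e
      proof -
        obtain x where "x \<in> e" "x \<in> U" "x \<noteq> v" using \<open>e \<in> boundary n (U - {v})\<close>
          unfolding boundary_def by blast
        moreover from this have "e = {x, v}"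
          using that all_edges_eq boundary_subset by blast
        ultimately show ?thesis using v(1) by simp
      qed
      then show ?thesis using v(2) unfolding boundary_def by blast
    qed
    have sub: "(E \<inter> boundary n (U - {v})) \<union> (E \<inter> boundary n {v}) \<subseteq> E \<inter> boundary n U"
    proof -
      have "e \<in> boundary n U" if "e \<in> E" "e \<in> boundary n (U - {v})" for e
        using that v unfolding boundary_def by blast
      moreover have "e \<in> boundary n U" if "e \<in> E" "e \<in> boundary n {v}" for e
        using that v unfolding boundary_def by blast
      ultimately show ?thesis by blast
    qed
    have c1: "card (U - {v}) = m" using Suc.hyps(2) v(1) finU by simp
    have "t * card (U - {v}) \<le> card (E \<inter> boundary n (U - {v}))"
      using Suc.prems Suc.hyps(2) c1 by (intro Suc.hyps(1)) auto
    moreover have "t \<le> card (E \<inter> boundary n {v})"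
      using deg[of v] degree_boundary[OF E] v Suc.prems by auto
    ultimately have "t * Suc m \<le> card (E \<inter> boundary n (U - {v})) + card (E \<inter> boundary n {v})"
      using c1 by simp
    also have "\<dots> = card ((E \<inter> boundary n (U - {v})) \<union> (E \<inter> boundary n {v}))"
      using disj finE by (subst card_Un_disjoint) auto
    also have "\<dots> \<le> card (E \<inter> boundary n U)"
      using sub finE by (intro card_mono) auto
    finally show ?thesis using Suc.hyps(2) by simp
  qed
qed simp

text \<open>If no class of a partition is huge, then the density of every class is at most the global
  density \<open>card E / (n - 1)\<close>; otherwise the boundary of the huge class alone suffices.\<close>

theorem tree_packing_ge:
  assumes E: "E \<subseteq> all_edges n" and n: "n \<ge> 2"
    and t: "real t \<le> real (card E) / (real n - 1)"
    and sparse: "\<And>S. S \<subseteq> {1..n} \<Longrightarrow> S \<noteq> {} \<Longrightarrow> real (card S) \<le> (1 - c) * real n \<Longrightarrow>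
      real (card (E \<inter> inner_edges S)) \<le> real (card E) / (real n - 1) * (real (card S) - 1)"
    and expand: "\<And>U. U \<subseteq> {1..n} \<Longrightarrow> real (card U) \<le> c * real n \<Longrightarrow>
      t * card U \<le> card (E \<inter> boundary n U)"
  shows "t \<le> tree_packing n E"
proof -
  have finE: "finite E" using E by (rule finite_graph)
  have E': "\<And>e. e \<in> E \<Longrightarrow> \<exists>x\<in>{1..n}. \<exists>y\<in>{1..n}. e = {x, y}"
    using E by (meson all_edgesE subsetD)
  have "t * (card (comps {1..n} E0) - 1) \<le> card {e \<in> E. \<not> (\<exists>C\<in>comps {1..n} E0. e \<subseteq> C)}"
    if E0: "E0 \<subseteq> E" for E0
  proof -
    define P where "P = comps {1..n} E0"
    define X where "X = {e \<in> E. \<not> (\<exists>C\<in>P. e \<subseteq> C)}"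
    have E0n: "e \<in> E0 \<Longrightarrow> e \<subseteq> {1..n}" for e using E0 E by (auto simp: all_edges_def)
    have finP: "finite P" by (simp add: P_def comps_def)
    have UP: "\<Union> P = {1..n}" unfolding P_def using E0n by (rule Union_comps)
    have PV: "C \<subseteq> {1..n}" if "C \<in> P" for C using UP that by blast
    have disjP: "C \<inter> D = {}" if "C \<in> P" "D \<in> P" "C \<noteq> D" for C D
      using comps_disjoint that unfolding P_def by blast
    have neP: "C \<noteq> {}" if "C \<in> P" for C using that conn_refl unfolding P_def comps_def by blast
    have finC: "finite C" if "C \<in> P" for C using PV[OF that] finite_subset by blast
    have P0: "card P \<ge> 1" using n finP by (auto simp: P_def comps_def Suc_le_eq card_gt_0_iff)
    have "t * (card P - 1) \<le> card X"
    proof (cases "\<exists>C\<in>P. real (card C) > (1 - c) * real n")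
      case True
      then obtain C where C: "C \<in> P" "real (card C) > (1 - c) * real n" by blast
      define U where "U = {1..n} - C"
      have cU: "card U + card C = n"
        using PV[OF C(1)] finC[OF C(1)] card_mono[OF _ PV[OF C(1)]] by (simp add: U_def card_Diff_subset)
      have "real (card U) \<le> c * real n" using C(2) cU by (simp add: algebra_simps flip: cU)
      then have bd: "t * card U \<le> card (E \<inter> boundary n U)" by (intro expand) (auto simp: U_def)
      have "E \<inter> boundary n U \<subseteq> X"
      proof
        fix e assume e: "e \<in> E \<inter> boundary n U"
        then obtain x y where xy: "x \<in> e" "x \<in> U" "y \<in> e" "y \<notin> U"
          unfolding boundary_def by blast
        moreover have "e \<subseteq> {1..n}" using e by (simp add: boundary_def all_edges_def)
        ultimately have "y \<in> C" by (auto simp: U_def)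
        have "\<not> e \<subseteq> D" if "D \<in> P" for D
          using disjP[OF C(1) that] xy \<open>y \<in> C\<close> by (auto simp: U_def)
        then show "e \<in> X" using e by (auto simp: X_def)
      qed
      then have "card (E \<inter> boundary n U) \<le> card X" using finE by (intro card_mono) (auto simp: X_def)
      \<comment> \<open>Every class other than the huge one contains a vertex of
        \<open>U\<close>.\<close>
      moreover have "card P - 1 \<le> card U"
      proof -
        have "P - {C} \<subseteq> (\<lambda>v. conn E0 `` {v}) ` U"
        proof
          fix D assume D: "D \<in> P - {C}"
          then obtain v where v: "v \<in> {1..n}" "D = conn E0 `` {v}" unfolding P_def comps_def by blast
          have "v \<in> D" using v by simp
          moreover have "C \<inter> D = {}" using D C(1) by (intro disjP) auto
          ultimately have "v \<in> U" using v(1) unfolding U_def by blast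
          then show "D \<in> (\<lambda>v. conn E0 `` {v}) ` U" using v by auto
        qed
        then have "card (P - {C}) \<le> card U" by (rule surj_card_le[rotated]) (simp add: U_def)
        then show ?thesis using C finP by simp
      qed
      ultimately show ?thesis using bd by (meson le_trans mult_le_mono2)
    next
      case False
      \<comment> \<open>Summed over all classes, the inner edges number at most r (n - |P|). There
        are r (n - 1) edges in all, so at least r (|P| - 1) of them cross.\<close>
      define r where "r = real (card E) / (real n - 1)"
      have inn: "real (card (E \<inter> inner_edges C)) \<le> r * (real (card C) - 1)" if "C \<in> P" for C
        unfolding r_def using False that PV neP by (intro sparse) auto
      have "E = X \<union> (\<Union>C\<in>P. E \<inter> inner_edges C)"
        using E by (auto simp: X_def inner_edges_def all_edges_def)
      then have "card E \<le> card X + card (\<Union>C\<in>P. E \<inter> inner_edges C)"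
        by (metis card_Un_le)
      also have "card (\<Union>C\<in>P. E \<inter> inner_edges C) \<le> (\<Sum>C\<in>P. card (E \<inter> inner_edges C))"
        using finP by (rule card_UN_le)
      finally have "real (card E) \<le> real (card X) + (\<Sum>C\<in>P. real (card (E \<inter> inner_edges C)))"
        by (simp flip: of_nat_sum of_nat_add)
      also have "(\<Sum>C\<in>P. real (card (E \<inter> inner_edges C))) \<le> (\<Sum>C\<in>P. r * (real (card C) - 1))"
        using inn by (rule sum_mono)
      also have "\<dots> = r * (real (\<Sum>C\<in>P. card C) - real (card P))"
        by (simp add: sum_distrib_left[symmetric] sum_subtractf)
      also have "(\<Sum>C\<in>P. card C) = card (\<Union> P)"
        using finC disjP by (intro card_Union_disjoint[symmetric]) (auto simp: pairwise_def disjnt_def)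
      also have "\<dots> = n" by (simp add: UP)
      finally have "real (card E) \<le> real (card X) + r * (real n - real (card P))" by simp
      moreover have "real (card E) = r * (real n - 1)" using n by (simp add: r_def)
      ultimately have "r * (real (card P) - 1) \<le> real (card X)" by (simp add: algebra_simps)
      moreover have "real t * (real (card P) - 1) \<le> r * (real (card P) - 1)"
        using t P0 unfolding r_def by (intro mult_right_mono) auto
      ultimately have "real (t * (card P - 1)) \<le> real (card X)" using P0 by (simp add: of_nat_diff)
      then show ?thesis by linarith
    qed
    then show ?thesis by (simp add: P_def X_def)
  qed
  then obtain F where F: "forest_packing E t F"
    "\<And>i x y. i < t \<Longrightarrow> x \<in> {1..n} \<Longrightarrow> y \<in> {1..n} \<Longrightarrow> (x, y) \<in> conn (F i)"
    using spanning_forest_packing[of "{1..n}" E t] E' n by auto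
  then have "tree_family n E t F"
    using forest_acyclic
    by (auto simp: tree_family_def spanning_tree_def forest_packing_def connected_on_def conn_def)
  then show ?thesis using tree_packing_bounds(3)[OF E n] by blast
qed

section \<open>Random subsets of a finite set\<close>

text \<open>Expectation over a random subset of \<open>A\<close> that contains each element
  independently with probability p. With the ground set as a parameter, the marginal on a subset of
  the potential edges has the same form.\<close>

definition bexp :: "'a set \<Rightarrow> real \<Rightarrow> ('a set \<Rightarrow> real) \<Rightarrow> real" where
  "bexp A p f = (\<Sum>E\<in>Pow A. p ^ card E * (1 - p) ^ (card A - card E) * f E)"

definition bprob :: "'a set \<Rightarrow> real \<Rightarrow> ('a set \<Rightarrow> bool) \<Rightarrow> real" where
  "bprob A p P = bexp A p (\<lambda>E. of_bool (P E))"

lemma bexp_cong: "(\<And>E. E \<subseteq> A \<Longrightarrow> f E = g E) \<Longrightarrow> bexp A p f = bexp A p g"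
  unfolding bexp_def by (rule sum.cong) auto

lemma bexp_empty [simp]: "bexp {} p f = f {}"
  by (simp add: bexp_def)

text \<open>Conditioning on a single element; the product structure of the distribution is derived
  from this by induction on the ground set.\<close>

lemma bexp_insert:
  assumes "finite A" "a \<notin> A"
  shows "bexp (insert a A) p f = p * bexp A p (\<lambda>E. f (insert a E)) + (1 - p) * bexp A p f"
proof -
  let ?w = "\<lambda>E. p ^ card E * (1 - p) ^ (card (insert a A) - card E) * f E"
  have inj: "inj_on (insert a) (Pow A)"
    using assms by (intro inj_onI) (metis PowD insert_ident subsetD)
  have fin: "finite E" if "E \<in> Pow A" for E using that assms finite_subset by auto
  have "bexp (insert a A) p f = sum ?w (Pow A) + sum ?w (insert a ` Pow A)"
    unfolding bexp_def Pow_insert using assms by (intro sum.union_disjoint) auto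
  also have "sum ?w (insert a ` Pow A) = p * bexp A p (\<lambda>E. f (insert a E))"
    unfolding bexp_def sum_distrib_left sum.reindex[OF inj]
  proof (rule sum.cong[OF refl])
    fix E assume E: "E \<in> Pow A"
    then have "a \<notin> E" using assms by auto
    then show "(?w \<circ> insert a) E = p * (p ^ card E * (1 - p) ^ (card A - card E) * f (insert a E))"
      using assms fin[OF E] by simp
  qed
  also have "sum ?w (Pow A) = (1 - p) * bexp A p f"
    unfolding bexp_def sum_distrib_left
  proof (rule sum.cong[OF refl])
    fix E assume E: "E \<in> Pow A"
    then have "card E \<le> card A" using assms by (auto intro: card_mono)
    then show "?w E = (1 - p) * (p ^ card E * (1 - p) ^ (card A - card E) * f E)"
      using assms by (simp add: Suc_diff_le)
  qed
  finally show ?thesis by simp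
qed

lemma bexp_add: "bexp A p (\<lambda>E. f E + g E) = bexp A p f + bexp A p g"
  by (simp add: bexp_def algebra_simps sum.distrib)

lemma bexp_cmult: "bexp A p (\<lambda>E. c * f E) = c * bexp A p f"
  by (simp add: bexp_def algebra_simps sum_distrib_left)

lemma bexp_sum: "bexp A p (\<lambda>E. \<Sum>i\<in>I. f i E) = (\<Sum>i\<in>I. bexp A p (f i))"
  unfolding bexp_def sum_distrib_left by (rule sum.swap)

lemma bexp_mono:
  assumes "0 \<le> p" "p \<le> 1" "\<And>E. E \<subseteq> A \<Longrightarrow> f E \<le> g E"
  shows "bexp A p f \<le> bexp A p g"
  unfolding bexp_def using assms by (intro sum_mono mult_left_mono) auto

lemma bexp_const: "finite A \<Longrightarrow> bexp A p (\<lambda>_. c) = c"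
  by (induction A rule: finite_induct) (simp_all add: bexp_insert algebra_simps)

text \<open>Independence of disjoint parts. Conditioning on an element b of \<open>B\<close>
  replaces f by another function of the remaining elements, hence the induction for arbitrary
  f.\<close>

lemma bexp_Un:
  assumes "finite B" "finite C" "B \<inter> C = {}"
  shows "bexp (B \<union> C) p (\<lambda>E. f (E \<inter> B) * g (E \<inter> C)) = bexp B p f * bexp C p g"
  using assms(1,3)
proof (induction B arbitrary: f rule: finite_induct)
  case empty
  have "bexp C p (\<lambda>E. f {} * g (E \<inter> C)) = bexp C p (\<lambda>E. f {} * g E)"
    by (rule bexp_cong) (simp add: Int_absorb2)
  then show ?case by (simp add: bexp_cmult)
next
  case (insert b B)
  have "bexp (insert b B \<union> C) p (\<lambda>E. f (E \<inter> insert b B) * g (E \<inter> C))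
    = p * bexp (B \<union> C) p (\<lambda>E. f (insert b E \<inter> insert b B) * g (insert b E \<inter> C))
      + (1 - p) * bexp (B \<union> C) p (\<lambda>E. f (E \<inter> insert b B) * g (E \<inter> C))"
    using insert assms(2) by (simp add: bexp_insert)
  also have "bexp (B \<union> C) p (\<lambda>E. f (insert b E \<inter> insert b B) * g (insert b E \<inter> C))
     = bexp (B \<union> C) p (\<lambda>E. f (insert b (E \<inter> B)) * g (E \<inter> C))"
  proof (rule bexp_cong)
    fix E assume "E \<subseteq> B \<union> C"
    have "insert b E \<inter> insert b B = insert b (E \<inter> B)" by blast
    moreover have "insert b E \<inter> C = E \<inter> C" using insert by blast
    ultimately show "f (insert b E \<inter> insert b B) * g (insert b E \<inter> C)
      = f (insert b (E \<inter> B)) * g (E \<inter> C)" by simp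
  qed
  also have "bexp (B \<union> C) p (\<lambda>E. f (E \<inter> insert b B) * g (E \<inter> C))
     = bexp (B \<union> C) p (\<lambda>E. f (E \<inter> B) * g (E \<inter> C))"
  proof (rule bexp_cong)
    fix E assume "E \<subseteq> B \<union> C"
    then have "E \<inter> insert b B = E \<inter> B" using insert by blast
    then show "f (E \<inter> insert b B) * g (E \<inter> C) = f (E \<inter> B) * g (E \<inter> C)" by simp
  qed
  also have "bexp (B \<union> C) p (\<lambda>E. f (insert b (E \<inter> B)) * g (E \<inter> C))
    = bexp B p (\<lambda>E. f (insert b E)) * bexp C p g"
    using insert.IH[of "\<lambda>E. f (insert b E)"] insert.prems by simp
  also have "bexp (B \<union> C) p (\<lambda>E. f (E \<inter> B) * g (E \<inter> C)) = bexp B p f * bexp C p g"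
    using insert by simp
  finally show ?case using insert by (simp add: bexp_insert algebra_simps)
qed

lemma bexp_restrict:
  assumes "finite A" "B \<subseteq> A"
  shows "bexp A p (\<lambda>E. f (E \<inter> B)) = bexp B p f"
proof -
  have "B \<union> (A - B) = A" using assms by auto
  then show ?thesis
    using bexp_Un[of B "A - B" p f "\<lambda>_. 1"] assms by (simp add: bexp_const finite_subset)
qed

lemma bexp_indep:
  assumes "finite A" "B \<subseteq> A" "C \<subseteq> A" "B \<inter> C = {}"
  shows "bexp A p (\<lambda>E. f (E \<inter> B) * g (E \<inter> C)) = bexp B p f * bexp C p g"
proof -
  have "bexp A p (\<lambda>E. f (E \<inter> B) * g (E \<inter> C))
    = bexp A p (\<lambda>E. f (E \<inter> (B \<union> C) \<inter> B) * g (E \<inter> (B \<union> C) \<inter> C))"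
  proof (rule bexp_cong)
    fix E
    have "E \<inter> (B \<union> C) \<inter> B = E \<inter> B" "E \<inter> (B \<union> C) \<inter> C = E \<inter> C" by blast+
    then show "f (E \<inter> B) * g (E \<inter> C) = f (E \<inter> (B \<union> C) \<inter> B) * g (E \<inter> (B \<union> C) \<inter> C)" by simp
  qed
  also have "\<dots> = bexp (B \<union> C) p (\<lambda>E. f (E \<inter> B) * g (E \<inter> C))"
    using assms by (intro bexp_restrict[where f = "\<lambda>E. f (E \<inter> B) * g (E \<inter> C)"]) auto
  also have "\<dots> = bexp B p f * bexp C p g"
    using assms finite_subset[of _ A] by (intro bexp_Un) auto
  finally show ?thesis .
qed

lemma bprob_restrict:
  "finite A \<Longrightarrow> B \<subseteq> A \<Longrightarrow> bprob A p (\<lambda>E. P (E \<inter> B)) = bprob B p P"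
  unfolding bprob_def by (rule bexp_restrict)

lemma bprob_indep:
  assumes "finite A" "B \<subseteq> A" "C \<subseteq> A" "B \<inter> C = {}"
  shows "bprob A p (\<lambda>E. P (E \<inter> B) \<and> Q (E \<inter> C)) = bprob B p P * bprob C p Q"
  unfolding bprob_def of_bool_conj using assms by (rule bexp_indep)

lemma bprob_nonneg: "0 \<le> p \<Longrightarrow> p \<le> 1 \<Longrightarrow> 0 \<le> bprob A p P"
  by (auto simp: bprob_def bexp_def intro!: sum_nonneg)

lemma bprob_mono:
  assumes "0 \<le> p" "p \<le> 1" "\<And>E. E \<subseteq> A \<Longrightarrow> P E \<Longrightarrow> Q E"
  shows "bprob A p P \<le> bprob A p Q"
  unfolding bprob_def using assms by (intro bexp_mono) auto

lemma bprob_not: "finite A \<Longrightarrow> bprob A p (\<lambda>E. \<not> P E) = 1 - bprob A p P"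
proof -
  assume "finite A"
  moreover have "bexp A p (\<lambda>E. of_bool (P E) + of_bool (\<not> P E)) = bexp A p (\<lambda>_. 1)"
    by (rule bexp_cong) simp
  ultimately show ?thesis unfolding bexp_add bprob_def by (simp add: bexp_const)
qed

lemma bprob_le_1: "finite A \<Longrightarrow> 0 \<le> p \<Longrightarrow> p \<le> 1 \<Longrightarrow> bprob A p P \<le> 1"
  using bprob_not[of A p P] bprob_nonneg[of p A "\<lambda>E. \<not> P E"] by simp

lemma bprob_disj:
  assumes "0 \<le> p" "p \<le> 1"
  shows "bprob A p (\<lambda>E. P E \<or> Q E) \<le> bprob A p P + bprob A p Q"
  unfolding bprob_def bexp_add[symmetric] using assms by (intro bexp_mono) auto

lemma bprob_Ex:
  assumes "0 \<le> p" "p \<le> 1" "finite I"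
  shows "bprob A p (\<lambda>E. \<exists>i\<in>I. P i E) \<le> (\<Sum>i\<in>I. bprob A p (P i))"
  unfolding bprob_def bexp_sum[symmetric]
proof (rule bexp_mono[OF assms(1,2)])
  fix E
  show "of_bool (\<exists>i\<in>I. P i E) \<le> (\<Sum>i\<in>I. of_bool (P i E) :: real)"
  proof (cases "\<exists>i\<in>I. P i E")
    case True
    then obtain i where "i \<in> I" "P i E" by blast
    then have "of_bool (P i E) \<le> (\<Sum>i\<in>I. of_bool (P i E) :: real)"
      using assms(3) by (intro member_le_sum) auto
    then show ?thesis using True \<open>P i E\<close> by simp
  qed (auto intro: sum_nonneg)
qed

lemma bprob_markov:
  assumes "0 \<le> p" "p \<le> 1" "\<And>E. E \<subseteq> A \<Longrightarrow> P E \<Longrightarrow> c \<le> f E" "\<And>E. E \<subseteq> A \<Longrightarrow> 0 \<le> f E"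
  shows "c * bprob A p P \<le> bexp A p f"
  unfolding bprob_def bexp_cmult[symmetric] using assms by (intro bexp_mono) auto

section \<open>Generating function, Chernoff and Chebyshev bounds, binomial tails\<close>

lemma bexp_power_card: "finite A \<Longrightarrow> bexp A p (\<lambda>E. y ^ card E) = (1 + p * (y - 1)) ^ card A"
proof (induction A rule: finite_induct)
  case (insert a A)
  have "bexp A p (\<lambda>E. y ^ card (insert a E)) = bexp A p (\<lambda>E. y * y ^ card E)"
  proof (rule bexp_cong)
    fix E assume "E \<subseteq> A"
    then have "finite E" "a \<notin> E" using insert finite_subset by auto
    then show "y ^ card (insert a E) = y * y ^ card E" by simp
  qed
  then show ?case using insert by (simp add: bexp_insert bexp_cmult algebra_simps)
qed simp

lemma bexp_power_card_le:
  assumes "finite A" "0 \<le> p" "p \<le> 1" "0 \<le> y"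
  shows "bexp A p (\<lambda>E. y ^ card E) \<le> exp (p * card A * (y - 1))"
proof -
  have "0 \<le> (1 - p) + p * y" using assms by (intro add_nonneg_nonneg mult_nonneg_nonneg) auto
  then have "(1 + p * (y - 1)) ^ card A \<le> exp (p * (y - 1)) ^ card A"
    by (intro power_mono exp_ge_add_one_self) (simp add: algebra_simps)
  also have "\<dots> = exp (p * card A * (y - 1))"
    by (simp add: algebra_simps flip: exp_of_nat_mult)
  finally show ?thesis using assms by (simp add: bexp_power_card)
qed

text \<open>Markov's inequality for y^|E \<inter> B| z^|E \<inter> C|, whose expectation factors by
  independence. An empty \<open>B\<close> or \<open>C\<close> gives the one-sided bounds.\<close>

lemma chernoff_joint:
  assumes "finite A" "B \<subseteq> A" "C \<subseteq> A" "B \<inter> C = {}" "0 \<le> p" "p \<le> 1" "1 \<le> y" "0 < z" "z \<le> 1"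
  shows "bprob A p (\<lambda>E. b \<le> real (card (E \<inter> B)) \<and> real (card (E \<inter> C)) \<le> c)
    \<le> y powr (-b) * z powr (-c) * exp (p * card B * (y - 1) - p * card C * (1 - z))"
proof -
  let ?P = "\<lambda>E. b \<le> real (card (E \<inter> B)) \<and> real (card (E \<inter> C)) \<le> c"
  have "y powr b * z powr c * bprob A p ?P \<le> bexp A p (\<lambda>E. y ^ card (E \<inter> B) * z ^ card (E \<inter> C))"
  proof (rule bprob_markov[OF assms(5,6)])
    fix E assume "?P E"
    then have "y powr b \<le> y powr real (card (E \<inter> B))" "z powr c \<le> z powr real (card (E \<inter> C))"
      using assms by (auto intro: powr_mono powr_mono')
    then show "y powr b * z powr c \<le> y ^ card (E \<inter> B) * z ^ card (E \<inter> C)"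
      using assms by (intro mult_mono) (auto simp: powr_realpow)
  qed (use assms in auto)
  also have "\<dots> = bexp B p (\<lambda>E. y ^ card E) * bexp C p (\<lambda>E. z ^ card E)"
    using assms(1-4) by (rule bexp_indep)
  also have "\<dots> \<le> exp (p * card B * (y - 1)) * exp (p * card C * (z - 1))"
  proof (intro mult_mono bexp_power_card_le)
    show "0 \<le> bexp C p (\<lambda>E. z ^ card E)"
      using assms unfolding bexp_def by (intro sum_nonneg) auto
  qed (use assms finite_subset[of _ A] in auto)
  also have "\<dots> = exp (p * card B * (y - 1) - p * card C * (1 - z))"
    by (simp add: algebra_simps flip: exp_add)
  finally show ?thesis using assms by (simp add: powr_minus field_simps)
qed

lemma chernoff_upper:
  assumes "finite A" "B \<subseteq> A" "0 \<le> p" "p \<le> 1" "1 \<le> y"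
  shows "bprob A p (\<lambda>E. b \<le> real (card (E \<inter> B))) \<le> y powr (-b) * exp (p * card B * (y - 1))"
  using chernoff_joint[of A B "{}" p y 1 b 0] assms by simp

lemma chernoff_lower:
  assumes "finite A" "C \<subseteq> A" "0 \<le> p" "p \<le> 1" "0 < z" "z \<le> 1"
  shows "bprob A p (\<lambda>E. real (card (E \<inter> C)) \<le> c) \<le> z powr (-c) * exp (- (p * card C * (1 - z)))"
  using chernoff_joint[of A "{}" C p 1 z 0 c] assms by simp

text \<open>Mean and variance share one induction because the cross term in the shifted square
  disappears only when the mean is zero.\<close>

lemma bexp_variance:
  fixes p :: real
  assumes "finite A"
  shows "bexp A p (\<lambda>E. real (card E) - p * card A) = 0 \<and>
    bexp A p (\<lambda>E. (real (card E) - p * card A)\<^sup>2) = card A * p * (1 - p)"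
  using assms
proof (induction A rule: finite_induct)
  case (insert a A)
  define X where "X = (\<lambda>E :: 'a set. real (card E) - p * card A)"
  have IH: "bexp A p X = 0" "bexp A p (\<lambda>E. (X E)\<^sup>2) = card A * p * (1 - p)"
    using insert.IH by (auto simp: X_def)
  have c: "real (card (insert a E)) - p * card (insert a A) = X E + (1 - p)"
     "real (card E) - p * card (insert a A) = X E - p" if "E \<subseteq> A" for E
    using that insert finite_subset[of E A] by (auto simp: X_def algebra_simps card_insert_if)
  have 1: "bexp A p (\<lambda>E. f (real (card (insert a E)) - p * card (insert a A))) = bexp A p (\<lambda>E. f (X E + (1 - p)))"
     "bexp A p (\<lambda>E. f (real (card E) - p * card (insert a A))) = bexp A p (\<lambda>E. f (X E - p))" for f
    by (rule bexp_cong; simp only: c)+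
  have lin: "bexp A p (\<lambda>E. X E + d) = d" for d
    using insert.hyps IH by (simp add: bexp_add bexp_const)
  have "bexp A p (\<lambda>E. (X E + d)\<^sup>2) = bexp A p (\<lambda>E. (X E)\<^sup>2 + (2 * d * X E + d\<^sup>2))" for d
    by (rule bexp_cong) (simp add: power2_eq_square algebra_simps)
  then have sq: "bexp A p (\<lambda>E. (X E + d)\<^sup>2) = card A * p * (1 - p) + d\<^sup>2" for d
    using insert.hyps IH by (simp add: bexp_add bexp_cmult bexp_const)
  show ?case
    using insert.hyps lin[of "1 - p"] lin[of "- p"] sq[of "1 - p"] sq[of "- p"]
      1[of "\<lambda>x. x"] 1[of "\<lambda>x. x\<^sup>2"]
    by (simp add: bexp_insert del: card_insert_disjoint)
       (simp add: insert.hyps algebra_simps power2_eq_square)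
qed simp

lemma chebyshev_card:
  fixes p :: real
  assumes "finite A" "0 \<le> p" "p \<le> 1" "0 < d"
  shows "bprob A p (\<lambda>E. d \<le> \<bar>real (card E) - p * card A\<bar>) \<le> card A * p / d\<^sup>2"
proof -
  have "d\<^sup>2 * bprob A p (\<lambda>E. d \<le> \<bar>real (card E) - p * card A\<bar>)
      \<le> bexp A p (\<lambda>E. (real (card E) - p * card A)\<^sup>2)"
    using assms by (intro bprob_markov) (auto simp: abs_le_square_iff[symmetric])
  also have "\<dots> = card A * p * (1 - p)" using bexp_variance[OF assms(1)] by blast
  also have "\<dots> \<le> card A * p" using assms by (simp add: mult_left_le)
  finally show ?thesis using assms by (simp add: field_simps)
qed

definition binom_cdf :: "nat \<Rightarrow> real \<Rightarrow> nat \<Rightarrow> real" where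
  "binom_cdf N p k = (\<Sum>j\<le>k. real (N choose j) * p ^ j * (1 - p) ^ (N - j))"

lemma bprob_card_le:
  assumes "finite A" "B \<subseteq> A"
  shows "bprob A p (\<lambda>E. card (E \<inter> B) \<le> k) = binom_cdf (card B) p k"
proof -
  have fB: "finite B" using assms finite_subset by blast
  have "bprob A p (\<lambda>E. card (E \<inter> B) \<le> k) = bprob B p (\<lambda>E. card E \<le> k)"
    using assms by (rule bprob_restrict)
  also have "\<dots> = (\<Sum>E\<in>Pow B. \<Sum>j\<le>k. if card E = j then p ^ j * (1 - p) ^ (card B - j) else 0)"
    unfolding bprob_def bexp_def by (rule sum.cong) (auto simp: sum.delta)
  also have "\<dots> = (\<Sum>j\<le>k. \<Sum>E\<in>Pow B. if card E = j then p ^ j * (1 - p) ^ (card B - j) else 0)"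
    by (rule sum.swap)
  also have "\<dots> = (\<Sum>j\<le>k. \<Sum>E\<in>{E. E \<subseteq> B \<and> card E = j}. p ^ j * (1 - p) ^ (card B - j))"
    using fB by (intro sum.cong refl sum.mono_neutral_cong_right) auto
  also have "\<dots> = binom_cdf (card B) p k"
    unfolding binom_cdf_def using fB by (simp add: n_subsets algebra_simps)
  finally show ?thesis .
qed

section \<open>Degrees of the random graph\<close>

lemma gnp_prob_eq: "gnp_prob n p P = bprob (all_edges n) p P"
proof -
  have "bprob (all_edges n) p P = (\<Sum>E\<in>Pow (all_edges n).
      if P E then p ^ card E * (1 - p) ^ (card (all_edges n) - card E) else 0)"
    unfolding bprob_def bexp_def by (rule sum.cong) auto
  also have "\<dots> = gnp_prob n p P"
    unfolding gnp_prob_def by (intro sum.mono_neutral_cong_right) auto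
  finally show ?thesis by simp
qed

lemma degree_star:
  assumes "E \<subseteq> all_edges n"
  shows "degree E v \<le> card (E \<inter> (boundary n {v} - {{u, v}})) + of_bool ({u, v} \<in> E)"
    and "card (E \<inter> (boundary n {v} - {{u, v}})) \<le> degree E v"
proof -
  define X where "X = E \<inter> boundary n {v}"
  have fin: "finite X" using finite_graph[OF assms] by (simp add: X_def)
  have 1: "E \<inter> (boundary n {v} - {{u, v}}) = X - {{u, v}}" by (auto simp: X_def)
  have 2: "degree E v = card X" by (simp add: degree_boundary[OF assms] X_def)
  have 3: "{u, v} \<in> X \<Longrightarrow> {u, v} \<in> E" by (simp add: X_def)
  show "degree E v \<le> card (E \<inter> (boundary n {v} - {{u, v}})) + of_bool ({u, v} \<in> E)"
     "card (E \<inter> (boundary n {v} - {{u, v}})) \<le> degree E v"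
    unfolding 1 2 using fin 3 by (simp_all add: card_Diff_singleton_if) linarith
qed

lemma prob_degree_le:
  assumes "v \<in> {1..n}"
  shows "bprob (all_edges n) p (\<lambda>E. degree E v \<le> k) = binom_cdf (n - 1) p k"
proof -
  have "bprob (all_edges n) p (\<lambda>E. degree E v \<le> k)
      = bprob (all_edges n) p (\<lambda>E. card (E \<inter> boundary n {v}) \<le> k)"
    unfolding bprob_def by (rule bexp_cong) (simp add: degree_boundary)
  then show ?thesis
    using assms by (simp add: bprob_card_le boundary_subset card_boundary)
qed

lemma edge_star:
  assumes "u \<in> {1..n}" "v \<in> {1..n}" "u \<noteq> v"
  shows "{u, v} \<in> boundary n {v}" "card (boundary n {v} - {{u, v}}) = n - 2"
    "(boundary n {u} - {{u, v}}) \<inter> (boundary n {v} - {{u, v}}) = {}"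
proof -
  show 1: "{u, v} \<in> boundary n {v}" using assms by (auto simp: boundary_def all_edges_def)
  have "finite (boundary n {v})" using finite_graph boundary_subset by blast
  then show "card (boundary n {v} - {{u, v}}) = n - 2"
    using 1 assms by (simp add: card_boundary)
  have "e = {u, v}" if "e \<in> boundary n {u}" "e \<in> boundary n {v}" for e
    using that assms unfolding boundary_def by (intro all_edges_eq[of e n]) blast+
  then show "(boundary n {u} - {{u, v}}) \<inter> (boundary n {v} - {{u, v}}) = {}" by blast
qed

text \<open>Once the edge \<open>{u, v}\<close> is ignored, the degrees of \<open>u\<close> and \<open>v\<close> are independent.\<close>

lemma prob_two_degrees_le:
  assumes "0 \<le> p" "p \<le> 1" "u \<in> {1..n}" "v \<in> {1..n}" "u \<noteq> v"
  shows "bprob (all_edges n) p (\<lambda>E. degree E u \<le> k \<and> degree E v \<le> k) \<le> (binom_cdf (n - 2) p k)\<^sup>2"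
    and "(1 - p) * binom_cdf (n - 2) p k \<le> binom_cdf (n - 1) p k"
proof -
  let ?A = "all_edges n"
  let ?B = "boundary n {u} - {{u, v}}" and ?C = "boundary n {v} - {{u, v}}"
  have sub: "?B \<subseteq> ?A" "?C \<subseteq> ?A" using boundary_subset by auto
  have cB: "card ?B = n - 2" "card ?C = n - 2"
    using edge_star[of v n u] edge_star[of u n v] assms by (auto simp: insert_commute)
  have q: "bprob ?B p (\<lambda>E. card E \<le> k) = binom_cdf (n - 2) p k"
    "bprob ?C p (\<lambda>E. card E \<le> k) = binom_cdf (n - 2) p k"
    using bprob_card_le[of ?A ?B p k] bprob_restrict[of ?A ?B p "\<lambda>E. card E \<le> k"]
      bprob_card_le[of ?A ?C p k] bprob_restrict[of ?A ?C p "\<lambda>E. card E \<le> k"] sub cB by auto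
  have "bprob ?A p (\<lambda>E. degree E u \<le> k \<and> degree E v \<le> k)
      \<le> bprob ?A p (\<lambda>E. card (E \<inter> ?B) \<le> k \<and> card (E \<inter> ?C) \<le> k)"
  proof (rule bprob_mono[OF assms(1,2)])
    fix E assume E: "E \<subseteq> ?A" and "degree E u \<le> k \<and> degree E v \<le> k"
    moreover have "card (E \<inter> ?B) \<le> degree E u"
      using degree_star(2)[OF E, of u v] by (simp add: insert_commute)
    moreover have "card (E \<inter> ?C) \<le> degree E v"
      using degree_star(2)[OF E, of v u] by simp
    ultimately show "card (E \<inter> ?B) \<le> k \<and> card (E \<inter> ?C) \<le> k" by linarith
  qed
  also have "\<dots> = bprob ?B p (\<lambda>E. card E \<le> k) * bprob ?C p (\<lambda>E. card E \<le> k)"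
    using sub edge_star[of u n v] assms by (intro bprob_indep) auto
  finally show "bprob ?A p (\<lambda>E. degree E u \<le> k \<and> degree E v \<le> k) \<le> (binom_cdf (n - 2) p k)\<^sup>2"
    unfolding q by (simp add: power2_eq_square)
  have e: "{u, v} \<in> ?A" using edge_star(1)[of u n v] boundary_subset assms by blast
  have "bprob {{u, v}} p (\<lambda>E. E = {}) = 1 - p"
    by (simp add: bprob_def bexp_insert)
  \<comment> \<open>When the edge {u, v} is absent, the other n - 2 potential edges determine the
    degree of v. This compares the two distribution functions without touching binomial
    coefficients.\<close>
  then have "(1 - p) * binom_cdf (n - 2) p k
      = bprob ?A p (\<lambda>E. E \<inter> {{u, v}} = {} \<and> card (E \<inter> ?C) \<le> k)"
    using bprob_indep[of ?A "{{u, v}}" ?C p "\<lambda>E. E = {}" "\<lambda>E. card E \<le> k"] sub e q by auto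
  also have "\<dots> \<le> bprob ?A p (\<lambda>E. degree E v \<le> k)"
  proof (rule bprob_mono[OF assms(1,2)])
    fix E assume E: "E \<subseteq> ?A" and *: "E \<inter> {{u, v}} = {} \<and> card (E \<inter> ?C) \<le> k"
    then have "{u, v} \<notin> E" by blast
    then show "degree E v \<le> k" using degree_star(1)[OF E, of v u] * by simp
  qed
  finally show "(1 - p) * binom_cdf (n - 2) p k \<le> binom_cdf (n - 1) p k"
    using assms by (simp add: prob_degree_le)
qed

text \<open>Chebyshev's inequality for the number X of vertices of degree at most k, at X = 0. With
  a and q the distribution functions for n - 1 and n - 2 trials, the diagonal pairs contribute 1/(n
  a). Distinct pairs contribute at most (q/a)^2 - 1, and q \<le> a/(1 - p), so their correlation
  disappears as p tends to 0.\<close>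

lemma prob_min_degree_gt:
  assumes "0 \<le> p" "p < 1" "n \<ge> 2" and q: "binom_cdf (n - 2) p k > 0"
  shows "bprob (all_edges n) p (\<lambda>E. \<forall>v\<in>{1..n}. k < degree E v)
    \<le> 1 / (real n * (1 - p) * binom_cdf (n - 2) p k) + (1 / (1 - p)\<^sup>2 - 1)"
proof -
  let ?A = "all_edges n"
  define a where "a = binom_cdf (n - 1) p k"
  define q where "q = binom_cdf (n - 2) p k"
  have aq: "(1 - p) * q \<le> a" unfolding a_def q_def
    by (rule prob_two_degrees_le(2)[of p 1 n 2]) (use assms in auto)
  have q0: "0 < q" using q by (simp add: q_def)
  have a0: "0 < a" using aq q0 assms by (smt (verit) mult_pos_pos)
  define X where "X = (\<lambda>E. \<Sum>v\<in>{1..n}. of_bool (degree E v \<le> k) :: real)"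
  have EX: "bexp ?A p X = n * a"
    unfolding X_def bexp_sum using prob_degree_le[of _ n p k] by (simp add: bprob_def a_def)
  have "bexp ?A p (\<lambda>E. (X E)\<^sup>2)
      = bexp ?A p (\<lambda>E. \<Sum>u\<in>{1..n}. \<Sum>v\<in>{1..n}. of_bool (degree E u \<le> k \<and> degree E v \<le> k))"
    unfolding X_def power2_eq_square sum_product of_bool_conj by (rule refl)
  also have "\<dots> = (\<Sum>u\<in>{1..n}. \<Sum>v\<in>{1..n}. bprob ?A p (\<lambda>E. degree E u \<le> k \<and> degree E v \<le> k))"
    unfolding bexp_sum bprob_def by (rule refl)
  also have "\<dots> \<le> (\<Sum>u\<in>{1..n}. \<Sum>v\<in>{1..n}. q\<^sup>2 + (if u = v then a else 0))"
  proof (intro sum_mono)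
    fix u v assume uv: "u \<in> {1..n}" "v \<in> {1..n}"
    show "bprob ?A p (\<lambda>E. degree E u \<le> k \<and> degree E v \<le> k) \<le> q\<^sup>2 + (if u = v then a else 0)"
    proof (cases "u = v")
      case True
      then show ?thesis using prob_degree_le[OF uv(1), of p k] by (simp add: a_def)
    next
      case False
      then show ?thesis using prob_two_degrees_le(1)[of p u n v k] assms uv by (simp add: q_def)
    qed
  qed
  also have "\<dots> = (real n)\<^sup>2 * q\<^sup>2 + n * a"
    by (simp add: sum.distrib power2_eq_square algebra_simps)
  finally have EX2: "bexp ?A p (\<lambda>E. (X E)\<^sup>2) \<le> (real n)\<^sup>2 * q\<^sup>2 + n * a" .
  have "(n * a)\<^sup>2 * bprob ?A p (\<lambda>E. \<forall>v\<in>{1..n}. k < degree E v)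
      \<le> bexp ?A p (\<lambda>E. (X E - n * a)\<^sup>2)"
  proof (rule bprob_markov)
    fix E assume "\<forall>v\<in>{1..n}. k < degree E v"
    then have "X E = 0" unfolding X_def by (intro sum.neutral) auto
    then show "(n * a)\<^sup>2 \<le> (X E - n * a)\<^sup>2" by simp
  qed (use assms in auto)
  also have "\<dots> = bexp ?A p (\<lambda>E. (X E)\<^sup>2 + ((- 2 * n * a) * X E + (n * a)\<^sup>2))"
    by (rule bexp_cong) (simp add: power2_eq_square algebra_simps)
  also have "\<dots> = bexp ?A p (\<lambda>E. (X E)\<^sup>2) - (n * a)\<^sup>2"
    unfolding bexp_add bexp_cmult EX by (simp add: bexp_const power2_eq_square)
  also have "\<dots> \<le> (real n)\<^sup>2 * q\<^sup>2 + n * a - (n * a)\<^sup>2" using EX2 by simp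
  finally have "bprob ?A p (\<lambda>E. \<forall>v\<in>{1..n}. k < degree E v)
      \<le> ((real n)\<^sup>2 * q\<^sup>2 + n * a - (n * a)\<^sup>2) / (n * a)\<^sup>2"
    using a0 assms by (simp add: pos_le_divide_eq mult.commute)
  also have "\<dots> = (q / a)\<^sup>2 + 1 / (n * a) - 1"
    using a0 assms by (simp add: field_simps power2_eq_square)
  also have "(q / a)\<^sup>2 \<le> (1 / (1 - p))\<^sup>2"
    using aq a0 q0 assms by (intro power_mono) (simp_all add: field_simps)
  also have "1 / (n * a) \<le> 1 / (real n * (1 - p) * q)"
    using aq a0 q0 assms by (intro divide_left_mono) (simp_all add: mult.assoc)
  finally show ?thesis by (simp add: q_def power_divide)
qed

section \<open>Stirling and Poisson estimates\<close>

text \<open>Stirling's formula up to a bounded factor. The right-hand side grows at least as fast as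
  \<open>ln (fact k)\<close> because (x + 1/2) ln(1 + 1/x) \<ge> 1.\<close>

lemma ln_fact_le:
  assumes "k \<ge> 1"
  shows "ln (fact k) \<le> 1 + ln (real k) / 2 + (real k * ln (real k) - real k)"
  using assms
proof (induction k rule: nat_induct_at_least)
  case (Suc k)
  define x where "x = real k"
  have x: "x \<ge> 1" using Suc by (simp add: x_def)
  have "2 * (x + 1 - x) / (x + (x + 1)) \<le> ln (x + 1) - ln x"
    using x by (intro ln_inverse_approx_ge) auto
  then have "1 \<le> (x + 1 / 2) * (ln (x + 1) - ln x)"
    using x by (simp add: field_simps)
  moreover have "ln (fact (Suc k)) = ln (x + 1) + ln (fact k)"
    by (simp add: x_def ln_mult add.commute)
  ultimately show ?case using Suc.IH by (simp add: x_def algebra_simps)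
qed simp

lemma ln_fact_ge:
  assumes "k \<ge> 1"
  shows "ln (real k) / 2 + (real k * ln (real k) - real k) \<le> ln (fact k)"
proof -
  \<comment> \<open>The additional 1/(4k) makes the induction work: (x + 1/2) ln(1 + 1/x) exceeds 1
    by at most 1/(4x(x + 1)), which telescopes.\<close>
  have "ln (real k) / 2 + (real k * ln (real k) - real k) + 1 / (4 * real k) \<le> ln (fact k)"
    using assms
  proof (induction k rule: nat_induct_at_least)
    case (Suc k)
    define x where "x = real k"
    have x: "x \<ge> 1" using Suc by (simp add: x_def)
    have "ln (x + 1) - ln x \<le> 1 * (inverse x + inverse (x + 1)) / 2"
      using x by (intro ln_inverse_approx_le) auto
    also have "\<dots> = (x + 1 / 2) / (x * (x + 1))"
      using x by (simp add: field_simps)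
    finally have "(x + 1 / 2) * (ln (x + 1) - ln x) \<le> (x + 1 / 2) * ((x + 1 / 2) / (x * (x + 1)))"
      using x by (intro mult_left_mono) auto
    also have "\<dots> = 1 + 1 / (4 * x) - 1 / (4 * (x + 1))"
    proof -
      have "x \<noteq> 0" "x + 1 \<noteq> 0" using x by auto
      then show ?thesis by (simp add: divide_simps) (simp add: algebra_simps)
    qed
    finally have "(x + 1 / 2) * (ln (x + 1) - ln x) \<le> 1 + 1 / (4 * x) - 1 / (4 * (x + 1))" .
    moreover have "ln (fact (Suc k)) = ln (x + 1) + ln (fact k)"
      by (simp add: x_def ln_mult add.commute)
    ultimately show ?case using Suc.IH by (simp add: x_def algebra_simps)
  qed simp
  moreover have "1 / (4 * real k) \<ge> 0" by simp
  ultimately show ?thesis by linarith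
qed

text \<open>The logarithm of the Poisson probability \<open>\<mu> ^ k * exp (- \<mu>) / fact k\<close> up to a term of order
  \<open>ln k\<close>; at \<open>k = 0\<close> the factor \<open>real k\<close> cancels the junk value \<open>ln (\<mu> / 0)\<close>.\<close>

definition log_poisson :: "real \<Rightarrow> nat \<Rightarrow> real" where
  "log_poisson \<mu> k = real k + real k * ln (\<mu> / real k) - \<mu>"

lemma poisson_le:
  assumes "k \<ge> 1" "\<mu> > 0"
  shows "\<mu> ^ k * exp (- \<mu>) / fact k \<le> exp (log_poisson \<mu> k - ln (real k) / 2)"
proof -
  have "\<mu> ^ k * exp (- \<mu>) / fact k = exp (real k * ln \<mu> - \<mu> - ln (fact k))"
    using assms by (simp add: exp_diff exp_minus exp_of_nat_mult divide_inverse)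
  also have "\<dots> \<le> exp (log_poisson \<mu> k - ln (real k) / 2)"
    using ln_fact_ge[OF assms(1)] assms by (simp add: log_poisson_def ln_div algebra_simps)
  finally show ?thesis .
qed

lemma poisson_ge:
  assumes "k \<ge> 1" "\<mu> > 0"
  shows "exp (log_poisson \<mu> k - ln (real k) / 2 - 1) \<le> \<mu> ^ k * exp (- \<mu>) / fact k"
proof -
  have "\<mu> ^ k * exp (- \<mu>) / fact k = exp (real k * ln \<mu> - \<mu> - ln (fact k))"
    using assms by (simp add: exp_diff exp_minus exp_of_nat_mult divide_inverse)
  moreover have "exp (log_poisson \<mu> k - ln (real k) / 2 - 1) \<le> exp (real k * ln \<mu> - \<mu> - ln (fact k))"
    using ln_fact_le[OF assms(1)] assms by (simp add: log_poisson_def ln_div algebra_simps)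
  ultimately show ?thesis by simp
qed

lemma fact_ge_power: "k \<ge> 1 \<Longrightarrow> (real k / exp 1) ^ k \<le> fact k"
proof -
  assume k: "k \<ge> 1"
  have "(real k / exp 1) ^ k = exp (real k * ln (real k) - real k)"
    using k by (simp add: exp_diff exp_of_nat_mult power_divide flip: exp_of_nat_mult[of k 1])
  also have "\<dots> \<le> exp (ln (fact k))"
    using ln_fact_ge[OF k] k ln_ge_zero[of "real k"] by (subst exp_le_cancel_iff) linarith
  finally show ?thesis by simp
qed

lemma binomial_le_pow_exp:
  assumes "k \<ge> 1"
  shows "real (n choose k) \<le> (exp 1 * real n / real k) ^ k"
proof -
  have "real (n choose k) * (real k / exp 1) ^ k \<le> real (n choose k) * fact k"
    using fact_ge_power[OF assms] by (intro mult_left_mono) auto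
  also have "\<dots> = real ((n choose k) * fact k)" by simp
  also have "\<dots> \<le> real n ^ k" using binomial_fact_pow[of n k] by (metis of_nat_le_iff of_nat_power)
  finally show ?thesis using assms by (simp add: power_divide power_mult_distrib field_simps)
qed

lemma binomial_ge_pow:
  assumes "k \<le> m + 1"
  shows "(real m + 1 - real k) ^ k \<le> real (m choose k) * fact k"
proof (cases "k \<le> m")
  case True
  have "real (m choose k) * fact k = (\<Prod>i<k. real m - real i)"
    by (simp add: binomial_gbinomial gbinomial_mult_fact' atLeast0LessThan)
  moreover have "(\<Prod>i<k. real m + 1 - real k) \<le> (\<Prod>i<k. real m - real i)"
    using True by (intro prod_mono) auto
  ultimately show ?thesis by simp
next
  case False
  then have "k = m + 1" using assms by simp
  then show ?thesis by simp
qed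

text \<open>The term j = k alone suffices. Bernoulli's inequality for the falling factorial and ln(1
  - p) \<ge> -p - 2p^2 for the power each cost a factor 3/4, and 9/16 \<ge> 1/2.\<close>

lemma binom_cdf_ge_poisson:
  assumes p: "0 \<le> p" "p \<le> 1 / 2" and n: "n \<ge> 2" and \<mu>: "\<mu> = p * (real n - 1)"
    and k: "4 * (real k)\<^sup>2 \<le> real n - 1" and pm: "8 * (p * \<mu>) \<le> 1"
  shows "\<mu> ^ k * exp (- \<mu>) / fact k / 2 \<le> binom_cdf (n - 2) p k"
proof -
  define N where "N = real n - 1"
  have N: "N \<ge> 1" using n by (simp add: N_def)
  have m0: "\<mu> \<ge> 0" using p N by (simp add: \<mu> N_def)
  have "real k * 1 \<le> real k * real k" by (cases "k = 0") (auto intro!: mult_left_mono)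
  then have kN: "real k \<le> N" using k by (simp add: N_def power2_eq_square)
  have c: "(N - real k) ^ k \<le> real (n - 2 choose k) * fact k"
    using binomial_ge_pow[of k "n - 2"] kN n by (simp add: N_def of_nat_diff)
  have "(3 / 4) * N ^ k \<le> (1 + real k * (- (real k / N))) * N ^ k"
    using k N by (intro mult_right_mono) (simp_all add: N_def field_simps power2_eq_square)
  also have "\<dots> \<le> (1 + - (real k / N)) ^ k * N ^ k"
    using kN N by (intro mult_right_mono Bernoulli_inequality) (auto simp: field_simps)
  also have "\<dots> = (N - real k) ^ k"
    using N by (simp add: field_simps flip: power_mult_distrib)
  finally have c2: "(3 / 4) * N ^ k \<le> real (n - 2 choose k) * fact k" using c by simp
  have "3 / 4 * exp (- \<mu>) \<le> (1 - 2 * p * \<mu>) * exp (- \<mu>)"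
    using pm by (intro mult_right_mono) auto
  also have "\<dots> \<le> exp (- (2 * p * \<mu>)) * exp (- \<mu>)"
    using exp_ge_add_one_self[of "- (2 * p * \<mu>)"] by (intro mult_right_mono) auto
  also have "\<dots> = exp ((- p - 2 * p\<^sup>2) * N)"
    by (simp add: \<mu> N_def algebra_simps power2_eq_square flip: exp_add)
  also have "\<dots> \<le> exp (ln (1 - p) * N)"
    using ln_one_minus_pos_lower_bound[of p] p N by (simp add: mult_right_mono)
  also have "\<dots> = (1 - p) ^ (n - 1)"
    using p n powr_realpow[of "1 - p" "n - 1"]
    by (simp add: N_def of_nat_diff powr_def mult.commute)
  also have "\<dots> \<le> (1 - p) ^ (n - 2 - k)"
    using p by (intro power_decreasing) auto
  finally have c3: "3 / 4 * exp (- \<mu>) \<le> (1 - p) ^ (n - 2 - k)" .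
  have "(3 / 4 * N ^ k) * p ^ k * (3 / 4 * exp (- \<mu>)) = 9 / 16 * (\<mu> ^ k * exp (- \<mu>))"
    by (simp add: \<mu> N_def power_mult_distrib)
  moreover have "0 \<le> \<mu> ^ k * exp (- \<mu>)" using m0 by simp
  ultimately have "\<mu> ^ k * exp (- \<mu>) / 2 \<le> (3 / 4 * N ^ k) * p ^ k * (3 / 4 * exp (- \<mu>))"
    by linarith
  also have "\<dots> \<le> (real (n - 2 choose k) * fact k) * p ^ k * (1 - p) ^ (n - 2 - k)"
    using p by (intro mult_mono[OF mult_right_mono[OF c2] c3]) auto
  finally have "\<mu> ^ k * exp (- \<mu>) / fact k / 2 \<le> real (n - 2 choose k) * p ^ k * (1 - p) ^ (n - 2 - k)"
    by (simp add: field_simps)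
  also have "\<dots> \<le> binom_cdf (n - 2) p k"
    unfolding binom_cdf_def using p by (intro member_le_sum) auto
  finally show ?thesis .
qed

text \<open>Up to 3\<mu>/4 each term is at most 3/4 of its successor, so the last one dominates; 4
  is the geometric sum 1/(1 - 3/4).\<close>

lemma sum_poisson_le:
  assumes "\<mu> > 0" "real k \<le> 3 / 4 * \<mu>"
  shows "(\<Sum>j\<le>k. \<mu> ^ j / fact j) \<le> 4 * (\<mu> ^ k / fact k)"
  using assms(2)
proof (induction k)
  case (Suc k)
  have "\<mu> ^ k / fact k = (real (Suc k) / \<mu>) * (\<mu> ^ Suc k / fact (Suc k))"
    using assms(1) by (simp add: divide_simps del: of_nat_Suc)
  also have "\<dots> \<le> 3 / 4 * (\<mu> ^ Suc k / fact (Suc k))"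
    using Suc.prems assms(1) by (intro mult_right_mono) (auto simp: field_simps)
  finally have "\<mu> ^ k / fact k \<le> 3 / 4 * (\<mu> ^ Suc k / fact (Suc k))" .
  moreover have "(\<Sum>j\<le>k. \<mu> ^ j / fact j) \<le> 4 * (\<mu> ^ k / fact k)"
    using Suc by simp
  ultimately show ?case unfolding sum.atMost_Suc by linarith
qed simp

lemma binom_cdf_le_poisson:
  assumes p: "0 \<le> p" "p \<le> 1" and \<mu>: "\<mu> = p * real N" "\<mu> > 0" and k: "real k \<le> 3 / 4 * \<mu>"
  shows "binom_cdf N p k \<le> exp (p * real k) * (4 * (\<mu> ^ k * exp (- \<mu>) / fact k))"
proof -
  have "binom_cdf N p k \<le> (\<Sum>j\<le>k. exp (p * real k - \<mu>) * (\<mu> ^ j / fact j))"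
    unfolding binom_cdf_def
  proof (rule sum_mono)
    fix j assume j: "j \<in> {..k}"
    show "real (N choose j) * p ^ j * (1 - p) ^ (N - j) \<le> exp (p * real k - \<mu>) * (\<mu> ^ j / fact j)"
    proof (cases "j \<le> N")
      case False
      then have "real (N choose j) * p ^ j * (1 - p) ^ (N - j) = 0" by (simp add: binomial_eq_0)
      moreover have "0 \<le> exp (p * real k - \<mu>) * (\<mu> ^ j / fact j)" using \<mu>(2) by simp
      ultimately show ?thesis by linarith
    next
      case True
      have "real ((N choose j) * fact j) \<le> real N ^ j"
        using binomial_fact_pow[of N j] by (metis of_nat_le_iff of_nat_power)
      then have "real (N choose j) \<le> real N ^ j / fact j" by (simp add: field_simps)
      then have 1: "real (N choose j) * p ^ j \<le> \<mu> ^ j / fact j"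
        using p mult_right_mono[of "real (N choose j)" "real N ^ j / fact j" "p ^ j"]
        by (simp add: \<mu> power_mult_distrib mult.commute)
      \<comment> \<open>The exponent is N - j instead of N; this is the source of the factor
        \<open>exp (p * real k)\<close>.\<close>
      have "(1 - p) ^ (N - j) \<le> exp (- p) ^ (N - j)"
        using p exp_ge_add_one_self[of "- p"] by (intro power_mono) auto
      also have "\<dots> = exp (p * real j - \<mu>)"
        using True by (simp add: \<mu> of_nat_diff algebra_simps flip: exp_of_nat_mult)
      also have "\<dots> \<le> exp (p * real k - \<mu>)"
        using j p by (simp add: mult_left_mono)
      finally have "(1 - p) ^ (N - j) \<le> exp (p * real k - \<mu>)" .
      then have "real (N choose j) * p ^ j * (1 - p) ^ (N - j) \<le> (\<mu> ^ j / fact j) * exp (p * real k - \<mu>)"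
        using 1 p \<mu> by (intro mult_mono) auto
      then show ?thesis by (simp add: mult.commute)
    qed
  qed
  also have "\<dots> = exp (p * real k - \<mu>) * (\<Sum>j\<le>k. \<mu> ^ j / fact j)"
    by (simp add: sum_distrib_left)
  also have "\<dots> \<le> exp (p * real k - \<mu>) * (4 * (\<mu> ^ k / fact k))"
    using sum_poisson_le[OF \<mu>(2) k] by (intro mult_left_mono) auto
  also have "\<dots> = exp (p * real k) * (4 * (\<mu> ^ k * exp (- \<mu>) / fact k))"
    by (simp add: exp_diff exp_minus field_simps)
  finally show ?thesis .
qed

section \<open>Typical properties of the random graph\<close>

lemma real_choose_two: "n \<ge> 1 \<Longrightarrow> real (n choose 2) = real n * (real n - 1) / 2"
  by (simp add: choose_two of_nat_diff real_of_nat_div)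

lemma sum_power_le:
  fixes x :: real
  assumes "0 \<le> x" "x \<le> 1 / 2"
  shows "(\<Sum>u=1..n. x ^ u) \<le> 2 * x"
proof -
  have "(1 - x) * (\<Sum>u<n. x ^ u) = 1 - x ^ n" by (simp add: one_diff_power_eq)
  also have "\<dots> \<le> 1" using assms by simp
  finally have 1: "(1 - x) * (\<Sum>u<n. x ^ u) \<le> 1" .
  have "(1 / 2) * (\<Sum>u<n. x ^ u) \<le> (1 - x) * (\<Sum>u<n. x ^ u)"
    using assms by (intro mult_right_mono sum_nonneg) auto
  with 1 have 2: "(\<Sum>u<n. x ^ u) \<le> 2" by simp
  have "(\<Sum>u=1..n. x ^ u) = (\<Sum>u<n. x ^ Suc u)"
    by (rule sum.reindex_bij_witness[of _ Suc "\<lambda>i. i - 1"]) auto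
  also have "\<dots> = x * (\<Sum>u<n. x ^ u)" by (simp add: sum_distrib_left)
  also have "\<dots> \<le> x * 2" using 2 assms by (intro mult_left_mono)
  finally show ?thesis by simp
qed

text \<open>Grouping the sets by size turns the union bound into a geometric series of ratio x.
  \<open>Q\<close> collects conditions on the set that do not involve the random graph.\<close>

lemma bprob_Ex_subset:
  assumes p: "0 \<le> p" "p \<le> 1" and V: "finite V" and c: "0 \<le> c" and x: "0 \<le> x" "x \<le> 1 / 2"
    and bound: "\<And>U. U \<subseteq> V \<Longrightarrow> U \<noteq> {} \<Longrightarrow> Q U \<Longrightarrow>
      real (card V choose card U) * bprob A p (P U) \<le> c * x ^ card U"
  shows "bprob A p (\<lambda>E. \<exists>U\<subseteq>V. U \<noteq> {} \<and> Q U \<and> P U E) \<le> 2 * c * x"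
proof -
  define I where "I = {U. U \<subseteq> V \<and> U \<noteq> {}}"
  have finI: "finite I" using V by (simp add: I_def)
  define g where "g = (\<lambda>u. c * x ^ u / real (card V choose u))"
  have cU: "1 \<le> card U" "card U \<le> card V" if "U \<in> I" for U
    using that V by (auto simp: I_def Suc_le_eq card_gt_0_iff finite_subset intro: card_mono)
  have "bprob A p (\<lambda>E. \<exists>U\<subseteq>V. U \<noteq> {} \<and> Q U \<and> P U E) \<le> bprob A p (\<lambda>E. \<exists>U\<in>I. Q U \<and> P U E)"
    using p by (intro bprob_mono) (auto simp: I_def)
  also have "\<dots> \<le> (\<Sum>U\<in>I. bprob A p (\<lambda>E. Q U \<and> P U E))"
    using p finI by (rule bprob_Ex)
  also have "\<dots> \<le> (\<Sum>U\<in>I. g (card U))"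
  proof (rule sum_mono)
    fix U assume U: "U \<in> I"
    have pos: "0 < real (card V choose card U)" using cU[OF U] by simp
    show "bprob A p (\<lambda>E. Q U \<and> P U E) \<le> g (card U)"
    proof (cases "Q U")
      case True
      then have "bprob A p (P U) * real (card V choose card U) \<le> c * x ^ card U"
        using bound[of U] U by (simp add: I_def mult.commute)
      then show ?thesis using True pos by (simp add: g_def pos_le_divide_eq)
    next
      case False
      then show ?thesis using c x by (simp add: g_def bprob_def bexp_def)
    qed
  qed
  also have "\<dots> = (\<Sum>u\<in>{1..card V}. \<Sum>U\<in>{U\<in>I. card U = u}. g (card U))"
    using finI cU by (intro sum.group[symmetric]) auto
  also have "\<dots> = (\<Sum>u\<in>{1..card V}. c * x ^ u)"
  proof (rule sum.cong[OF refl])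
    fix u assume u: "u \<in> {1..card V}"
    then have "{U\<in>I. card U = u} = {U. U \<subseteq> V \<and> card U = u}" by (auto simp: I_def)
    then have "(\<Sum>U\<in>{U\<in>I. card U = u}. g (card U)) = real (card V choose u) * g u"
      using V by (simp add: n_subsets)
    also have "real (card V choose u) \<noteq> 0" using u by simp
    then have "real (card V choose u) * g u = c * x ^ u" by (simp add: g_def)
    finally show "(\<Sum>U\<in>{U\<in>I. card U = u}. g (card U)) = c * x ^ u" .
  qed
  also have "\<dots> = c * (\<Sum>u\<in>{1..card V}. x ^ u)" by (simp add: sum_distrib_left)
  also have "\<dots> \<le> c * (2 * x)" using c x by (intro mult_left_mono sum_power_le)
  finally show ?thesis by simp
qed

text \<open>Inner and boundary edges of a set are independent, and both bounds fit in one exponential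
  moment. The factor \<open>sqrt p\<close> comes from requiring many inner edges.\<close>

lemma prob_dense_violation:
  assumes p: "0 < p" "p \<le> 1" and n: "n \<ge> 2" and z: "0 < z" "z \<le> 1" and t: "0 \<le> t"
    and x: "x = exp 1 * real n * sqrt p * (z powr (- t) * exp (- ((99 / 100) * (p * (real n - 1)) * (1 - z))))"
    and x2: "x \<le> 1 / 2"
  shows "bprob (all_edges n) p (\<lambda>E. \<exists>U\<subseteq>{1..n}. U \<noteq> {} \<and> real (card U) \<le> real n / 100 \<and>
      (real (card U) / 2 \<le> real (card (E \<inter> inner_edges U)) \<and>
       real (card (E \<inter> boundary n U)) \<le> t * real (card U))) \<le> 4 * x"
proof -
  define D where "D = z powr (- t) * exp (- ((99 / 100) * (p * (real n - 1)) * (1 - z)))"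
  have D0: "0 < D" using z by (simp add: D_def)
  have xD: "x = exp 1 * real n * sqrt p * D" by (simp add: x D_def)
  have "bprob (all_edges n) p (\<lambda>E. \<exists>U\<subseteq>{1..n}. U \<noteq> {} \<and> real (card U) \<le> real n / 100 \<and>
      (real (card U) / 2 \<le> real (card (E \<inter> inner_edges U)) \<and>
       real (card (E \<inter> boundary n U)) \<le> t * real (card U))) \<le> 2 * 2 * x"
  proof (rule bprob_Ex_subset)
    show "0 \<le> x" using p D0 by (simp add: xD)
    fix U assume U: "U \<subseteq> {1..n}" "U \<noteq> {}" "real (card U) \<le> real n / 100"
    let ?P = "\<lambda>E. real (card U) / 2 \<le> real (card (E \<inter> inner_edges U)) \<and>
       real (card (E \<inter> boundary n U)) \<le> t * real (card U)"
    define u where "u = card U"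
    have finU: "finite U" using U finite_subset by blast
    have u: "1 \<le> u" using U finU by (simp add: u_def Suc_le_eq card_gt_0_iff)
    have un: "u \<le> n" using card_mono[OF _ U(1)] by (simp add: u_def)
    define r where "r = real u * sqrt p"
    have r0: "0 < r" using u p by (simp add: r_def)
    \<comment> \<open>The mean number of inner edges is at most r^2/2, so y = 1/r^2 gives y^(-u/2) =
      r^u at the price of a factor at most exp(1/2). For r \<ge> 1 the choice y = 1 ignores the
      inner edges, and 1 \<le> r^u.\<close>
    define y where "y = (if r \<ge> 1 then 1 else 1 / r\<^sup>2)"
    have y1: "1 \<le> y" using r0 by (simp add: y_def power_le_one)
    have r2: "r\<^sup>2 = (real u)\<^sup>2 * p" using p by (simp add: r_def power_mult_distrib)
    have Y: "y powr (- (real u / 2)) \<le> r ^ u"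
    proof (cases "r \<ge> 1")
      case True
      then show ?thesis by (simp add: y_def)
    next
      case False
      have "y = r powr (- 2)" using False r0 by (simp add: y_def powr_minus powr_numeral divide_inverse)
      then have "y powr (- (real u / 2)) = r powr real u" by (simp add: powr_powr)
      then show ?thesis using r0 by (simp add: powr_realpow)
    qed
    have "real (u choose 2) = real u * (real u - 1) / 2" using u by (rule real_choose_two)
    also have "\<dots> \<le> (real u)\<^sup>2 / 2" by (simp add: power2_eq_square algebra_simps)
    finally have M: "p * real (u choose 2) * (y - 1) \<le> p * ((real u)\<^sup>2 / 2) * (y - 1)"
      using p y1 by (intro mult_left_mono mult_right_mono) auto
    have "p * ((real u)\<^sup>2 / 2) * (y - 1) \<le> 1 / 2"
    proof (cases "r \<ge> 1")
      case False
      have "p * ((real u)\<^sup>2 / 2) * (y - 1) = r\<^sup>2 * (y - 1) / 2" by (simp add: r2 mult.commute)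
      also have "\<dots> \<le> r\<^sup>2 * y / 2" by (simp add: mult_left_mono)
      also have "r\<^sup>2 * y = 1" using False r0 by (simp add: y_def)
      finally show ?thesis by simp
    qed (simp add: y_def)
    with M have M2: "p * real (u choose 2) * (y - 1) \<le> 1 / 2" by linarith
    \<comment> \<open>As u \<le> n/100, each vertex of \<open>U\<close> has at least 0.99 n
      potential neighbours outside.\<close>
    have nu: "(99 / 100) * (real n - 1) \<le> real (n - u)"
      using U(3) un by (simp add: u_def of_nat_diff)
    have "real u * ((99 / 100) * (p * (real n - 1)) * (1 - z)) = (p * real u * (1 - z)) * ((99 / 100) * (real n - 1))"
      by simp
    also have "\<dots> \<le> (p * real u * (1 - z)) * real (n - u)"
      using nu p z by (intro mult_left_mono) auto
    finally have B: "real u * ((99 / 100) * (p * (real n - 1)) * (1 - z)) \<le> p * real (u * (n - u)) * (1 - z)"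
      by (simp add: mult.commute mult.left_commute)
    have "bprob (all_edges n) p ?P
      \<le> y powr (- (real u / 2)) * z powr (- (t * real u)) *
         exp (p * real (card (inner_edges U)) * (y - 1) - p * real (card (boundary n U)) * (1 - z))"
      unfolding u_def[symmetric] using p z y1 U inner_edges_subset boundary_subset inner_boundary_disjoint
      by (intro chernoff_joint) auto
    also have "\<dots> \<le> r ^ u * z powr (- (t * real u)) *
         exp (1 / 2 - real u * ((99 / 100) * (p * (real n - 1)) * (1 - z)))"
      using Y M2 B finU U r0
      by (intro mult_mono) (auto simp: card_inner_edges card_boundary u_def[symmetric])
    also have "\<dots> = exp (1 / 2) * (r * D) ^ u"
    proof -
      have 1: "z powr (- (t * real u)) = (z powr (- t)) ^ u"
        using powr_realpow[of "z powr (- t)" u] z by (simp add: powr_powr)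
      have 2: "exp (1 / 2 - real u * W) = exp (1 / 2) * exp (- W) ^ u" for W :: real
        using exp_add[of "1 / 2" "real u * - W"] exp_of_nat_mult[of u "- W"] by simp
      show ?thesis unfolding 1 2 D_def power_mult_distrib by (simp only: mult_ac)
    qed
    also have "\<dots> \<le> 2 * (r * D) ^ u"
    proof -
      have "exp (1 / 2 :: real) \<le> 2" using exp_bound[of "1/2"] by (simp add: power2_eq_square)
      then show ?thesis using r0 D0 by (intro mult_right_mono) auto
    qed
    finally have 1: "bprob (all_edges n) p ?P \<le> 2 * (r * D) ^ u" .
    have "real (n choose u) * bprob (all_edges n) p ?P \<le> (exp 1 * real n / real u) ^ u * (2 * (r * D) ^ u)"
      using 1 binomial_le_pow_exp[OF u, of n] p by (intro mult_mono bprob_nonneg) auto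
    also have "\<dots> = 2 * (exp 1 * real n / real u * (r * D)) ^ u"
      by (simp only: power_mult_distrib mult.left_commute)
    \<comment> \<open>The factor u in r cancels the u in the bound (en/u)^u for the number of sets,
      so the base is the same for all sizes.\<close>
    also have "exp 1 * real n / real u * (r * D) = x" using u by (simp add: xD r_def)
    finally show "real (card {1..n} choose card U) * bprob (all_edges n) p ?P \<le> 2 * x ^ card U"
      by (simp add: u_def)
  qed (use p x2 in auto)
  then show ?thesis by simp
qed

text \<open>ln z - 1 + 1/z is the Chernoff exponent, per unit of the threshold, for exceeding the
  mean by a factor z. It is bounded away from 0 once z is, and grows like ln z, so a constant
  multiple dominates the entropy term 2 + ln z.\<close>

lemma rate_bounds:
  obtains g0 K :: real where "g0 > 0" "K > 0"
    "\<And>z. z \<ge> (251 / 250) \<Longrightarrow> g0 \<le> ln z - 1 + 1 / z \<and> 2 + ln z \<le> K * (ln z - 1 + 1 / z)"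
proof -
  define a :: real where "a = (251 / 250)"
  define g0 where "g0 = ln a - 1 + 1 / a"
  have a1: "a > 1" by (simp add: a_def)
  have "ln (1 / a) \<noteq> 1 / a - 1"
  proof
    assume "ln (1 / a) = 1 / a - 1"
    then have "1 / a = 1" using a1 by (intro ln_eq_minus_one) auto
    then show False using a1 by simp
  qed
  moreover have "ln (1 / a) \<le> 1 / a - 1" using a1 by (intro ln_le_minus_one) simp
  ultimately have "ln (1 / a) < 1 / a - 1" by simp
  then have g0: "g0 > 0" using a1 by (simp add: g0_def ln_div)
  have 1: "g0 \<le> ln z - 1 + 1 / z" if z: "z \<ge> a" for z
  proof -
    have "1 - a / z \<le> ln (z / a)"
      using ln_le_minus_one[of "a / z"] z a1 by (simp add: ln_div)
    then have "ln a + 1 - a / z \<le> ln z" using z a1 by (simp add: ln_div)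
    moreover have "(a - 1) / z \<le> (a - 1) / a" using z a1 by (intro divide_left_mono) auto
    moreover have "(a - 1) / a = 1 - 1 / a" "(a - 1) / z = a / z - 1 / z" using a1 by (auto simp: diff_divide_distrib)
    ultimately show ?thesis by (simp add: g0_def)
  qed
  have 2: "2 + ln z \<le> (4 / g0 + 4) * (ln z - 1 + 1 / z)" if z: "z \<ge> a" for z
  proof -
    define g where "g = ln z - 1 + 1 / z"
    have g: "g \<ge> g0" using 1[OF z] by (simp add: g_def)
    have "(4 / g0) * g0 \<le> (4 / g0) * g" using g g0 by (intro mult_left_mono) auto
    then have h: "4 \<le> (4 / g0) * g" using g0 by simp
    have "2 + ln z \<le> (4 / g0) * g + 4 * g"
    proof (cases "ln z \<le> 2")
      case True
      then show ?thesis using h g g0 by linarith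
    next
      case False
      moreover have "ln z - 1 \<le> g" using z a1 by (simp add: g_def)
      ultimately show ?thesis using h by linarith
    qed
    then show ?thesis by (simp add: g_def algebra_simps)
  qed
  show thesis
    by (rule that[of g0 "4 / g0 + 4"]) (use g0 1 2 in \<open>auto simp: a_def add_pos_pos\<close>)
qed

text \<open>A set of s vertices spans p s(s - 1)/2 edges on average, and the threshold is z = 0.995
  (n - 1)/s times that. The exponent is \<mu> times a rate comparable to the entropy per vertex, so
  it wins as soon as \<mu> is a large constant.\<close>

lemma prob_locally_dense:
  assumes "\<epsilon> > 0"
  shows "\<forall>\<^sub>F n in sequentially. \<forall>p. 0 \<le> p \<and> p \<le> 1 \<and> (97 / 100) * ln (real n) \<le> p * (real n - 1) \<longrightarrow>
    bprob (all_edges n) p (\<lambda>E. \<exists>S\<subseteq>{1..n}. S \<noteq> {} \<and> real (card S) \<le> (99 / 100) * real n \<and>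
      (199 / 400) * (p * (real n - 1)) * (real (card S) - 1) < real (card (E \<inter> inner_edges S))) \<le> \<epsilon>"
proof -
  obtain g0 K :: real where gK: "g0 > 0" "K > 0"
    "\<And>z. z \<ge> (251 / 250) \<Longrightarrow> g0 \<le> ln z - 1 + 1 / z \<and> 2 + ln z \<le> K * (ln z - 1 + 1 / z)"
    using rate_bounds by metis
  have t1: "filterlim (\<lambda>n. (199 / 400) * ((97 / 100) * ln (real n))) at_top sequentially"
    by real_asymp
  have "((\<lambda>x. exp (- (x * g0 / 4))) \<longlongrightarrow> 0) at_top"
    using gK(1) by real_asymp
  then have "\<forall>\<^sub>F x in at_top. exp (- (x * g0 / 4)) < min (1/2) (\<epsilon> / 2)"
    using assms by (intro order_tendstoD) auto
  then have ev2: "\<forall>\<^sub>F x in at_top. 4 * K \<le> x \<and> exp (- (x * g0 / 4)) < min (1/2) (\<epsilon> / 2)"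
    using eventually_ge_at_top[of "4 * K"] by eventually_elim auto
  have ev: "\<forall>\<^sub>F n in sequentially. 4 * K \<le> (199 / 400) * ((97 / 100) * ln (real n)) \<and>
     exp (- (((199 / 400) * ((97 / 100) * ln (real n))) * g0 / 4)) < min (1/2) (\<epsilon> / 2)"
    using eventually_compose_filterlim[OF ev2 t1] .
  show ?thesis
    using ev eventually_ge_at_top[of 1000]
  proof eventually_elim
    case (elim n)
    show ?case
    proof (intro allI impI)
      fix p :: real
      assume A: "0 \<le> p \<and> p \<le> 1 \<and> (97 / 100) * ln (real n) \<le> p * (real n - 1)"
      define \<tau> where "\<tau> = (199 / 400) * (p * (real n - 1))"
      have \<tau>: "(199 / 400) * ((97 / 100) * ln (real n)) \<le> \<tau>" using A by (simp add: \<tau>_def)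
      then have \<tau>K: "4 * K \<le> \<tau>" using elim by linarith
      have \<tau>0: "\<tau> > 0" using \<tau>K gK by linarith
      define x where "x = exp (- (\<tau> * g0 / 4))"
      have "x \<le> exp (- (((199 / 400) * ((97 / 100) * ln (real n))) * g0 / 4))"
        using \<tau> gK by (simp add: x_def)
      then have x: "x \<le> 1 / 2" "2 * x \<le> \<epsilon>" using elim by auto
      have "bprob (all_edges n) p (\<lambda>E. \<exists>S\<subseteq>{1..n}. S \<noteq> {} \<and> real (card S) \<le> (99 / 100) * real n \<and>
        \<tau> * (real (card S) - 1) < real (card (E \<inter> inner_edges S))) \<le> 2 * 1 * x"
      proof (rule bprob_Ex_subset)
        fix S assume S: "S \<subseteq> {1..n}" "S \<noteq> {}" "real (card S) \<le> (99 / 100) * real n"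
        define s where "s = card S"
        have finS: "finite S" using S finite_subset by blast
        have s1: "1 \<le> s" using S finS by (simp add: s_def Suc_le_eq card_gt_0_iff)
        show "real (card {1..n} choose card S) *
          bprob (all_edges n) p (\<lambda>E. \<tau> * (real (card S) - 1) < real (card (E \<inter> inner_edges S)))
            \<le> 1 * x ^ card S"
        proof (cases "s = 1")
          \<comment> \<open>For a single vertex both sides of the comparison are 0; the strict
            inequality makes the event impossible.\<close>
          case True
          then have "card (inner_edges S) = 0" using finS by (simp add: card_inner_edges s_def)
          moreover have "finite (inner_edges S)"
            by (rule finite_graph[OF inner_edges_subset[OF S(1)]])
          ultimately have "inner_edges S = {}" by simp
          then show ?thesis using True by (simp add: s_def bprob_def bexp_def x_def)
        next
          case False
          then have s2: "real s \<ge> 2" using s1 by linarith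
          define z where "z = (199 / 200) * (real n - 1) / real s"
          \<comment> \<open>0.995/0.99 exceeds 1.005, and n \<ge> 1000 preserves 1.004 =
            251/250.\<close>
          have "(251 / 250) * real s \<le> (199 / 200) * (real n - 1)" using S(3) elim(2) by (simp add: s_def)
          then have z: "z \<ge> (251 / 250)" using s2 by (simp add: z_def pos_le_divide_eq)
          define g where "g = ln z - 1 + 1 / z"
          have g: "g0 \<le> g" "2 + ln z \<le> K * g" using gK(3)[OF z] by (auto simp: g_def)
          have M: "real (card (inner_edges S)) = real s * (real s - 1) / 2"
            using finS real_choose_two[OF s1] by (simp add: card_inner_edges s_def)
          have pz: "p * real (card (inner_edges S)) = \<tau> * (real s - 1) / z"
          proof -
            have "real n - 1 > 0" using elim(2) by simp
            then show ?thesis using s2 unfolding M \<tau>_def z_def by (simp add: field_simps)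
          qed
          have "bprob (all_edges n) p (\<lambda>E. \<tau> * (real s - 1) < real (card (E \<inter> inner_edges S)))
             \<le> bprob (all_edges n) p (\<lambda>E. \<tau> * (real s - 1) \<le> real (card (E \<inter> inner_edges S)))"
            using A by (intro bprob_mono) auto
          also have "\<dots> \<le> z powr (- (\<tau> * (real s - 1))) * exp (p * real (card (inner_edges S)) * (z - 1))"
            using A z S inner_edges_subset by (intro chernoff_upper) auto
          also have "\<dots> = exp (- (\<tau> * (real s - 1)) * ln z + \<tau> * (real s - 1) / z * (z - 1))"
            using z unfolding pz exp_add by (simp add: powr_def)
          also have "- (\<tau> * (real s - 1)) * ln z + \<tau> * (real s - 1) / z * (z - 1) = - (\<tau> * (real s - 1) * g)"
            using z by (simp add: g_def field_simps)
          finally have P: "bprob (all_edges n) p (\<lambda>E. \<tau> * (real s - 1) < real (card (E \<inter> inner_edges S)))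
            \<le> exp (- (\<tau> * (real s - 1) * g))" .
          \<comment> \<open>Expresses the entropy of the choice of \<open>S\<close> through the same
            z as the Chernoff rate: (en/s)^s is at most exp(s (2 + ln z)).\<close>
          have "real n / real s \<le> exp 1 * z"
          proof -
            have "real n \<le> 2 * ((199 / 200) * (real n - 1))" using elim(2) by simp
            also have "\<dots> \<le> exp 1 * ((199 / 200) * (real n - 1))"
              using elim(2) exp_ge_add_one_self[of 1] by (intro mult_right_mono) auto
            finally have "real n / real s \<le> exp 1 * ((199 / 200) * (real n - 1)) / real s"
              by (rule divide_right_mono) simp
            then show ?thesis unfolding z_def times_divide_eq_right .
          qed
          then have "exp 1 * real n / real s \<le> exp 1 * (exp 1 * z)"
            by (metis exp_ge_zero mult_left_mono times_divide_eq_right)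
          then have "(exp 1 * real n / real s) ^ s \<le> (exp 1 * (exp 1 * z)) ^ s"
            by (intro power_mono) auto
          also have "exp 1 * (exp 1 * z) = exp (2 + ln z)" using z by (simp add: exp_add flip: exp_add[of 1 1])
          also have "exp (2 + ln z) ^ s = exp (real s * (2 + ln z))" by (simp add: exp_of_nat_mult)
          finally have C: "real (n choose s) \<le> exp (real s * (2 + ln z))"
            using binomial_le_pow_exp[OF s1, of n] by linarith
          have "real s * (2 + ln z) \<le> (2 * (real s - 1)) * (2 + ln z)"
            using s2 z by (intro mult_right_mono) auto
          also have "\<dots> \<le> (2 * (real s - 1)) * (\<tau> / 4 * g)"
          proof (intro mult_left_mono)
            have "K * g \<le> \<tau> / 4 * g" using \<tau>K g gK by (intro mult_right_mono) auto
            then show "2 + ln z \<le> \<tau> / 4 * g" using g by linarith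
          qed (use s2 in auto)
          finally have "real s * (2 + ln z) - \<tau> * (real s - 1) * g \<le> - (\<tau> * (real s - 1) / 2 * g)"
            by (simp add: field_simps)
          also have "\<dots> \<le> - (\<tau> * (real s / 2) / 2 * g0)"
            unfolding neg_le_iff_le using s2 g \<tau>0 gK by (intro mult_mono divide_right_mono mult_left_mono) auto
          finally have ex: "real s * (2 + ln z) - \<tau> * (real s - 1) * g \<le> real s * (- (\<tau> * g0 / 4))"
            by (simp add: algebra_simps)
          have "real (n choose s) * bprob (all_edges n) p (\<lambda>E. \<tau> * (real s - 1) < real (card (E \<inter> inner_edges S)))
            \<le> exp (real s * (2 + ln z)) * exp (- (\<tau> * (real s - 1) * g))"
            using C P A by (intro mult_mono bprob_nonneg) auto
          also have "\<dots> = exp (real s * (2 + ln z) - \<tau> * (real s - 1) * g)"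
            by (simp flip: exp_add)
          also have "\<dots> \<le> exp (real s * (- (\<tau> * g0 / 4)))" using ex by simp
          also have "\<dots> = x ^ s" by (simp only: x_def exp_of_nat_mult)
          finally show ?thesis by (simp add: s_def)
        qed
      qed (use A x in \<open>auto simp: x_def\<close>)
      then show "bprob (all_edges n) p (\<lambda>E. \<exists>S\<subseteq>{1..n}. S \<noteq> {} \<and> real (card S) \<le> (99 / 100) * real n \<and>
        (199 / 400) * (p * (real n - 1)) * (real (card S) - 1) < real (card (E \<inter> inner_edges S))) \<le> \<epsilon>"
        using x(2) unfolding \<tau>_def by linarith
    qed
  qed
qed

text \<open>Chebyshev's inequality: m/(n - 1) has mean pn/2 and variance at most pn/(2(n -
  1)).\<close>

lemma prob_edges_deviation:
  assumes p: "0 \<le> p" "p \<le> 1" and n: "n \<ge> 2" and d: "d > 0"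
  shows "bprob (all_edges n) p (\<lambda>E. d \<le> \<bar>real (card E) / (real n - 1) - p * real n / 2\<bar>)
    \<le> p * real n / (2 * (real n - 1) * d\<^sup>2)"
proof -
  have N: "real (card (all_edges n)) = real n * (real n - 1) / 2"
    using n real_choose_two[of n] by (simp add: card_all_edges)
  have n1: "real n - 1 > 0" using n by simp
  have eq: "\<bar>real (card E) / (real n - 1) - p * real n / 2\<bar> = \<bar>real (card E) - p * card (all_edges n)\<bar> / (real n - 1)" for E
  proof -
    have "real (card E) / (real n - 1) - p * real n / 2 = (real (card E) - p * card (all_edges n)) / (real n - 1)"
    proof -
      have "p * (x * y / 2) / y = p * x / 2" if "y \<noteq> 0" for x y :: real using that by simp
      from this[of "real n - 1" "real n"] show ?thesis using n1 by (simp only: N diff_divide_distrib)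
    qed
    then show ?thesis using n1 by simp
  qed
  have "bprob (all_edges n) p (\<lambda>E. d \<le> \<bar>real (card E) / (real n - 1) - p * real n / 2\<bar>)
     = bprob (all_edges n) p (\<lambda>E. d * (real n - 1) \<le> \<bar>real (card E) - p * card (all_edges n)\<bar>)"
    unfolding eq using n1 by (simp add: pos_le_divide_eq)
  also have "\<dots> \<le> card (all_edges n) * p / (d * (real n - 1))\<^sup>2"
    using p d n1 by (intro chebyshev_card) auto
  also have "\<dots> = p * real n / (2 * (real n - 1) * d\<^sup>2)"
  proof -
    have "x * y / 2 * p / (d * y)\<^sup>2 = p * x / (2 * y * d\<^sup>2)" if "y \<noteq> 0" for x y :: real
      using that by (simp add: power2_eq_square mult_ac)
    from this[of "real n - 1" "real n"] show ?thesis using n1 unfolding N by simp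
  qed
  finally show ?thesis .
qed

text \<open>For \<mu> and k of order log n, all corrections between the binomial second moment and
  its Poisson form are negligible. The bound is uniform in p and k because k is later chosen
  depending on n.\<close>

lemma prob_min_degree_gt_small:
  assumes "\<epsilon> > 0"
  shows "\<exists>K. \<forall>\<^sub>F n in sequentially. \<forall>p k \<mu>. 0 \<le> p \<and> p \<le> 1 \<and> \<mu> = p * (real n - 1) \<and> \<mu> \<le> 10 * ln (real n) \<and>
      real k \<le> 10 * ln (real n) \<and> K \<le> real n * (\<mu> ^ k * exp (- \<mu>) / fact k) \<longrightarrow>
    bprob (all_edges n) p (\<lambda>E. \<forall>v\<in>{1..n}. k < degree E v) \<le> \<epsilon>"
proof (intro exI[of _ "8 / \<epsilon>"])
  define \<delta> where "\<delta> = (\<lambda>n. 10 * ln (real n) / (real n - 1))"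
  have "((\<lambda>n. 1 / (1 - \<delta> n)\<^sup>2 - 1) \<longlongrightarrow> 0) sequentially" unfolding \<delta>_def by real_asymp
  then have e1: "\<forall>\<^sub>F n in sequentially. 1 / (1 - \<delta> n)\<^sup>2 - 1 < \<epsilon> / 2"
    using assms by (intro order_tendstoD) auto
  have e2: "\<forall>\<^sub>F n in sequentially. \<delta> n \<le> 1 / 2" unfolding \<delta>_def by real_asymp
  have e3: "\<forall>\<^sub>F n in sequentially. 4 * (10 * ln (real n))\<^sup>2 \<le> real n - 1" by real_asymp
  have e4: "\<forall>\<^sub>F n in sequentially. 8 * (\<delta> n * (10 * ln (real n))) \<le> 1" unfolding \<delta>_def by real_asymp
  show "\<forall>\<^sub>F n in sequentially. \<forall>p k \<mu>. 0 \<le> p \<and> p \<le> 1 \<and> \<mu> = p * (real n - 1) \<and> \<mu> \<le> 10 * ln (real n) \<and>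
      real k \<le> 10 * ln (real n) \<and> 8 / \<epsilon> \<le> real n * (\<mu> ^ k * exp (- \<mu>) / fact k) \<longrightarrow>
    bprob (all_edges n) p (\<lambda>E. \<forall>v\<in>{1..n}. k < degree E v) \<le> \<epsilon>"
    using e1 e2 e3 e4 eventually_ge_at_top[of 2]
  proof eventually_elim
    case (elim n)
    show ?case
    proof (intro allI impI)
      fix p :: real and k :: nat and \<mu> :: real
      assume A: "0 \<le> p \<and> p \<le> 1 \<and> \<mu> = p * (real n - 1) \<and> \<mu> \<le> 10 * ln (real n) \<and>
        real k \<le> 10 * ln (real n) \<and> 8 / \<epsilon> \<le> real n * (\<mu> ^ k * exp (- \<mu>) / fact k)"
      have n1: "real n - 1 > 0" using elim by simp
      have p\<delta>: "p \<le> \<delta> n" using A n1 by (simp add: \<delta>_def pos_le_divide_eq)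
      define T where "T = \<mu> ^ k * exp (- \<mu>) / fact k"
      define q where "q = binom_cdf (n - 2) p k"
      have "p * \<mu> \<le> \<delta> n * (10 * ln (real n))"
        using p\<delta> A n1 by (intro mult_mono) auto
      moreover have "(real k)\<^sup>2 \<le> (10 * ln (real n))\<^sup>2" using A by (intro power_mono) auto
      ultimately have "T / 2 \<le> q"
        unfolding T_def q_def using A elim p\<delta> by (intro binom_cdf_ge_poisson) auto
      moreover have nT: "8 / \<epsilon> \<le> real n * T" using A unfolding T_def by blast
      have "0 < 8 / \<epsilon>" using assms by simp
      then have "0 < real n * T" using nT by linarith
      then have T0: "T > 0" using n1 by (simp add: zero_less_mult_iff)
      ultimately have q: "q > 0" "T / 2 \<le> q" by auto
      \<comment> \<open>Origin of the witness 8/\<epsilon>: 1 - p and q/T are at least 1/2, so the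
        first term of the second moment bound is at most 4/(nT) \<le> \<epsilon>/2. The other half
        pays for 1/(1 - p)^2 - 1.\<close>
      have "8 / \<epsilon> / 4 \<le> real n * (1 / 2) * (T / 2)" using nT by simp
      also have "\<dots> \<le> real n * (1 - p) * q"
        using q p\<delta> elim T0 by (intro mult_mono) auto
      finally have "2 / \<epsilon> \<le> real n * (1 - p) * q" by simp
      then have "1 / (real n * (1 - p) * q) \<le> 1 / (2 / \<epsilon>)"
        using assms q A p\<delta> elim by (intro divide_left_mono mult_pos_pos) auto
      moreover have "1 / (1 - p)\<^sup>2 \<le> 1 / (1 - \<delta> n)\<^sup>2"
        using p\<delta> elim by (intro divide_left_mono power_mono mult_pos_pos zero_less_power) auto
      moreover have "bprob (all_edges n) p (\<lambda>E. \<forall>v\<in>{1..n}. k < degree E v)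
          \<le> 1 / (real n * (1 - p) * q) + (1 / (1 - p)\<^sup>2 - 1)"
        unfolding q_def using A p\<delta> elim q by (intro prob_min_degree_gt) (auto simp: q_def)
      ultimately show "bprob (all_edges n) p (\<lambda>E. \<forall>v\<in>{1..n}. k < degree E v) \<le> \<epsilon>"
        using elim(1) by simp
    qed
  qed
qed

section \<open>Combining bad events; the criterion for typical graphs\<close>

lemma bprob_le_add:
  assumes "0 \<le> p" "p \<le> 1" "\<And>E. E \<subseteq> A \<Longrightarrow> P E \<Longrightarrow> Q E \<or> R E"
    "bprob A p Q \<le> a" "bprob A p R \<le> b"
  shows "bprob A p P \<le> a + b"
proof -
  have "bprob A p P \<le> bprob A p (\<lambda>E. Q E \<or> R E)"
    using assms by (intro bprob_mono) auto
  also have "\<dots> \<le> bprob A p Q + bprob A p R" using assms by (intro bprob_disj)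
  finally show ?thesis using assms by linarith
qed

lemma aasI:
  assumes "\<And>n. 0 \<le> p n \<and> p n \<le> 1"
    and "\<And>\<epsilon>. \<epsilon> > 0 \<Longrightarrow> \<forall>\<^sub>F n in sequentially. bprob (all_edges n) (p n) (\<lambda>E. \<not> P n E) \<le> \<epsilon>"
  shows "aas p P"
  unfolding aas_def gnp_prob_eq
proof (rule tendstoI)
  fix e :: real assume "e > 0"
  then have "\<forall>\<^sub>F n in sequentially. bprob (all_edges n) (p n) (\<lambda>E. \<not> P n E) \<le> e / 2"
    using assms(2)[of "e / 2"] by simp
  then show "\<forall>\<^sub>F n in sequentially. dist (bprob (all_edges n) (p n) (P n)) 1 < e"
  proof eventually_elim
    case (elim n)
    have "bprob (all_edges n) (p n) (\<lambda>E. \<not> P n E) = 1 - bprob (all_edges n) (p n) (P n)"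
      by (intro bprob_not) simp
    moreover have "bprob (all_edges n) (p n) (P n) \<le> 1"
      using assms(1) by (intro bprob_le_1) auto
    ultimately show ?case using elim \<open>e > 0\<close> by (simp add: dist_real_def)
  qed
qed

text \<open>The factor 199/400, just below 1/2, leaves room for the fluctuation of m/(n - 1) around
  \<mu>/2 and still exceeds the mean density of sets with at most 0.99 n vertices.\<close>

definition locally_dense :: "nat \<Rightarrow> real \<Rightarrow> nat set set \<Rightarrow> bool" where
  "locally_dense n \<mu> E \<longleftrightarrow> (\<exists>S\<subseteq>{1..n}. S \<noteq> {} \<and> real (card S) \<le> (99 / 100) * real n \<and>
      (199 / 400) * \<mu> * (real (card S) - 1) < real (card (E \<inter> inner_edges S)))"

text \<open>The requirement on inner edges is essential for this event to be rare: a single vertex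
  of minimum degree t already has a boundary of t edges.\<close>

definition weak_boundary :: "nat \<Rightarrow> real \<Rightarrow> nat set set \<Rightarrow> bool" where
  "weak_boundary n t E \<longleftrightarrow> (\<exists>U\<subseteq>{1..n}. U \<noteq> {} \<and> real (card U) \<le> real n / 100 \<and>
      (real (card U) / 2 \<le> real (card (E \<inter> inner_edges U)) \<and>
       real (card (E \<inter> boundary n U)) \<le> t * real (card U)))"

text \<open>The number t depends on the graph, while union bounds need a fixed level; t' is such a
  level above t.\<close>

lemma tree_packing_ge_typical:
  assumes E: "E \<subseteq> all_edges n" and n: "n \<ge> 2"
    and t: "t \<le> min_degree n E" "real t \<le> real (card E) / (real n - 1)" "real t \<le> t'"
    and r: "(199 / 400) * \<mu> \<le> real (card E) / (real n - 1)"
    and typical: "\<not> locally_dense n \<mu> E" "\<not> weak_boundary n t' E"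
  shows "t \<le> tree_packing n E"
proof (rule tree_packing_ge[OF E n t(2), where c = "1 / 100"])
  fix S assume S: "S \<subseteq> {1..n}" "S \<noteq> {}" "real (card S) \<le> (1 - 1 / 100) * real n"
  then have "card S \<ge> 1" by (simp add: Suc_le_eq card_gt_0_iff finite_subset)
  have "real (card (E \<inter> inner_edges S)) \<le> (199 / 400) * \<mu> * (real (card S) - 1)"
    using typical(1) S unfolding locally_dense_def by force
  also have "\<dots> \<le> real (card E) / (real n - 1) * (real (card S) - 1)"
    using r \<open>card S \<ge> 1\<close> by (intro mult_right_mono) auto
  finally show "real (card (E \<inter> inner_edges S)) \<le> real (card E) / (real n - 1) * (real (card S) - 1)" .
next
  fix U assume U: "U \<subseteq> {1..n}" "real (card U) \<le> 1 / 100 * real n"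
  show "t * card U \<le> card (E \<inter> boundary n U)"
  proof (rule boundary_ge_if_no_dense_violation[OF E _ _ U])
    show "t \<le> degree E v" if "v \<in> {1..n}" for v
      using t(1) that unfolding min_degree_def by (meson Min_le finite_atLeastAtMost finite_imageI
        image_eqI le_trans)
    fix W assume W: "W \<subseteq> {1..n}" "W \<noteq> {}" "real (card W) \<le> 1 / 100 * real n"
      "card W \<le> 2 * card (E \<inter> inner_edges W)"
    then have "\<not> real (card (E \<inter> boundary n W)) \<le> t' * real (card W)"
      using typical(2) unfolding weak_boundary_def by force
    moreover have "real t * real (card W) \<le> t' * real (card W)"
      using t(3) by (intro mult_right_mono) auto
    ultimately have "real (t * card W) \<le> real (card (E \<inter> boundary n W))" by simp
    then show "t * card W \<le> card (E \<inter> boundary n W)" by linarith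
  qed
qed

lemma min_degree_gt_iff:
  "n \<ge> 1 \<Longrightarrow> k < min_degree n E \<longleftrightarrow> (\<forall>v\<in>{1..n}. k < degree E v)"
  unfolding min_degree_def by (subst Min_gr_iff) auto

section \<open>The Poisson rate at half the mean\<close>

lemma beta_const_eq: "beta_const = 2 / (1 - ln 2)"
  by (simp add: beta_const_def ln_div)

text \<open>The bounds come from 2/3 \<le> ln 2 \<le> 25/36. The identity says that \<mu>/\<beta> is
  the negative of \<open>log_poisson\<close> extended to real k, at k = \<mu>/2.\<close>

lemma beta_const_bounds: "6 \<le> beta_const" "beta_const \<le> (131 / 20)" "\<mu> / beta_const = \<mu> / 2 - \<mu> / 2 * ln 2"
proof -
  have 1: "2 / 3 \<le> ln (2::real)" "ln (2::real) \<le> 25 / 36"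
    using ln2_ge_two_thirds ln2_le_25_over_36 by auto
  then show "6 \<le> beta_const" "beta_const \<le> (131 / 20)"
    by (auto simp: beta_const_eq field_simps)
  show "\<mu> / beta_const = \<mu> / 2 - \<mu> / 2 * ln 2"
    using 1 by (simp add: beta_const_eq field_simps)
qed

text \<open>In real k, \<open>log_poisson\<close> is concave, with value -\<mu>/\<beta> and slope ln
  2 at \<mu>/2; the bound is the tangent line at distance at most 2.\<close>

lemma log_poisson_le:
  assumes "\<mu> > 0" "k \<ge> 1" "real k \<le> \<mu> / 2 + 2"
  shows "log_poisson \<mu> k \<le> 2 * ln 2 - \<mu> / beta_const"
proof -
  have "ln (\<mu> / (2 * real k)) \<le> \<mu> / (2 * real k) - 1"
    using assms by (intro ln_le_minus_one) auto
  then have "real k * ln (\<mu> / (2 * real k)) \<le> real k * (\<mu> / (2 * real k) - 1)"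
    by (intro mult_left_mono) auto
  also have "\<dots> = \<mu> / 2 - real k" using assms by (simp add: algebra_simps)
  also have "ln (\<mu> / (2 * real k)) = ln (\<mu> / real k) - ln 2"
    using assms by (simp add: ln_div ln_mult)
  finally have "log_poisson \<mu> k \<le> real k * ln 2 - \<mu> / 2"
    by (simp add: log_poisson_def algebra_simps)
  moreover have "real k * ln 2 \<le> (\<mu> / 2 + 2) * ln 2" using assms by (intro mult_right_mono) auto
  ultimately show ?thesis by (simp add: beta_const_bounds(3) algebra_simps)
qed

text \<open>Below \<mu>/2 one may replace ln(\<mu>/k) by ln 2; being at most 3 below \<mu>/2 then
  costs at most 3 + 3 ln 2 \<le> 6.\<close>

lemma log_poisson_ge:
  assumes "k \<ge> 1" "real k \<le> \<mu> / 2" "\<mu> / 2 - 3 \<le> real k"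
  shows "- \<mu> / beta_const - 6 \<le> log_poisson \<mu> k"
proof -
  have "ln 2 \<le> ln (\<mu> / real k)" using assms by (simp add: pos_le_divide_eq)
  then have "real k * ln 2 \<le> real k * ln (\<mu> / real k)" by (intro mult_left_mono) auto
  moreover have "\<mu> / 2 * ln 2 - 3 * ln 2 \<le> real k * ln 2"
    using assms mult_right_mono[of "\<mu> / 2 - 3" "real k" "ln 2"] by (simp add: left_diff_distrib)
  moreover have "ln 2 \<le> (1 :: real)" using ln2_le_25_over_36 by simp
  moreover have "- \<mu> / beta_const = - (\<mu> / 2 - \<mu> / 2 * ln 2)"
    using beta_const_bounds(3)[of \<mu>] by simp
  ultimately show ?thesis using assms(3) unfolding log_poisson_def by linarith
qed

text \<open>Limits how far the least k whose rate reaches a given level can overshoot that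
  level.\<close>

lemma log_poisson_Suc_le:
  assumes "\<mu> > 0"
  shows "log_poisson \<mu> (Suc k) \<le> log_poisson \<mu> k + 1 + ln \<mu>"
proof (cases "k = 0")
  case False
  have "real k * ln (real k) \<le> real (Suc k) * ln (real (Suc k))"
    using False by (intro mult_mono) auto
  then show ?thesis using assms False by (simp add: log_poisson_def ln_div algebra_simps)
qed (simp add: log_poisson_def)

text \<open>At the mean the rate vanishes up to rounding, so some k \<le> \<mu> always reaches a
  sufficiently negative level.\<close>

lemma log_poisson_floor:
  assumes "\<mu> \<ge> 0"
  shows "log_poisson \<mu> (nat \<lfloor>\<mu>\<rfloor>) \<ge> - 1"
proof -
  define k where "k = nat \<lfloor>\<mu>\<rfloor>"
  have k: "real k \<le> \<mu>" "\<mu> - 1 \<le> real k"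
    using assms unfolding k_def by linarith+
  have "0 \<le> real k * ln (\<mu> / real k)"
  proof (cases "k = 0")
    case False
    then have "0 \<le> ln (\<mu> / real k)" using k by (intro ln_ge_zero) (simp add: pos_le_divide_eq)
    then show ?thesis by simp
  qed simp
  then show ?thesis using k unfolding k_def[symmetric] by (simp add: log_poisson_def)
qed

section \<open>Degree and edge count estimates uniform in the edge probability\<close>

lemma prob_degree_le_union:
  assumes p: "0 \<le> p" "p \<le> 1" and n: "n \<ge> 2"
  shows "bprob (all_edges n) p (\<lambda>E. \<exists>v\<in>{1..n}. degree E v \<le> k) \<le> real n * binom_cdf (n - 1) p k"
proof -
  have "bprob (all_edges n) p (\<lambda>E. \<exists>v\<in>{1..n}. degree E v \<le> k)
      \<le> (\<Sum>v\<in>{1..n}. bprob (all_edges n) p (\<lambda>E. degree E v \<le> k))"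
    using p by (intro bprob_Ex) auto
  also have "\<dots> = (\<Sum>v\<in>{1..n}. binom_cdf (n - 1) p k)"
    by (intro sum.cong prob_degree_le) auto
  finally show ?thesis by simp
qed

text \<open>A Chernoff bound with z = 1/2, using 0.51 ln 2 - 1/2 < -7/50. For \<mu> \<ge> 10 log n
  it gives n^(-0.4); the level 0.51 \<mu> lies above the typical m/(n - 1).\<close>

lemma prob_degree_le_chernoff:
  assumes p: "0 \<le> p" "p \<le> 1" and n: "n \<ge> 2" and \<mu>: "\<mu> = p * (real n - 1)"
  shows "bprob (all_edges n) p (\<lambda>E. \<exists>v\<in>{1..n}. real (degree E v) \<le> (51 / 100) * \<mu>)
    \<le> real n * exp (- ((7 / 50) * \<mu>))"
proof -
  have "bprob (all_edges n) p (\<lambda>E. real (degree E v) \<le> (51 / 100) * \<mu>) \<le> exp (- ((7 / 50) * \<mu>))"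
    if v: "v \<in> {1..n}" for v
  proof -
    have "bprob (all_edges n) p (\<lambda>E. real (degree E v) \<le> (51 / 100) * \<mu>)
      \<le> bprob (all_edges n) p (\<lambda>E. real (card (E \<inter> boundary n {v})) \<le> (51 / 100) * \<mu>)"
      using p by (intro bprob_mono) (auto simp: degree_boundary)
    also have "\<dots> \<le> (1/2) powr (- ((51 / 100) * \<mu>)) * exp (- (p * card (boundary n {v}) * (1 - 1/2)))"
      using p boundary_subset by (intro chernoff_lower) auto
    also have "\<dots> = exp ((51 / 100) * \<mu> * ln 2) * exp (- (\<mu> / 2))"
      using v n by (simp add: card_boundary \<mu> of_nat_diff powr_def ln_div)
    also have "\<dots> = exp ((51 / 100) * \<mu> * ln 2 - \<mu> / 2)" by (simp flip: exp_add)
    also have "\<dots> \<le> exp (- ((7 / 50) * \<mu>))"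
    proof -
      have "(51 / 100) * \<mu> * ln 2 \<le> (51 / 100) * \<mu> * (25 / 36)"
        using ln2_le_25_over_36 p n by (intro mult_left_mono) (auto simp: \<mu>)
      moreover have "\<mu> \<ge> 0" using p n by (simp add: \<mu>)
      ultimately show ?thesis by simp
    qed
    finally show ?thesis .
  qed
  then have "(\<Sum>v\<in>{1..n}. bprob (all_edges n) p (\<lambda>E. real (degree E v) \<le> (51 / 100) * \<mu>))
      \<le> (\<Sum>v\<in>{1..n}. exp (- ((7 / 50) * \<mu>)))"
    by (intro sum_mono)
  moreover have "bprob (all_edges n) p (\<lambda>E. \<exists>v\<in>{1..n}. real (degree E v) \<le> (51 / 100) * \<mu>)
      \<le> (\<Sum>v\<in>{1..n}. bprob (all_edges n) p (\<lambda>E. real (degree E v) \<le> (51 / 100) * \<mu>))"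
    using p by (intro bprob_Ex) auto
  ultimately show ?thesis by simp
qed

text \<open>Bounds the base in \<open>prob_dense_violation\<close>: thanks to the inner edges the
  union over sets costs about sqrt n per vertex instead of n.\<close>

lemma n_sqrt_p_le:
  assumes "0 \<le> p" "n \<ge> 2" "\<mu> = p * (real n - 1)"
  shows "real n * sqrt p \<le> sqrt (real n) * sqrt (2 * \<mu>)"
proof -
  have "p * real n \<le> p * (2 * (real n - 1))" using assms by (intro mult_left_mono) auto
  then have "real n * p \<le> 2 * \<mu>" using assms by (simp add: mult_ac)
  then have "sqrt (real n * p) \<le> sqrt (2 * \<mu>)" by simp
  then have "sqrt (real n) * sqrt (real n * p) \<le> sqrt (real n) * sqrt (2 * \<mu>)"
    by (intro mult_left_mono) auto
  moreover have "sqrt (real n) * sqrt (real n * p) = real n * sqrt p"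
    by (simp add: real_sqrt_mult)
  ultimately show ?thesis by simp
qed

lemma prob_edges_relative:
  assumes "\<epsilon> > 0"
  shows "\<forall>\<^sub>F n in sequentially. \<forall>p \<mu>. 0 \<le> p \<and> p \<le> 1 \<and> \<mu> = p * (real n - 1) \<and> 1 \<le> \<mu> \<longrightarrow>
    bprob (all_edges n) p (\<lambda>E. \<not> ((199 / 400) * \<mu> \<le> real (card E) / (real n - 1) \<and>
      real (card E) / (real n - 1) \<le> (51 / 100) * \<mu>)) \<le> \<epsilon>"
proof -
  have "((\<lambda>n. 80000 / (real n - 1)) \<longlongrightarrow> 0) sequentially" by real_asymp
  then have "\<forall>\<^sub>F n in sequentially. 80000 / (real n - 1) < \<epsilon>"
    using assms by (intro order_tendstoD) auto
  then show ?thesis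
    using eventually_ge_at_top[of 1000]
  proof eventually_elim
    case (elim n)
    show ?case
    proof (intro allI impI)
      fix p \<mu> :: real
      assume A: "0 \<le> p \<and> p \<le> 1 \<and> \<mu> = p * (real n - 1) \<and> 1 \<le> \<mu>"
      have n1: "real n - 1 > 0" using elim by simp
      \<comment> \<open>The window is (1/2 - 1/400) pn to (1/2 + 1/400) pn. Its lower end is at
        least 199\<mu>/400, and as pn \<le> 1.002 \<mu> its upper end stays below 0.51
        \<mu>.\<close>
      define d where "d = (1 / 400) * (p * real n)"
      have pn: "\<mu> \<le> p * real n" "p * real n \<le> (501 / 500) * \<mu>"
      proof -
        show "\<mu> \<le> p * real n" using A by (simp add: algebra_simps)
        have "real n \<le> (501 / 500) * (real n - 1)" using elim by simp
        then have "p * real n \<le> p * ((501 / 500) * (real n - 1))" using A by (intro mult_left_mono) auto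
        then show "p * real n \<le> (501 / 500) * \<mu>" using A by (simp add: mult.left_commute)
      qed
      have d0: "d > 0" using pn A by (simp add: d_def)
      have "bprob (all_edges n) p (\<lambda>E. \<not> ((199 / 400) * \<mu> \<le> real (card E) / (real n - 1) \<and>
          real (card E) / (real n - 1) \<le> (51 / 100) * \<mu>))
        \<le> bprob (all_edges n) p (\<lambda>E. d \<le> \<bar>real (card E) / (real n - 1) - p * real n / 2\<bar>)"
        using A
      proof (intro bprob_mono)
        fix E assume *: "\<not> ((199 / 400) * \<mu> \<le> real (card E) / (real n - 1) \<and> real (card E) / (real n - 1) \<le> (51 / 100) * \<mu>)"
        show "d \<le> \<bar>real (card E) / (real n - 1) - p * real n / 2\<bar>"
        proof (rule ccontr)
          assume "\<not> ?thesis"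
          then have "\<bar>real (card E) / (real n - 1) - p * real n / 2\<bar> < (1 / 400) * (p * real n)"
            by (simp add: d_def)
          then have "(199 / 400) * \<mu> \<le> real (card E) / (real n - 1)" "real (card E) / (real n - 1) \<le> (51 / 100) * \<mu>"
            using pn A unfolding abs_less_iff by linarith+
          then show False using * by blast
        qed
      qed auto
      also have "\<dots> \<le> p * real n / (2 * (real n - 1) * d\<^sup>2)"
        using A elim d0 by (intro prob_edges_deviation) auto
      also have "\<dots> = 80000 / (real n - 1) / (p * real n)"
      proof -
        have "a / (2 * y * ((1 / 400) * a)\<^sup>2) = 80000 / y / a" if "a \<noteq> 0" "y \<noteq> 0" for a y :: real
          using that by (simp add: power2_eq_square)
        moreover have "p * real n \<noteq> 0" "real n - 1 \<noteq> 0" using n1 pn A by linarith+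
        ultimately show ?thesis unfolding d_def by blast
      qed
      also have "\<dots> \<le> 80000 / (real n - 1) / 1"
        using pn A n1 by (intro divide_left_mono) auto
      finally show "bprob (all_edges n) p (\<lambda>E. \<not> ((199 / 400) * \<mu> \<le> real (card E) / (real n - 1) \<and>
          real (card E) / (real n - 1) \<le> (51 / 100) * \<mu>)) \<le> \<epsilon>" using elim by simp
    qed
  qed
qed

text \<open>For \<mu> of order log n the variance of m/(n - 1) is of order log n / n, so deviation 1
  is already unlikely. The upper margin 2 also absorbs the difference p/2 between pn/2 and
  \<mu>/2.\<close>

lemma prob_edges_absolute:
  assumes "\<epsilon> > 0"
  shows "\<forall>\<^sub>F n in sequentially. \<forall>p \<mu>. 0 \<le> p \<and> p \<le> 1 \<and> \<mu> = p * (real n - 1) \<and> \<mu> \<le> 10 * ln (real n) \<longrightarrow>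
    bprob (all_edges n) p (\<lambda>E. \<not> (\<mu> / 2 - 1 \<le> real (card E) / (real n - 1) \<and>
      real (card E) / (real n - 1) < \<mu> / 2 + 2)) \<le> \<epsilon>"
proof -
  have "((\<lambda>n. 10 * ln (real n) / (real n - 1)) \<longlongrightarrow> 0) sequentially" by real_asymp
  then have "\<forall>\<^sub>F n in sequentially. 10 * ln (real n) / (real n - 1) < \<epsilon>"
    using assms by (intro order_tendstoD) auto
  then show ?thesis
    using eventually_ge_at_top[of 2]
  proof eventually_elim
    case (elim n)
    show ?case
    proof (intro allI impI)
      fix p \<mu> :: real
      assume A: "0 \<le> p \<and> p \<le> 1 \<and> \<mu> = p * (real n - 1) \<and> \<mu> \<le> 10 * ln (real n)"
      have n1: "real n - 1 > 0" using elim by simp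
      have pn: "p * real n = \<mu> + p" using A by (simp add: algebra_simps)
      have "bprob (all_edges n) p (\<lambda>E. \<not> (\<mu> / 2 - 1 \<le> real (card E) / (real n - 1) \<and>
          real (card E) / (real n - 1) < \<mu> / 2 + 2))
        \<le> bprob (all_edges n) p (\<lambda>E. 1 \<le> \<bar>real (card E) / (real n - 1) - p * real n / 2\<bar>)"
        using A
      proof (intro bprob_mono)
        fix E assume *: "\<not> (\<mu> / 2 - 1 \<le> real (card E) / (real n - 1) \<and> real (card E) / (real n - 1) < \<mu> / 2 + 2)"
        show "1 \<le> \<bar>real (card E) / (real n - 1) - p * real n / 2\<bar>"
        proof (rule ccontr)
          assume "\<not> ?thesis"
          then show False using * pn A by argo
        qed
      qed auto
      also have "\<dots> \<le> p * real n / (2 * (real n - 1) * 1\<^sup>2)"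
        using A elim by (intro prob_edges_deviation) auto
      also have "\<dots> \<le> (2 * \<mu>) / (2 * (real n - 1))"
      proof -
        have "p * 1 \<le> p * (real n - 1)" using A elim by (intro mult_left_mono) auto
        then have "p * real n \<le> 2 * \<mu>" using A pn by simp
        then show ?thesis unfolding one_power2 mult_1_right using n1 by (intro divide_right_mono) auto
      qed
      also have "\<dots> = \<mu> / (real n - 1)" using n1 by (simp add: field_simps)
      also have "\<dots> \<le> 10 * ln (real n) / (real n - 1)" using A n1 by (intro divide_right_mono) auto
      finally show "bprob (all_edges n) p (\<lambda>E. \<not> (\<mu> / 2 - 1 \<le> real (card E) / (real n - 1) \<and>
          real (card E) / (real n - 1) < \<mu> / 2 + 2)) \<le> \<epsilon>" using elim by simp
    qed
  qed
qed

section \<open>Above the threshold\<close>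

lemma prob_weak_boundary_above:
  assumes "\<epsilon> > 0"
  shows "\<forall>\<^sub>F n in sequentially. \<forall>p \<mu>. 0 \<le> p \<and> p \<le> 1 \<and> \<mu> = p * (real n - 1) \<and> 5 * ln (real n) \<le> \<mu> \<longrightarrow>
    bprob (all_edges n) p (weak_boundary n ((51 / 100) * \<mu>)) \<le> \<epsilon>"
proof -
  \<comment> \<open>With \<mu> \<ge> 5 log n the exponential is at most n^(-0.65), which beats sqrt
    n.\<close>
  define f where "f = (\<lambda>n. exp 1 * (sqrt (real n) * (10 * exp (- ((13 / 100) * (5 * ln (real n)))))))"
  have "(f \<longlongrightarrow> 0) sequentially" unfolding f_def by real_asymp
  then have "\<forall>\<^sub>F n in sequentially. f n < min (1/2) (\<epsilon> / 4)"
    using assms by (intro order_tendstoD) auto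
  then show ?thesis
    using eventually_ge_at_top[of 2]
  proof eventually_elim
    case (elim n)
    show ?case
    proof (intro allI impI)
      fix p \<mu> :: real
      assume A: "0 \<le> p \<and> p \<le> 1 \<and> \<mu> = p * (real n - 1) \<and> 5 * ln (real n) \<le> \<mu>"
      have "ln (real n) > 0" using elim by simp
      then have \<mu>0: "\<mu> > 0" using A by linarith
      then have p0: "p > 0" using A by (cases "p = 0") auto
      define x where "x = exp 1 * real n * sqrt p * ((1/2) powr (- ((51 / 100) * \<mu>)) *
        exp (- ((99 / 100) * (p * (real n - 1)) * (1 - 1/2))))"
      have "(1/2) powr (- ((51 / 100) * \<mu>)) * exp (- ((99 / 100) * (p * (real n - 1)) * (1 - 1/2)))
         = exp ((51 / 100) * \<mu> * ln 2) * exp (- ((99 / 200) * \<mu>))"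
        using A by (simp add: powr_def ln_div)
      also have "\<dots> = exp ((51 / 100) * \<mu> * ln 2 - (99 / 200) * \<mu>)" by (simp flip: exp_add)
      also have "\<dots> \<le> exp (- ((7 / 50) * \<mu>))"
      proof -
        have "(51 / 100) * \<mu> * ln 2 \<le> (51 / 100) * \<mu> * (25 / 36)"
          using ln2_le_25_over_36 \<mu>0 by (intro mult_left_mono) auto
        then have "(51 / 100) * \<mu> * ln 2 - (99 / 200) * \<mu> \<le> - ((7 / 50) * \<mu>)" using \<mu>0 by linarith
        then show ?thesis by simp
      qed
      finally have D: "(1/2) powr (- ((51 / 100) * \<mu>)) * exp (- ((99 / 100) * (p * (real n - 1)) * (1 - 1/2)))
        \<le> exp (- ((7 / 50) * \<mu>))" .
      have "x = exp 1 * ((real n * sqrt p) * ((1/2) powr (- ((51 / 100) * \<mu>)) *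
        exp (- ((99 / 100) * (p * (real n - 1)) * (1 - 1/2)))))" by (simp add: x_def)
      also have "\<dots> \<le> exp 1 * ((sqrt (real n) * sqrt (2 * \<mu>)) * exp (- ((7 / 50) * \<mu>)))"
        using A elim \<mu>0 by (intro mult_left_mono mult_mono[OF n_sqrt_p_le D]) auto
      also have "\<dots> = exp 1 * (sqrt (real n) * (sqrt (2 * \<mu>) * exp (- ((7 / 50) * \<mu>))))" by simp
      also have "\<dots> \<le> exp 1 * (sqrt (real n) * (10 * exp (- ((13 / 100) * \<mu>))))"
      proof -
        \<comment> \<open>There is no upper bound on \<mu> here, so sqrt(2\<mu>) is absorbed by
          lowering the exponent from 0.14 to 0.13.\<close>
        have "1 + (1 / 50) * \<mu> \<le> exp ((1 / 50) * \<mu>)" by (rule exp_ge_add_one_self)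
        then have "2 * \<mu> \<le> 100 * exp ((1 / 50) * \<mu>)" by linarith
        also have "\<dots> = (10 * exp ((1 / 100) * \<mu>))\<^sup>2" by (simp add: power2_eq_square flip: exp_add)
        finally have "sqrt (2 * \<mu>) \<le> sqrt ((10 * exp ((1 / 100) * \<mu>))\<^sup>2)"
          by (rule real_sqrt_le_mono)
        then have "sqrt (2 * \<mu>) \<le> \<bar>10 * exp ((1 / 100) * \<mu>)\<bar>" unfolding real_sqrt_abs .
        then have "sqrt (2 * \<mu>) \<le> 10 * exp ((1 / 100) * \<mu>)" by simp
        then have "sqrt (2 * \<mu>) * exp (- ((7 / 50) * \<mu>)) \<le> (10 * exp ((1 / 100) * \<mu>)) * exp (- ((7 / 50) * \<mu>))"
          by (intro mult_right_mono) auto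
        also have "\<dots> = 10 * exp (- ((13 / 100) * \<mu>))" by (simp flip: exp_add)
        finally show ?thesis by (intro mult_left_mono) auto
      qed
      also have "\<dots> \<le> f n" unfolding f_def using A by (intro mult_left_mono) auto
      finally have x: "x \<le> 1 / 2" "4 * x \<le> \<epsilon>" using elim by auto
      have "bprob (all_edges n) p (weak_boundary n ((51 / 100) * \<mu>)) \<le> 4 * x"
        unfolding weak_boundary_def
        by (rule prob_dense_violation[where z = "1/2"]) (use A p0 elim x \<mu>0 in \<open>auto simp: x_def\<close>)
      then show "bprob (all_edges n) p (weak_boundary n ((51 / 100) * \<mu>)) \<le> \<epsilon>" using x by simp
    qed
  qed
qed

text \<open>Near the threshold a crude Chernoff bound loses a factor \<open>sqrt \<mu>\<close>, so the Poisson
  probabilities are estimated with Stirling's formula there.\<close>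

lemma prob_min_degree_above:
  assumes "\<epsilon> > 0"
  shows "\<exists>W. \<forall>\<^sub>F n in sequentially. \<forall>p \<mu>. 0 \<le> p \<and> p \<le> 1 \<and> \<mu> = p * (real n - 1) \<and> \<mu> \<le> 10 * ln (real n) \<and>
      beta_const * (ln (real n) - ln (ln (real n)) / 2) + W \<le> \<mu> \<longrightarrow>
    bprob (all_edges n) p (\<lambda>E. \<exists>v\<in>{1..n}. degree E v \<le> nat \<lfloor>\<mu> / 2 + 2\<rfloor>) \<le> \<epsilon>"
proof -
  \<comment> \<open>32 = 2 * 4 * 4: 2 bounds exp(pk), 4 is the geometric sum of the Poisson terms,
    and 4 = exp(2 ln 2) is the cost of the level exceeding \<mu>/2 by up to 2.\<close>
  have "((\<lambda>w. 32 * exp (- (w / beta_const))) \<longlongrightarrow> 0) at_top"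
  proof -
    have "beta_const > 0" using beta_const_bounds(1) by simp
    then show ?thesis by real_asymp
  qed
  then have "\<forall>\<^sub>F w in at_top. 32 * exp (- (w / beta_const)) < \<epsilon> \<and> 0 \<le> w"
    using assms by (intro eventually_conj order_tendstoD eventually_ge_at_top) auto
  then have "\<exists>w. 32 * exp (- (w / beta_const)) < \<epsilon> \<and> 0 \<le> w"
    by (rule eventually_happens'[rotated]) simp
  then obtain W where W: "32 * exp (- (W / beta_const)) < \<epsilon>" "0 \<le> W" by blast
  have e1: "\<forall>\<^sub>F n in sequentially. 10 * ln (real n) / (real n - 1) * (5 * ln (real n) + 2) \<le> 1 / 2"
    by real_asymp
  have e2: "\<forall>\<^sub>F n in sequentially. 8 \<le> ln (real n)" by real_asymp
  have e3: "\<forall>\<^sub>F n in sequentially. ln (ln (real n)) \<le> ln (real n)" by real_asymp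
  show ?thesis
  proof (intro exI[of _ W])
    show "\<forall>\<^sub>F n in sequentially. \<forall>p \<mu>. 0 \<le> p \<and> p \<le> 1 \<and> \<mu> = p * (real n - 1) \<and> \<mu> \<le> 10 * ln (real n) \<and>
        beta_const * (ln (real n) - ln (ln (real n)) / 2) + W \<le> \<mu> \<longrightarrow>
      bprob (all_edges n) p (\<lambda>E. \<exists>v\<in>{1..n}. degree E v \<le> nat \<lfloor>\<mu> / 2 + 2\<rfloor>) \<le> \<epsilon>"
      using e1 e2 e3 eventually_ge_at_top[of 2]
    proof eventually_elim
      case (elim n)
      show ?case
      proof (intro allI impI)
        fix p \<mu> :: real
        define L where "L = ln (real n)"
        assume A: "0 \<le> p \<and> p \<le> 1 \<and> \<mu> = p * (real n - 1) \<and> \<mu> \<le> 10 * ln (real n) \<and>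
          beta_const * (ln (real n) - ln (ln (real n)) / 2) + W \<le> \<mu>"
        have L: "8 \<le> L" "ln L \<le> L" using elim by (auto simp: L_def)
        have n1: "real n - 1 > 0" using elim by simp
        have \<mu>W: "beta_const * (L - ln L / 2) + W \<le> \<mu>" using A by (simp add: L_def)
        have "6 * (L - ln L / 2) \<le> beta_const * (L - ln L / 2)"
          using L beta_const_bounds(1) by (intro mult_right_mono) auto
        then have \<mu>3: "3 * L \<le> \<mu>" using \<mu>W W L by argo
        then have \<mu>0: "\<mu> > 0" using L by linarith
        define k where "k = nat \<lfloor>\<mu> / 2 + 2\<rfloor>"
        have k: "real k \<le> \<mu> / 2 + 2" "\<mu> / 2 + 1 \<le> real k"
          using \<mu>0 unfolding k_def by linarith+
        have kL: "L \<le> real k" using k \<mu>3 L by linarith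
        have k1: "1 \<le> k" using kL L by linarith
        have "real k \<le> 3 / 4 * \<mu>" using k \<mu>3 L by linarith
        then have "binom_cdf (n - 1) p k \<le> exp (p * real k) * (4 * (\<mu> ^ k * exp (- \<mu>) / fact k))"
          using A elim \<mu>0 by (intro binom_cdf_le_poisson) (auto simp: of_nat_diff)
        also have "\<dots> \<le> 2 * (4 * exp (log_poisson \<mu> k - ln (real k) / 2))"
        proof (intro mult_mono mult_left_mono poisson_le k1 \<mu>0)
          have "p \<le> 10 * ln (real n) / (real n - 1)" using A n1 by (simp add: pos_le_divide_eq)
          moreover have "real k \<le> 5 * ln (real n) + 2" using k A by simp
          ultimately have "p * real k \<le> 10 * ln (real n) / (real n - 1) * (5 * ln (real n) + 2)"
            using A elim by (intro mult_mono) auto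
          then have "exp (p * real k) \<le> exp (1 / 2)" using elim(1) by simp
          also have "exp (1 / 2 :: real) \<le> 2" using exp_bound[of "1/2"] by (simp add: power2_eq_square)
          finally show "exp (p * real k) \<le> 2" .
        qed (use \<mu>0 in auto)
        \<comment> \<open>As k \<ge> L, Stirling's factor 1/sqrt k yields the term ln L / 2, which
          matches the log log term of the threshold.\<close>
        also have "\<dots> \<le> 8 * exp (2 * ln 2 - \<mu> / beta_const - ln L / 2)"
        proof -
          have "ln L \<le> ln (real k)" using kL L by simp
          then show ?thesis using log_poisson_le[OF \<mu>0 k1 k(1)] by simp
        qed
        finally have "real n * binom_cdf (n - 1) p k \<le> real n * (8 * exp (2 * ln 2 - \<mu> / beta_const - ln L / 2))"
          by (intro mult_left_mono) auto
        also have "\<dots> = 8 * exp (L + (2 * ln 2 - \<mu> / beta_const - ln L / 2))"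
          using n1 by (simp only: exp_add) (simp add: L_def)
        also have "\<dots> \<le> 8 * exp (2 * ln 2 - W / beta_const)"
        proof -
          have "(beta_const * (L - ln L / 2) + W) / beta_const \<le> \<mu> / beta_const"
            using \<mu>W beta_const_bounds(1) by (intro divide_right_mono) auto
          then have "L - ln L / 2 + W / beta_const \<le> \<mu> / beta_const"
            using beta_const_bounds(1) by (simp add: add_divide_distrib)
          then show ?thesis by simp
        qed
        also have "\<dots> = 32 * exp (- (W / beta_const))"
          by (simp add: exp_diff exp_minus exp_double divide_inverse)
        finally have "real n * binom_cdf (n - 1) p k \<le> \<epsilon>" using W by simp
        moreover have "bprob (all_edges n) p (\<lambda>E. \<exists>v\<in>{1..n}. degree E v \<le> k) \<le> real n * binom_cdf (n - 1) p k"
          using A elim by (intro prob_degree_le_union) auto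
        ultimately show "bprob (all_edges n) p (\<lambda>E. \<exists>v\<in>{1..n}. degree E v \<le> nat \<lfloor>\<mu> / 2 + 2\<rfloor>) \<le> \<epsilon>"
          unfolding k_def by linarith
      qed
    qed
  qed
qed

text \<open>w can grow at any speed. Up to \<mu> = 10 log n the sharp Poisson bound is paired with
  an absolute error of the edge count, beyond that the Chernoff bound with a relative error.\<close>

lemma prob_degree_le_density_above:
  assumes "\<epsilon> > 0"
  shows "\<exists>W. \<forall>\<^sub>F n in sequentially. \<forall>p \<mu>. 0 \<le> p \<and> p \<le> 1 \<and> \<mu> = p * (real n - 1) \<and>
      beta_const * (ln (real n) - ln (ln (real n)) / 2) + W \<le> \<mu> \<and> 1 \<le> \<mu> \<longrightarrow>
    bprob (all_edges n) p (\<lambda>E. \<exists>v\<in>{1..n}. real (degree E v) \<le> real (card E) / (real n - 1)) \<le> \<epsilon>"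
proof -
  obtain W where W: "\<forall>\<^sub>F n in sequentially. \<forall>p \<mu>. 0 \<le> p \<and> p \<le> 1 \<and> \<mu> = p * (real n - 1) \<and> \<mu> \<le> 10 * ln (real n) \<and>
      beta_const * (ln (real n) - ln (ln (real n)) / 2) + W \<le> \<mu> \<longrightarrow>
    bprob (all_edges n) p (\<lambda>E. \<exists>v\<in>{1..n}. degree E v \<le> nat \<lfloor>\<mu> / 2 + 2\<rfloor>) \<le> \<epsilon> / 2"
    using prob_min_degree_above[of "\<epsilon> / 2"] assms by auto
  have e2: "\<epsilon> / 2 > 0" using assms by simp
  have "((\<lambda>n. real n * exp (- ((7 / 50) * (10 * ln (real n))))) \<longlongrightarrow> 0) sequentially" by real_asymp
  then have ev: "\<forall>\<^sub>F n in sequentially. real n * exp (- ((7 / 50) * (10 * ln (real n)))) < \<epsilon> / 2"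
    using assms by (intro order_tendstoD) auto
  show ?thesis
  proof (intro exI[of _ W])
    show "\<forall>\<^sub>F n in sequentially. \<forall>p \<mu>. 0 \<le> p \<and> p \<le> 1 \<and> \<mu> = p * (real n - 1) \<and>
        beta_const * (ln (real n) - ln (ln (real n)) / 2) + W \<le> \<mu> \<and> 1 \<le> \<mu> \<longrightarrow>
      bprob (all_edges n) p (\<lambda>E. \<exists>v\<in>{1..n}. real (degree E v) \<le> real (card E) / (real n - 1)) \<le> \<epsilon>"
      using W ev prob_edges_absolute[OF e2] prob_edges_relative[OF e2] eventually_ge_at_top[of 2]
    proof eventually_elim
      case (elim n)
      show ?case
      proof (intro allI impI)
        fix p \<mu> :: real
        assume A: "0 \<le> p \<and> p \<le> 1 \<and> \<mu> = p * (real n - 1) \<and>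
          beta_const * (ln (real n) - ln (ln (real n)) / 2) + W \<le> \<mu> \<and> 1 \<le> \<mu>"
        have "bprob (all_edges n) p (\<lambda>E. \<exists>v\<in>{1..n}. real (degree E v) \<le> real (card E) / (real n - 1))
          \<le> \<epsilon> / 2 + \<epsilon> / 2"
        proof (cases "\<mu> \<le> 10 * ln (real n)")
          case True
          show ?thesis
          proof (rule bprob_le_add)
            show "bprob (all_edges n) p (\<lambda>E. \<exists>v\<in>{1..n}. degree E v \<le> nat \<lfloor>\<mu> / 2 + 2\<rfloor>) \<le> \<epsilon> / 2"
              using elim(1) A True by blast
            show "bprob (all_edges n) p (\<lambda>E. \<not> (\<mu> / 2 - 1 \<le> real (card E) / (real n - 1) \<and>
              real (card E) / (real n - 1) < \<mu> / 2 + 2)) \<le> \<epsilon> / 2"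
              using elim(3) A True by blast
            fix E assume "\<exists>v\<in>{1..n}. real (degree E v) \<le> real (card E) / (real n - 1)"
            then obtain v where v: "v \<in> {1..n}" "real (degree E v) \<le> real (card E) / (real n - 1)" by blast
            have "degree E v \<le> nat \<lfloor>\<mu> / 2 + 2\<rfloor>" if "real (card E) / (real n - 1) < \<mu> / 2 + 2"
            proof -
              have "real (degree E v) \<le> \<mu> / 2 + 2" using v that by linarith
              then show ?thesis by linarith
            qed
            then show "(\<exists>v\<in>{1..n}. degree E v \<le> nat \<lfloor>\<mu> / 2 + 2\<rfloor>) \<or>
              \<not> (\<mu> / 2 - 1 \<le> real (card E) / (real n - 1) \<and> real (card E) / (real n - 1) < \<mu> / 2 + 2)"
              using v by blast
          qed (use A in auto)
        next
          case False
          show ?thesis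
          proof (rule bprob_le_add)
            have "bprob (all_edges n) p (\<lambda>E. \<exists>v\<in>{1..n}. real (degree E v) \<le> (51 / 100) * \<mu>)
              \<le> real n * exp (- ((7 / 50) * \<mu>))"
              using A elim by (intro prob_degree_le_chernoff) auto
            also have "\<dots> \<le> real n * exp (- ((7 / 50) * (10 * ln (real n))))"
              using False by (intro mult_left_mono) auto
            finally show "bprob (all_edges n) p (\<lambda>E. \<exists>v\<in>{1..n}. real (degree E v) \<le> (51 / 100) * \<mu>) \<le> \<epsilon> / 2"
              using elim(2) by linarith
            show "bprob (all_edges n) p (\<lambda>E. \<not> ((199 / 400) * \<mu> \<le> real (card E) / (real n - 1) \<and>
              real (card E) / (real n - 1) \<le> (51 / 100) * \<mu>)) \<le> \<epsilon> / 2"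
              using elim(4) A by blast
            fix E assume "\<exists>v\<in>{1..n}. real (degree E v) \<le> real (card E) / (real n - 1)"
            then show "(\<exists>v\<in>{1..n}. real (degree E v) \<le> (51 / 100) * \<mu>) \<or>
              \<not> ((199 / 400) * \<mu> \<le> real (card E) / (real n - 1) \<and> real (card E) / (real n - 1) \<le> (51 / 100) * \<mu>)"
              by (meson order_trans)
          qed (use A in auto)
        qed
        then show "bprob (all_edges n) p (\<lambda>E. \<exists>v\<in>{1..n}. real (degree E v) \<le> real (card E) / (real n - 1)) \<le> \<epsilon>"
          by simp
      qed
    qed
  qed
qed

lemma good_above:
  assumes E: "E \<subseteq> all_edges n" and n: "n \<ge> 2"
    and deg: "\<not> (\<exists>v\<in>{1..n}. real (degree E v) \<le> real (card E) / (real n - 1))"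
    and r: "(199 / 400) * \<mu> \<le> real (card E) / (real n - 1)" "real (card E) / (real n - 1) \<le> (51 / 100) * \<mu>"
    and typical: "\<not> locally_dense n \<mu> E" "\<not> weak_boundary n ((51 / 100) * \<mu>) E"
  shows "int (min_degree n E) > \<lfloor>real (num_edges E) / (real n - 1)\<rfloor> \<and>
     int (tree_packing n E) = \<lfloor>real (num_edges E) / (real n - 1)\<rfloor>"
proof -
  define r where "r = real (card E) / (real n - 1)"
  have r0: "r \<ge> 0" using n by (simp add: r_def)
  have "nat \<lfloor>r\<rfloor> < degree E v" if "v \<in> {1..n}" for v
  proof -
    have "r < real (degree E v)" using deg that unfolding r_def by (meson not_le)
    then show ?thesis using r0 by linarith
  qed
  then have 1: "nat \<lfloor>r\<rfloor> < min_degree n E"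
    using n by (subst min_degree_gt_iff) auto
  have 3: "real (nat \<lfloor>r\<rfloor>) \<le> r" using r0 by linarith
  have 2: "nat \<lfloor>r\<rfloor> \<le> tree_packing n E"
  proof (rule tree_packing_ge_typical[OF E n _ _ _ r(1) typical])
    show "nat \<lfloor>r\<rfloor> \<le> min_degree n E" using 1 by simp
    show "real (nat \<lfloor>r\<rfloor>) \<le> real (card E) / (real n - 1)" using 3 by (simp only: r_def)
    show "real (nat \<lfloor>r\<rfloor>) \<le> (51 / 100) * \<mu>" using 3 r(2) unfolding r_def by (rule order_trans)
  qed
  have "real (tree_packing n E * (n - 1)) \<le> real (card E)"
    using tree_packing_bounds(2)[OF E n] by (simp only: of_nat_le_iff)
  then have "real (tree_packing n E) \<le> r"
    using n by (simp add: r_def of_nat_diff pos_le_divide_eq)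
  then have "int (tree_packing n E) \<le> \<lfloor>r\<rfloor>" by linarith
  then show ?thesis using 1 2 r0 by (simp add: num_edges_def flip: r_def) linarith
qed

theorem aas_above:
  assumes w: "filterlim w at_top sequentially" and p: "\<forall>n. 0 \<le> p n \<and> p n \<le> 1"
    and pn: "\<forall>\<^sub>F n in sequentially.
      p n * (real n - 1) = beta_const * (ln (real n) - ln (ln (real n)) / 2) + w n"
  shows "aas p (\<lambda>n E. int (min_degree n E) > \<lfloor>real (num_edges E) / (real n - 1)\<rfloor>
                \<and> int (tree_packing n E) = \<lfloor>real (num_edges E) / (real n - 1)\<rfloor>)"
proof (rule aasI)
  fix \<epsilon> :: real assume \<epsilon>: "\<epsilon> > 0"
  then have e4: "\<epsilon> / 4 > 0" by simp
  obtain W where W: "\<forall>\<^sub>F n in sequentially. \<forall>p \<mu>. 0 \<le> p \<and> p \<le> 1 \<and> \<mu> = p * (real n - 1) \<and>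
      beta_const * (ln (real n) - ln (ln (real n)) / 2) + W \<le> \<mu> \<and> 1 \<le> \<mu> \<longrightarrow>
    bprob (all_edges n) p (\<lambda>E. \<exists>v\<in>{1..n}. real (degree E v) \<le> real (card E) / (real n - 1)) \<le> \<epsilon> / 4"
    using prob_degree_le_density_above[OF e4] by blast
  have wW: "\<forall>\<^sub>F n in sequentially. max W 0 \<le> w n"
    using w unfolding filterlim_at_top by blast
  have L: "\<forall>\<^sub>F n in sequentially. 1 \<le> ln (real n)" "\<forall>\<^sub>F n in sequentially. 3 * ln (ln (real n)) \<le> ln (real n)"
    by real_asymp+
  show "\<forall>\<^sub>F n in sequentially. bprob (all_edges n) (p n)
    (\<lambda>E. \<not> (int (min_degree n E) > \<lfloor>real (num_edges E) / (real n - 1)\<rfloor>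
           \<and> int (tree_packing n E) = \<lfloor>real (num_edges E) / (real n - 1)\<rfloor>)) \<le> \<epsilon>"
    using W pn wW L prob_edges_relative[OF e4] prob_locally_dense[OF e4] prob_weak_boundary_above[OF e4]
      eventually_ge_at_top[of 2]
  proof eventually_elim
    case (elim n)
    define \<mu> where "\<mu> = p n * (real n - 1)"
    have \<mu>w: "\<mu> = beta_const * (ln (real n) - ln (ln (real n)) / 2) + w n"
      using elim(2) by (simp add: \<mu>_def)
    have "6 * (ln (real n) - ln (ln (real n)) / 2) \<le> beta_const * (ln (real n) - ln (ln (real n)) / 2)"
      using elim(4,5) beta_const_bounds(1) by (intro mult_right_mono) auto
    moreover have "0 \<le> w n" using elim(3) by simp
    ultimately have "6 * (ln (real n) - ln (ln (real n)) / 2) \<le> \<mu>" unfolding \<mu>w by linarith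
    \<comment> \<open>3 log log n \<le> log n makes the log log term at most log n / 6, and 6 (1 -
      1/6) = 5.\<close>
    then have \<mu>5: "5 * ln (real n) \<le> \<mu>" using elim(4,5) by argo
    then have \<mu>1: "1 \<le> \<mu>" "(97 / 100) * ln (real n) \<le> \<mu>" using elim(4) by linarith+
    have p01: "0 \<le> p n" "p n \<le> 1" using p by auto
    have "bprob (all_edges n) (p n)
      (\<lambda>E. \<not> (int (min_degree n E) > \<lfloor>real (num_edges E) / (real n - 1)\<rfloor>
           \<and> int (tree_packing n E) = \<lfloor>real (num_edges E) / (real n - 1)\<rfloor>))
      \<le> \<epsilon> / 4 + (\<epsilon> / 4 + (\<epsilon> / 4 + \<epsilon> / 4))"
    proof (rule bprob_le_add[OF p01])
      show "bprob (all_edges n) (p n) (\<lambda>E. \<exists>v\<in>{1..n}. real (degree E v) \<le> real (card E) / (real n - 1)) \<le> \<epsilon> / 4"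
        using elim(1) p01 \<mu>1 \<mu>w elim(3) \<mu>_def by auto
      show "bprob (all_edges n) (p n) (\<lambda>E. \<not> ((199 / 400) * \<mu> \<le> real (card E) / (real n - 1) \<and>
          real (card E) / (real n - 1) \<le> (51 / 100) * \<mu>) \<or> locally_dense n \<mu> E \<or> weak_boundary n ((51 / 100) * \<mu>) E)
          \<le> \<epsilon> / 4 + (\<epsilon> / 4 + \<epsilon> / 4)"
      proof (rule bprob_le_add[OF p01])
        show "bprob (all_edges n) (p n) (\<lambda>E. \<not> ((199 / 400) * \<mu> \<le> real (card E) / (real n - 1) \<and>
          real (card E) / (real n - 1) \<le> (51 / 100) * \<mu>)) \<le> \<epsilon> / 4"
          using elim(6) p01 \<mu>1 \<mu>_def by blast
        show "bprob (all_edges n) (p n) (\<lambda>E. locally_dense n \<mu> E \<or> weak_boundary n ((51 / 100) * \<mu>) E)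
          \<le> \<epsilon> / 4 + \<epsilon> / 4"
        proof (rule bprob_le_add[OF p01])
          show "bprob (all_edges n) (p n) (locally_dense n \<mu>) \<le> \<epsilon> / 4"
            unfolding locally_dense_def using elim(7) p01 \<mu>1 unfolding \<mu>_def by blast
          show "bprob (all_edges n) (p n) (weak_boundary n ((51 / 100) * \<mu>)) \<le> \<epsilon> / 4"
            using elim(8) p01 \<mu>5 \<mu>_def by blast
        qed
      qed blast
    next
      fix E assume "E \<subseteq> all_edges n" "\<not> (int (min_degree n E) > \<lfloor>real (num_edges E) / (real n - 1)\<rfloor>
           \<and> int (tree_packing n E) = \<lfloor>real (num_edges E) / (real n - 1)\<rfloor>)"
      then show "(\<exists>v\<in>{1..n}. real (degree E v) \<le> real (card E) / (real n - 1)) \<or>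
        (\<not> ((199 / 400) * \<mu> \<le> real (card E) / (real n - 1) \<and>
          real (card E) / (real n - 1) \<le> (51 / 100) * \<mu>) \<or> locally_dense n \<mu> E \<or> weak_boundary n ((51 / 100) * \<mu>) E)"
        using good_above[of E n \<mu>] elim(9) by blast
    qed
    then show ?case by simp
  qed
qed (use p in auto)

section \<open>Below the threshold\<close>

text \<open>The witness \<open>k\<close> is the least one whose Poisson probability is not much smaller than
  \<open>1 / n\<close>: likely enough for some vertex to have degree at most \<open>k\<close>, yet so unlikely that
  no small set has a boundary of at most \<open>k\<close> edges per vertex. If \<open>k = 0\<close>, there is an
  isolated vertex and nothing is left to prove.\<close>

lemma prob_min_degree_gt_critical:
  assumes "\<epsilon> > 0"
  shows "\<forall>\<^sub>F n in sequentially. \<forall>p \<mu>. 0 \<le> p \<and> p \<le> 1 \<and> \<mu> = p * (real n - 1) \<and> \<mu> \<le> 7 * ln (real n) \<longrightarrow>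
    (\<exists>k. (k = 0 \<or> (97 / 100) * ln (real n) \<le> \<mu> \<and> real k \<le> \<mu> \<and>
            log_poisson \<mu> k \<le> - ((97 / 100) * ln (real n)) + 1 + ln \<mu>) \<and>
      bprob (all_edges n) p (\<lambda>E. \<forall>v\<in>{1..n}. k < degree E v) \<le> \<epsilon>)"
proof -
  obtain K where K: "\<forall>\<^sub>F n in sequentially. \<forall>p k \<mu>. 0 \<le> p \<and> p \<le> 1 \<and> \<mu> = p * (real n - 1) \<and> \<mu> \<le> 10 * ln (real n) \<and>
      real k \<le> 10 * ln (real n) \<and> K \<le> real n * (\<mu> ^ k * exp (- \<mu>) / fact k) \<longrightarrow>
    bprob (all_edges n) p (\<lambda>E. \<forall>v\<in>{1..n}. k < degree E v) \<le> \<epsilon>"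
    using prob_min_degree_gt_small[OF assms] by blast
  \<comment> \<open>At level -0.97 log n the Poisson expectation is at least n^(0.03)/(e sqrt(7 log
    n)), which eventually exceeds any constant demanded by the second moment bound.\<close>
  have "filterlim (\<lambda>n. exp ((3 / 100) * ln (real n) - ln (7 * ln (real n)) / 2 - 1)) at_top sequentially"
    by real_asymp
  then have eK: "\<forall>\<^sub>F n in sequentially. K \<le> exp ((3 / 100) * ln (real n) - ln (7 * ln (real n)) / 2 - 1)"
    unfolding filterlim_at_top by blast
  have L: "\<forall>\<^sub>F n in sequentially. 2 \<le> ln (real n)" by real_asymp
  show ?thesis
    using K eK L eventually_ge_at_top[of 2]
  proof eventually_elim
    case (elim n)
    show ?case
    proof (intro allI impI)
      fix p \<mu> :: real
      define L where "L = ln (real n)"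
      assume A: "0 \<le> p \<and> p \<le> 1 \<and> \<mu> = p * (real n - 1) \<and> \<mu> \<le> 7 * ln (real n)"
      have L2: "2 \<le> L" using elim(3) by (simp add: L_def)
      have \<mu>7: "0 \<le> \<mu>" "\<mu> \<le> 7 * L" using A elim(4) by (auto simp: L_def)
      define k where "k = (LEAST k. - ((97 / 100) * L) \<le> log_poisson \<mu> k)"
      have ex: "- ((97 / 100) * L) \<le> log_poisson \<mu> (nat \<lfloor>\<mu>\<rfloor>)"
        using log_poisson_floor[OF \<mu>7(1)] L2 by linarith
      then have kP: "- ((97 / 100) * L) \<le> log_poisson \<mu> k" unfolding k_def by (rule LeastI)
      have "k \<le> nat \<lfloor>\<mu>\<rfloor>" unfolding k_def using ex by (rule Least_le)
      then have k\<mu>: "real k \<le> \<mu>" using \<mu>7(1) by linarith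
      have crit: "k = 0 \<or> (97 / 100) * L \<le> \<mu> \<and> real k \<le> \<mu> \<and>
            log_poisson \<mu> k \<le> - ((97 / 100) * L) + 1 + ln \<mu>"
      proof (cases k)
        case (Suc j)
        have small: "log_poisson \<mu> i < - ((97 / 100) * L)" if "i < k" for i
          using not_less_Least that unfolding k_def by fastforce
        have "\<mu> > 0" using k\<mu> Suc by simp
        then have "log_poisson \<mu> k \<le> - ((97 / 100) * L) + 1 + ln \<mu>"
          using log_poisson_Suc_le[of \<mu> j] small[of j] Suc by simp
        \<comment> \<open>As k > 0, the value 0 misses the level; since \<open>log_poisson\<close>
          at 0 is -\<mu>, this says 0.97 L < \<mu>.\<close>
        moreover have "(97 / 100) * L \<le> \<mu>" using small[of 0] Suc by (simp add: log_poisson_def)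
        ultimately show ?thesis using k\<mu> by blast
      qed simp
      have "exp ((3 / 100) * L - ln (7 * L) / 2 - 1)
        = real n * exp (- ((97 / 100) * L) - ln (7 * L) / 2 - 1)"
      proof -
        have "real n = exp L" using elim(4) by (simp add: L_def)
        then show ?thesis by (simp flip: exp_add)
      qed
      also have "\<dots> \<le> real n * (\<mu> ^ k * exp (- \<mu>) / fact k)"
      proof (intro mult_left_mono)
        show "exp (- ((97 / 100) * L) - ln (7 * L) / 2 - 1) \<le> \<mu> ^ k * exp (- \<mu>) / fact k"
        proof (cases "k = 0")
          case True
          have "0 \<le> ln (7 * L)" using L2 by simp
          then show ?thesis using kP True by (simp add: log_poisson_def)
        next
          case False
          then have "ln (real k) \<le> ln (7 * L)" using k\<mu> \<mu>7 by simp
          then have "exp (- ((97 / 100) * L) - ln (7 * L) / 2 - 1) \<le> exp (log_poisson \<mu> k - ln (real k) / 2 - 1)"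
            using kP by simp
          also have "\<dots> \<le> \<mu> ^ k * exp (- \<mu>) / fact k"
            using False k\<mu> by (intro poisson_ge) auto
          finally show ?thesis .
        qed
      qed simp
      finally have "K \<le> real n * (\<mu> ^ k * exp (- \<mu>) / fact k)" using elim(2) by (simp add: L_def)
      moreover have "\<mu> \<le> 10 * ln (real n)" "real k \<le> 10 * ln (real n)"
        using \<mu>7 k\<mu> L2 by (auto simp: L_def)
      ultimately have "bprob (all_edges n) p (\<lambda>E. \<forall>v\<in>{1..n}. k < degree E v) \<le> \<epsilon>"
        using elim(1) A by blast
      then show "\<exists>k. (k = 0 \<or> (97 / 100) * ln (real n) \<le> \<mu> \<and> real k \<le> \<mu> \<and>
            log_poisson \<mu> k \<le> - ((97 / 100) * ln (real n)) + 1 + ln \<mu>) \<and>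
          bprob (all_edges n) p (\<lambda>E. \<forall>v\<in>{1..n}. k < degree E v) \<le> \<epsilon>"
        using crit unfolding L_def by blast
    qed
  qed
qed

text \<open>The level \<mu>/2 - 2 is below \<mu>/2 - 1, the lower end of the typical range of m/(n -
  1), so a vertex of such a degree decides the comparison.\<close>

lemma prob_min_degree_below:
  assumes "\<epsilon> > 0"
  shows "\<exists>W. \<forall>\<^sub>F n in sequentially. \<forall>p \<mu>. 0 \<le> p \<and> p \<le> 1 \<and> \<mu> = p * (real n - 1) \<and>
      (97 / 100) * ln (real n) \<le> \<mu> \<and> \<mu> \<le> 7 * ln (real n) \<and>
      \<mu> \<le> beta_const * (ln (real n) - ln (ln (real n)) / 2) - W \<longrightarrow>
    bprob (all_edges n) p (\<lambda>E. \<forall>v\<in>{1..n}. nat \<lfloor>\<mu> / 2 - 2\<rfloor> < degree E v) \<le> \<epsilon>"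
proof -
  obtain K where K: "\<forall>\<^sub>F n in sequentially. \<forall>p k \<mu>. 0 \<le> p \<and> p \<le> 1 \<and> \<mu> = p * (real n - 1) \<and> \<mu> \<le> 10 * ln (real n) \<and>
      real k \<le> 10 * ln (real n) \<and> K \<le> real n * (\<mu> ^ k * exp (- \<mu>) / fact k) \<longrightarrow>
    bprob (all_edges n) p (\<lambda>E. \<forall>v\<in>{1..n}. k < degree E v) \<le> \<epsilon>"
    using prob_min_degree_gt_small[OF assms] by blast
  \<comment> \<open>The summand 7 is 6 from \<open>log_poisson_ge\<close> plus 1 from Stirling, ln 7
    / 2 comes from k \<le> 7 log n, and \<open>max K 1\<close> makes the logarithm of the required
    expectation meaningful.\<close>
  define W where "W = beta_const * (ln (max K 1) + 7 + ln 7 / 2)"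
  have L: "\<forall>\<^sub>F n in sequentially. 10 \<le> ln (real n)" by real_asymp
  show ?thesis
  proof (intro exI[of _ W])
    show "\<forall>\<^sub>F n in sequentially. \<forall>p \<mu>. 0 \<le> p \<and> p \<le> 1 \<and> \<mu> = p * (real n - 1) \<and>
        (97 / 100) * ln (real n) \<le> \<mu> \<and> \<mu> \<le> 7 * ln (real n) \<and>
        \<mu> \<le> beta_const * (ln (real n) - ln (ln (real n)) / 2) - W \<longrightarrow>
      bprob (all_edges n) p (\<lambda>E. \<forall>v\<in>{1..n}. nat \<lfloor>\<mu> / 2 - 2\<rfloor> < degree E v) \<le> \<epsilon>"
      using K L eventually_ge_at_top[of 2]
    proof eventually_elim
      case (elim n)
      show ?case
      proof (intro allI impI)
        fix p \<mu> :: real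
        define L where "L = ln (real n)"
        assume A: "0 \<le> p \<and> p \<le> 1 \<and> \<mu> = p * (real n - 1) \<and>
          (97 / 100) * ln (real n) \<le> \<mu> \<and> \<mu> \<le> 7 * ln (real n) \<and>
          \<mu> \<le> beta_const * (ln (real n) - ln (ln (real n)) / 2) - W"
        have L10: "10 \<le> L" using elim by (simp add: L_def)
        have \<mu>: "(97 / 100) * L \<le> \<mu>" "\<mu> \<le> 7 * L" "\<mu> \<le> beta_const * (L - ln L / 2) - W"
          using A by (auto simp: L_def)
        define k where "k = nat \<lfloor>\<mu> / 2 - 2\<rfloor>"
        have k: "real k \<le> \<mu> / 2 - 2" "\<mu> / 2 - 3 \<le> real k" "1 \<le> k"
          using \<mu>(1) L10 unfolding k_def by linarith+
        have "\<mu> / beta_const \<le> (beta_const * (L - ln L / 2) - W) / beta_const"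
          using \<mu>(3) beta_const_bounds(1) by (intro divide_right_mono) auto
        also have "\<dots> = L - ln L / 2 - (ln (max K 1) + 7 + ln 7 / 2)"
          using beta_const_bounds(1) by (simp add: W_def diff_divide_distrib)
        finally have \<mu>b: "\<mu> / beta_const \<le> L - ln L / 2 - (ln (max K 1) + 7 + ln 7 / 2)" .
        have "ln (real k) \<le> ln (7 * L)" using k \<mu> L10 by simp
        also have "\<dots> = ln 7 + ln L" using L10 by (simp add: ln_mult)
        finally have lk: "ln (real k) \<le> ln 7 + ln L" .
        have lp: "- \<mu> / beta_const - 6 \<le> log_poisson \<mu> k"
          using k by (intro log_poisson_ge) auto
        have "K \<le> exp (ln (max K 1))" by simp
        also have "\<dots> \<le> exp (L + (log_poisson \<mu> k - ln (real k) / 2 - 1))"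
        proof -
          have "ln (max K 1) \<le> L + (log_poisson \<mu> k - ln (real k) / 2 - 1)"
            using \<mu>b lk lp minus_divide_left[of \<mu> beta_const] by linarith
          then show ?thesis by (simp only: exp_le_cancel_iff)
        qed
        also have "\<dots> = real n * exp (log_poisson \<mu> k - ln (real k) / 2 - 1)"
          using elim(3) by (simp only: exp_add) (simp add: L_def)
        also have "\<dots> \<le> real n * (\<mu> ^ k * exp (- \<mu>) / fact k)"
          using k \<mu> L10 by (intro mult_left_mono poisson_ge) auto
        finally have "K \<le> real n * (\<mu> ^ k * exp (- \<mu>) / fact k)" .
        moreover have "\<mu> \<le> 10 * ln (real n)" "real k \<le> 10 * ln (real n)"
          using \<mu> k L10 unfolding L_def by linarith+
        ultimately show "bprob (all_edges n) p (\<lambda>E. \<forall>v\<in>{1..n}. nat \<lfloor>\<mu> / 2 - 2\<rfloor> < degree E v) \<le> \<epsilon>"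
          using elim(1) A unfolding k_def by blast
      qed
    qed
  qed
qed

text \<open>With the optimal z the tail per vertex is the Poisson rate at k, about n^(-0.97), so the
  base of the union bound is about n^(1/2 - 0.97 + 0.07) up to logarithmic factors.\<close>

lemma prob_weak_boundary_below:
  assumes "\<epsilon> > 0"
  shows "\<forall>\<^sub>F n in sequentially. \<forall>p \<mu> k. 0 \<le> p \<and> p \<le> 1 \<and> \<mu> = p * (real n - 1) \<and>
      (97 / 100) * ln (real n) \<le> \<mu> \<and> \<mu> \<le> 7 * ln (real n) \<and> k \<ge> 1 \<and> real k \<le> \<mu> \<and>
      log_poisson \<mu> k \<le> - ((97 / 100) * ln (real n)) + 1 + ln \<mu> \<longrightarrow>
    bprob (all_edges n) p (weak_boundary n (real k)) \<le> \<epsilon>"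
proof -
  define f where "f = (\<lambda>n. exp 1 * ((sqrt (real n) * sqrt (2 * (7 * ln (real n)))) *
    exp (- ((97 / 100) * ln (real n)) + 1 + ln (7 * ln (real n)) + (1 / 100) * (7 * ln (real n)))))"
  have "(f \<longlongrightarrow> 0) sequentially" unfolding f_def by real_asymp
  then have "\<forall>\<^sub>F n in sequentially. f n < min (1/2) (\<epsilon> / 4)"
    using assms by (intro order_tendstoD) auto
  then show ?thesis
    using eventually_ge_at_top[of 2]
  proof eventually_elim
    case (elim n)
    show ?case
    proof (intro allI impI)
      fix p \<mu> :: real and k :: nat
      assume A: "0 \<le> p \<and> p \<le> 1 \<and> \<mu> = p * (real n - 1) \<and>
        (97 / 100) * ln (real n) \<le> \<mu> \<and> \<mu> \<le> 7 * ln (real n) \<and> k \<ge> 1 \<and> real k \<le> \<mu> \<and>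
        log_poisson \<mu> k \<le> - ((97 / 100) * ln (real n)) + 1 + ln \<mu>"
      have \<mu>0: "\<mu> > 0" using A by linarith
      then have p0: "p > 0" using A by (cases "p = 0") auto
      have k0: "real k > 0" using A by simp
      \<comment> \<open>This minimises the Chernoff bound for a mean \<mu>. The factor 99/100 only
        adds (\<mu> - k)/100 to the exponent \<open>log_poisson\<close>, and that is at most 0.07
        log n.\<close>
      define z where "z = real k / \<mu>"
      have z: "0 < z" "z \<le> 1" using A \<mu>0 by (auto simp: z_def)
      have "ln z = - ln (\<mu> / real k)" using k0 \<mu>0 by (simp add: z_def ln_div)
      then have "z powr (- real k) * exp (- ((99 / 100) * \<mu> * (1 - z)))
        = exp (real k * ln (\<mu> / real k)) * exp (- ((99 / 100) * \<mu> * (1 - z)))"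
        using z by (simp add: powr_def)
      also have "\<dots> = exp (real k * ln (\<mu> / real k) - (99 / 100) * (\<mu> - real k))"
        using \<mu>0 by (simp add: z_def algebra_simps flip: exp_add)
      also have "\<dots> \<le> exp (- ((97 / 100) * ln (real n)) + 1 + ln (7 * ln (real n)) + (1 / 100) * (7 * ln (real n)))"
      proof -
        have "ln \<mu> \<le> ln (7 * ln (real n))" using A \<mu>0 by simp
        moreover have "real k + real k * ln (\<mu> / real k) - \<mu> \<le> - ((97 / 100) * ln (real n)) + 1 + ln \<mu>"
          "\<mu> \<le> 7 * ln (real n)"
          using A unfolding log_poisson_def by blast+
        ultimately show ?thesis using k0 unfolding exp_le_cancel_iff by argo
      qed
      finally have D: "z powr (- real k) * exp (- ((99 / 100) * (p * (real n - 1)) * (1 - z)))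
        \<le> exp (- ((97 / 100) * ln (real n)) + 1 + ln (7 * ln (real n)) + (1 / 100) * (7 * ln (real n)))"
        using A by simp
      define x where "x = exp 1 * real n * sqrt p * (z powr (- real k) *
        exp (- ((99 / 100) * (p * (real n - 1)) * (1 - z))))"
      have s: "real n * sqrt p \<le> sqrt (real n) * sqrt (2 * (7 * ln (real n)))"
      proof -
        have "real n * sqrt p \<le> sqrt (real n) * sqrt (2 * \<mu>)"
          using A elim by (intro n_sqrt_p_le) auto
        also have "\<dots> \<le> sqrt (real n) * sqrt (2 * (7 * ln (real n)))"
          using A by (intro mult_left_mono real_sqrt_le_mono) auto
        finally show ?thesis .
      qed
      have "x = exp 1 * ((real n * sqrt p) * (z powr (- real k) *
        exp (- ((99 / 100) * (p * (real n - 1)) * (1 - z)))))" by (simp add: x_def)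
      also have "\<dots> \<le> f n"
        unfolding f_def by (intro mult_left_mono mult_mono[OF s D]) (use elim(2) in auto)
      finally have x: "x \<le> 1 / 2" "4 * x \<le> \<epsilon>" using elim by auto
      have "bprob (all_edges n) p (weak_boundary n (real k)) \<le> 4 * x"
        unfolding weak_boundary_def
        by (rule prob_dense_violation[OF p0 _ elim(2) z _ x_def x(1)]) (use A in auto)
      then show "bprob (all_edges n) p (weak_boundary n (real k)) \<le> \<epsilon>" using x by simp
    qed
  qed
qed

lemma good_below:
  assumes E: "E \<subseteq> all_edges n" and n: "n \<ge> 2" and \<mu>: "400 \<le> \<mu>"
    and k: "min_degree n E \<le> k" "min_degree n E \<le> nat \<lfloor>\<mu> / 2 - 2\<rfloor>"
    and r: "\<mu> / 2 - 1 \<le> real (card E) / (real n - 1)"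
    and typical: "\<not> locally_dense n \<mu> E" "\<not> weak_boundary n (real k) E"
  shows "int (min_degree n E) \<le> \<lfloor>real (num_edges E) / (real n - 1)\<rfloor> \<and>
     tree_packing n E = min_degree n E"
proof -
  have 1: "real (min_degree n E) \<le> real (card E) / (real n - 1)"
    using k(2) r \<mu> by linarith
  \<comment> \<open>\<mu> \<ge> 400 makes \<mu>/400 at least the margin 1 in the edge count
    bound.\<close>
  have "(199 / 400) * \<mu> \<le> real (card E) / (real n - 1)" using r \<mu> by linarith
  then have "min_degree n E \<le> tree_packing n E"
    using 1 k by (intro tree_packing_ge_typical[OF E n _ _ _ _ typical]) auto
  then have "tree_packing n E = min_degree n E"
    using tree_packing_bounds(1)[OF E n] by simp
  moreover have "int (min_degree n E) \<le> \<lfloor>real (num_edges E) / (real n - 1)\<rfloor>"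
    using 1 by (simp add: num_edges_def le_floor_iff)
  ultimately show ?thesis by simp
qed

lemma good_isolated:
  assumes E: "E \<subseteq> all_edges n" and n: "n \<ge> 2" and "min_degree n E = 0"
  shows "int (min_degree n E) \<le> \<lfloor>real (num_edges E) / (real n - 1)\<rfloor> \<and>
     tree_packing n E = min_degree n E"
  using tree_packing_bounds(1)[OF E n] assms by simp

theorem aas_below:
  assumes w: "filterlim w at_top sequentially" and p: "\<forall>n. 0 \<le> p n \<and> p n \<le> 1"
    and pn: "\<forall>\<^sub>F n in sequentially.
      p n * (real n - 1) = beta_const * (ln (real n) - ln (ln (real n)) / 2) - w n"
  shows "aas p (\<lambda>n E. int (min_degree n E) \<le> \<lfloor>real (num_edges E) / (real n - 1)\<rfloor>
                \<and> tree_packing n E = min_degree n E)"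
proof (rule aasI)
  fix \<epsilon> :: real assume \<epsilon>: "\<epsilon> > 0"
  then have e5: "\<epsilon> / 5 > 0" by simp
  obtain W where W: "\<forall>\<^sub>F n in sequentially. \<forall>p \<mu>. 0 \<le> p \<and> p \<le> 1 \<and> \<mu> = p * (real n - 1) \<and>
      (97 / 100) * ln (real n) \<le> \<mu> \<and> \<mu> \<le> 7 * ln (real n) \<and>
      \<mu> \<le> beta_const * (ln (real n) - ln (ln (real n)) / 2) - W \<longrightarrow>
    bprob (all_edges n) p (\<lambda>E. \<forall>v\<in>{1..n}. nat \<lfloor>\<mu> / 2 - 2\<rfloor> < degree E v) \<le> \<epsilon> / 5"
    using prob_min_degree_below[OF e5] by blast
  have wW: "\<forall>\<^sub>F n in sequentially. max W 0 \<le> w n"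
    using w unfolding filterlim_at_top by blast
  have L: "\<forall>\<^sub>F n in sequentially. 500 \<le> ln (real n)" by real_asymp
  show "\<forall>\<^sub>F n in sequentially. bprob (all_edges n) (p n)
    (\<lambda>E. \<not> (int (min_degree n E) \<le> \<lfloor>real (num_edges E) / (real n - 1)\<rfloor>
           \<and> tree_packing n E = min_degree n E)) \<le> \<epsilon>"
    using W pn wW L prob_edges_absolute[OF e5] prob_locally_dense[OF e5] prob_weak_boundary_below[OF e5]
      prob_min_degree_gt_critical[OF e5] eventually_ge_at_top[of 2]
  proof eventually_elim
    case (elim n)
    define \<mu> where "\<mu> = p n * (real n - 1)"
    have \<mu>w: "\<mu> = beta_const * (ln (real n) - ln (ln (real n)) / 2) - w n"
      using elim(2) by (simp add: \<mu>_def)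
    have "0 \<le> ln (ln (real n))" using elim(4) by simp
    then have "beta_const * (ln (real n) - ln (ln (real n)) / 2) \<le> beta_const * ln (real n)"
      using beta_const_bounds(1) by (intro mult_left_mono) auto
    also have "\<dots> \<le> 7 * ln (real n)"
      using elim(4) beta_const_bounds(2) by (intro mult_right_mono) auto
    finally have \<mu>7: "\<mu> \<le> 7 * ln (real n)" using \<mu>w elim(3) by linarith
    have \<mu>W: "\<mu> \<le> beta_const * (ln (real n) - ln (ln (real n)) / 2) - W" using \<mu>w elim(3) by linarith
    have p01: "0 \<le> p n" "p n \<le> 1" using p by auto
    let ?bad = "\<lambda>E. \<not> (int (min_degree n E) \<le> \<lfloor>real (num_edges E) / (real n - 1)\<rfloor>
           \<and> tree_packing n E = min_degree n E)"
    obtain k where k: "k = 0 \<or> (97 / 100) * ln (real n) \<le> \<mu> \<and> real k \<le> \<mu> \<and>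
            log_poisson \<mu> k \<le> - ((97 / 100) * ln (real n)) + 1 + ln \<mu>"
      and kP: "bprob (all_edges n) (p n) (\<lambda>E. \<forall>v\<in>{1..n}. k < degree E v) \<le> \<epsilon> / 5"
      using elim(8) p01 \<mu>_def \<mu>7 by blast
    have deg: "(\<forall>v\<in>{1..n}. j < degree E v) \<longleftrightarrow> j < min_degree n E" for j E
      using elim(9) by (subst min_degree_gt_iff) auto
    show ?case
    proof (cases "k = 0")
      \<comment> \<open>This case covers every density too small for the other estimates, including
        p = 0: up to probability \<epsilon>/5 there is an isolated vertex.\<close>
      case True
      have "bprob (all_edges n) (p n) ?bad \<le> bprob (all_edges n) (p n) (\<lambda>E. \<forall>v\<in>{1..n}. k < degree E v)"
        using p01 good_isolated[OF _ elim(9)] unfolding deg True by (intro bprob_mono) blast+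
      then show ?thesis using kP \<epsilon> by linarith
    next
      case False
      then have k1: "(97 / 100) * ln (real n) \<le> \<mu>" "real k \<le> \<mu>" "1 \<le> k"
        "log_poisson \<mu> k \<le> - ((97 / 100) * ln (real n)) + 1 + ln \<mu>" using k by auto
      then have \<mu>400: "400 \<le> \<mu>" using elim(4) by linarith
      have \<mu>10: "\<mu> \<le> 10 * ln (real n)" using \<mu>7 elim(4) by linarith
      let ?B1 = "\<lambda>E. k < min_degree n E" and ?B2 = "\<lambda>E. nat \<lfloor>\<mu> / 2 - 2\<rfloor> < min_degree n E"
      let ?B3 = "\<lambda>E. \<not> (\<mu> / 2 - 1 \<le> real (card E) / (real n - 1) \<and> real (card E) / (real n - 1) < \<mu> / 2 + 2)"
      have B1: "bprob (all_edges n) (p n) ?B1 \<le> \<epsilon> / 5" using kP unfolding deg .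
      have B2: "bprob (all_edges n) (p n) ?B2 \<le> \<epsilon> / 5"
        using elim(1) p01 k1(1) \<mu>7 \<mu>W \<mu>_def unfolding deg by blast
      have B3: "bprob (all_edges n) (p n) ?B3 \<le> \<epsilon> / 5"
        using elim(5) p01 \<mu>_def \<mu>10 by blast
      have B4: "bprob (all_edges n) (p n) (locally_dense n \<mu>) \<le> \<epsilon> / 5"
        unfolding locally_dense_def using elim(6) p01 k1(1) unfolding \<mu>_def by blast
      have B5: "bprob (all_edges n) (p n) (weak_boundary n (real k)) \<le> \<epsilon> / 5"
        using elim(7) p01 k1 \<mu>7 \<mu>_def by blast
      have "bprob (all_edges n) (p n) ?bad \<le> \<epsilon> / 5 + (\<epsilon> / 5 + (\<epsilon> / 5 + (\<epsilon> / 5 + \<epsilon> / 5)))"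
      proof (rule bprob_le_add[OF p01 _ B1 bprob_le_add[OF p01 _ B2 bprob_le_add[OF p01 _ B3
              bprob_le_add[OF p01 _ B4 B5]]]])
        fix E assume E: "E \<subseteq> all_edges n" and bad: "?bad E"
        show "?B1 E \<or> (?B2 E \<or> (?B3 E \<or> (locally_dense n \<mu> E \<or> weak_boundary n (real k) E)))"
          using good_below[OF E elim(9) \<mu>400, of k] bad by (meson not_less)
      qed assumption+
      then show ?thesis by simp
    qed
  qed
qed (use p in auto)

theorem theorem2p2:
  fixes w :: "nat \<Rightarrow> real"
  assumes w_inf: "filterlim w at_top sequentially"
  shows
    "(\<forall>p :: nat \<Rightarrow> real.
        (\<forall>n. 0 \<le> p n \<and> p n \<le> 1) \<longrightarrow>
        (\<forall>\<^sub>F n in sequentially.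
            p n * (real n - 1) = beta_const * (ln (real n) - ln (ln (real n)) / 2) - w n) \<longrightarrow>
        aas p (\<lambda>n E. int (min_degree n E) \<le> \<lfloor>real (num_edges E) / (real n - 1)\<rfloor>
                      \<and> tree_packing n E = min_degree n E))
   \<and>
    (\<forall>p :: nat \<Rightarrow> real.
        (\<forall>n. 0 \<le> p n \<and> p n \<le> 1) \<longrightarrow>
        (\<forall>\<^sub>F n in sequentially.
            p n * (real n - 1) = beta_const * (ln (real n) - ln (ln (real n)) / 2) + w n) \<longrightarrow>
        aas p (\<lambda>n E. int (min_degree n E) > \<lfloor>real (num_edges E) / (real n - 1)\<rfloor>
                      \<and> int (tree_packing n E) = \<lfloor>real (num_edges E) / (real n - 1)\<rfloor>))"
  using aas_below[OF w_inf] aas_above[OF w_inf] by blast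

end
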